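(* Let $u_1,\ldots,u_p\in\mathcal{U}$ (not necessarily distinct), let $X_l=D_lY(u_l)D_{l+1}$ for $1\le l\le p$, and let $B=X_1X_2\cdots X_p$. Then for every $k\in\mathbb{N}$ $$\lim_{n\to\infty}\tau_1\big((BB^* )^k\big)=\sum_{\sigma\in\mathcal{NC}^2(W_0^k)}\ \prod_{\text{blocks }V\text{ of }\sigma} w(V),$$ where the weight of a block $V$ of $\sigma$ is $$w(V)=\begin{cases} r_{i(V)+1}(u_V) & \text{if the depth of } V \text{ is odd},\\ d(V) & \text{if the depth of } V\text{ is even}.\end{cases}$$
   Context: **Random matrices.** Fix $p\in\mathbb{N}$. For each $n$ let $n=n_1+\ldots+n_{p+1}$ with natural numbers $n_j$ depending on $n$, such that $d_j=\lim_{n\to\infty}n_j/n>0$ exists for $1\le j\le p+1$ (the asymptotic dimensions). Let $D_j$ be the $n\times n$ diagonal matrix whose only nonzero entries are $(D_j)_{i,i}=1$ for $n_1+\ldots+n_{j-1}<i\le n_1+\ldots+n_j$. Let $\mathbb{E}$ be classical expectation, $\tau(A)=\frac1n\mathbb{E}(\mathrm{Tr}(A))$ for $n\times n$ random matrices, and $\tau_j(A)=\frac1{n_j}\mathbb{E}(\mathrm{Tr}(D_jA))$ the normalized partial traces. Let $\{Y(u):u\in\mathcal{U}\}$ be a family ($\mathcal U$ a finite set of labels) of independent Hermitian $n\times n$ random matrices (dependence on $n$ is suppressed) such that: (A1) the family is asymptotically free under $\tau$; (A2) the family is asymptotically free under $\tau$ against the family of deterministic diagonal matrices; (A3) the norms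 of the matrices $Y(u)$ are uniformly bounded almost surely. Let $\nu(u)$ be the limit distribution of $Y(u)$ under $\tau$ and $(r_k(u))_{k\ge1}$ its free cumulants. **Words and pair partitions.** Let $\widetilde W=12\ldots(2p)(2p)^*\ldots2^*1^*$ (length $4p$). In $\widetilde W$ the letters $2j-1,\,2j,\,(2j)^*,\,(2j-1)^*$ carry the label $u_j$, for $1\le j\le p$. Let $W_0$ be the word of length $4p$ obtained from $\widetilde W$ by replacing each letter $2i+1$ by $(2i)^*$ and each letter $(2i+1)^*$ by $2i$, for $1\le i\le p-1$, keeping all other letters; thus $$W_0=1\,2\,2^*\,4\,4^*\ldots (2p)(2p)^*\,(2p-2)(2p-2)^*\ldots 4\,4^*\,2\,2^*\,1^*.$$ Each position of $W_0$ keeps the label that the letter of $\widetilde W$ at the same position carries. $\mathcal{NC}^2(W_0^k)$ is the set of noncrossing pair partitions of $\{1,\ldots,4pk\}$ such that, coloring the leg $s$ by the $s$-th letter of $W_0^k$ (and giving it the corresponding label), the two legs of every block are colored by $\{j,j^*\}$ for some $j\in\{1,2,4,\ldots,2p\}$ and carry the same label. For a block $V$ this common label is denoted $u_V$. **Depth and inner blocks.** A block $\{c<d\}$ is an inner block of a block $\{a<b\}$ (and the latter is an outer block of the former) if $a<c<d<b$. It is a nearest inner block if there is no block which is simultaneously an outer block of $\{c,d\}$ and an inner block of $\{a,b\}$. $i(V)$ denotes the number of nearest inner blocks of $V$. A block without outer blocks has depth $1$, and otherwise the depth of a block is one more than the depth of its nearest outer block (so the depth of $V$ is one plus the number of outer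 blocks of $V$). **Dimensions.** For a block $V$ of even depth: $d(V)=d_1$ if (left leg, right leg) are colored by $(1^*,1)$; $d(V)=d_{j+1}$ if (left leg, right leg) are colored by $(2j,(2j)^* )$ or by $((2j)^*,2j)$, $1\le j\le p$. (Blocks colored by $(1,1^* )$ always have odd depth.) *)

theory Defs
  imports
    "HOL-Probability.Probability"
    "HOL-Library.Disjoint_Sets"
    "Jordan_Normal_Form.Schur_Decomposition"
begin

section \<open>Noncrossing partitions and free cumulants\<close>

definition noncrossing :: "nat set set \<Rightarrow> bool" where
  "noncrossing P \<longleftrightarrow>
     (\<forall>S\<in>P. \<forall>T\<in>P. S \<noteq> T \<longrightarrow>
        \<not> (\<exists>a\<in>S. \<exists>b\<in>T. \<exists>c\<in>S. \<exists>d\<in>T. a < b \<and> b < c \<and> c < d))"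

definition NC :: "nat \<Rightarrow> nat set set set" where
  "NC k = {P. partition_on {1..k} P \<and> noncrossing P}"

definition NC2 :: "nat \<Rightarrow> nat set set set" where
  "NC2 k = {P \<in> NC k. \<forall>V\<in>P. card V = 2}"

lemma finite_NC: "finite (NC k)"
  unfolding NC_def
  by (rule finite_subset[of _ "{P. partition_on {1..k} P}"])
     (auto simp: finitely_many_partition_on)

lemma NC_block_card_less:
  assumes "P \<in> NC k" "P \<noteq> {{1..k}}" "V \<in> P"
  shows "card V < k"
proof -
  have part: "partition_on {1..k} P" using assms(1) by (simp add: NC_def)
  have "V \<subseteq> {1..k}" using part assms(3) by (auto simp: partition_on_def)
  moreover have "V \<noteq> {1..k}"
  proof
    assume eq: "V = {1..k}"
    have "W = V" if "W \<in> P" for W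
    proof (rule ccontr)
      assume "W \<noteq> V"
      hence "W \<inter> V = {}" using part assms(3) that by (auto simp: partition_on_def disjoint_def)
      moreover have "W \<subseteq> V" "W \<noteq> {}" using part that eq by (auto simp: partition_on_def)
      ultimately show False by auto
    qed
    hence "P = {V}" using assms(3) by blast
    thus False using assms(2) eq by simp
  qed
  ultimately have "V \<subset> {1..k}" by auto
  from psubset_card_mono[OF _ this] show ?thesis by simp
qed

text \<open>The free cumulants of a sequence of moments, obtained by solving the moment-cumulant
  formula (lemma \<open>moment_free_cumulant\<close>) for its one-block term.\<close>

function free_cumulant :: "(nat \<Rightarrow> complex) \<Rightarrow> nat \<Rightarrow> complex" where
  "free_cumulant m k =
     m k - (\<Sum>P \<in> NC k - {{{1..k}}}. \<Prod>V\<in>P. free_cumulant m (card V))"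
  by auto
termination
  by (relation "Wellfounded.measure snd") (auto intro: NC_block_card_less)

declare free_cumulant.simps [simp del]

lemma moment_free_cumulant:
  assumes "k \<ge> 1"
  shows "m k = (\<Sum>P \<in> NC k. \<Prod>V\<in>P. free_cumulant m (card V))"
proof -
  have "{{1..k}} \<in> NC k"
    using assms by (auto simp: NC_def noncrossing_def partition_on_def disjoint_def)
  hence "(\<Sum>P \<in> NC k. \<Prod>V\<in>P. free_cumulant m (card V)) =
      (\<Prod>V\<in>{{1..k}}. free_cumulant m (card V)) +
      (\<Sum>P \<in> NC k - {{{1..k}}}. \<Prod>V\<in>P. free_cumulant m (card V))"
    by (rule sum.remove[OF finite_NC])
  also have "(\<Prod>V\<in>{{1..k}}. free_cumulant m (card V)) = free_cumulant m k"
    by simp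
  also have "free_cumulant m k +
      (\<Sum>P \<in> NC k - {{{1..k}}}. \<Prod>V\<in>P. free_cumulant m (card V)) = m k"
    using free_cumulant.simps[of m k] by (simp only: eq_diff_eq)
  finally show ?thesis by (rule sym)
qed

section \<open>Freeness\<close>

text \<open>A noncommutative polynomial in the variables \<open>X i\<close> (\<open>i :: 'i\<close>) is its finitely supported
  coefficient function on words; \<open>ncpoly_set J\<close> is the unital algebra generated by the
  \<open>X i\<close> with \<open>i \<in> J\<close>. A linear functional on polynomials is given by its values on words.\<close>

definition ncpoly_set :: "'i set \<Rightarrow> ('i list \<Rightarrow> complex) set" where
  "ncpoly_set J = {P. finite {w. P w \<noteq> 0} \<and> (\<forall>w. P w \<noteq> 0 \<longrightarrow> w \<in> lists J)}"

definition ncpoly_one :: "'i list \<Rightarrow> complex" where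
  "ncpoly_one w = (if w = [] then 1 else 0)"

definition ncpoly_mult :: "('i list \<Rightarrow> complex) \<Rightarrow> ('i list \<Rightarrow> complex) \<Rightarrow> 'i list \<Rightarrow> complex" where
  "ncpoly_mult P Q w = (\<Sum>k\<le>length w. P (take k w) * Q (drop k w))"

definition lin_ext :: "('i list \<Rightarrow> complex) \<Rightarrow> ('i list \<Rightarrow> complex) \<Rightarrow> complex" where
  "lin_ext \<phi> P = (\<Sum>w | P w \<noteq> 0. P w * \<phi> w)"

text \<open>The variables indexed by \<open>I\<close> are grouped by the map \<open>g\<close>; the algebras generated by the
  different groups are free with respect to \<open>\<phi>\<close>. Each list entry is a pair of a group and a
  centred polynomial in the variables of that group.\<close>

definition free_family :: "('i list \<Rightarrow> complex) \<Rightarrow> 'i set \<Rightarrow> ('i \<Rightarrow> 'g) \<Rightarrow> bool" where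
  "free_family \<phi> I g \<longleftrightarrow>
     (\<forall>Ps. Ps \<noteq> [] \<longrightarrow> distinct_adj (map fst Ps) \<longrightarrow>
        (\<forall>(c, P) \<in> set Ps.
            c \<in> g ` I \<and> P \<in> ncpoly_set {i \<in> I. g i = c} \<and> lin_ext \<phi> P = 0) \<longrightarrow>
        lin_ext \<phi> (foldr ncpoly_mult (map snd Ps) ncpoly_one) = 0)"

section \<open>Random matrices\<close>

definition mat_trace :: "complex mat \<Rightarrow> complex" where
  "mat_trace A = (\<Sum>i<dim_row A. A $$ (i, i))"

definition mat_list_prod :: "nat \<Rightarrow> complex mat list \<Rightarrow> complex mat" where
  "mat_list_prod n As = foldr (*) As (1\<^sub>m n)"

definition l2_norm :: "complex Matrix.vec \<Rightarrow> real" where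
  "l2_norm v = sqrt (\<Sum>i<dim_vec v. (cmod (vec_index v i))\<^sup>2)"

definition mat_norm :: "complex mat \<Rightarrow> real" where
  "mat_norm A = (SUP v \<in> {v \<in> carrier_vec (dim_col A). l2_norm v \<le> 1}. l2_norm (A *\<^sub>v v))"

definition hermitian_mat :: "complex mat \<Rightarrow> bool" where
  "hermitian_mat A \<longleftrightarrow> mat_adjoint A = A"

definition tau :: "'w measure \<Rightarrow> nat \<Rightarrow> ('w \<Rightarrow> complex mat) \<Rightarrow> complex" where
  "tau M n A = (1 / of_nat n) * integral\<^sup>L M (\<lambda>\<omega>. mat_trace (A \<omega>))"

text \<open>Independence of \<open>n \<times> n\<close> random matrices: independence of the tuples of their entries
  (this includes the measurability of all entries).\<close>

definition indep_matrices ::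
    "'w measure \<Rightarrow> nat \<Rightarrow> ('u \<Rightarrow> 'w \<Rightarrow> complex mat) \<Rightarrow> 'u set \<Rightarrow> bool" where
  "indep_matrices M n Y U \<longleftrightarrow>
     prob_space.indep_vars M (\<lambda>_. \<Pi>\<^sub>M ij \<in> {..<n} \<times> {..<n}. borel)
       (\<lambda>u \<omega>. \<lambda>ij \<in> {..<n} \<times> {..<n}. Y u \<omega> $$ ij) U"

text \<open>A family \<open>a\<close> indexed by \<open>i \<in> I\<close> of sequences of random matrices (\<open>a i n\<close> is the \<open>n \<times> n\<close>
  one) has the joint limit distribution \<open>\<phi>\<close> under \<open>tau\<close>: its mixed moments exist and converge
  to those of \<open>\<phi>\<close>. It is asymptotically free, with respect to the grouping \<open>g\<close> of the indices,
  if it has a joint limit distribution for which the groups of variables are free.\<close>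

definition has_joint_limit ::
    "'w measure \<Rightarrow> ('i \<Rightarrow> nat \<Rightarrow> 'w \<Rightarrow> complex mat) \<Rightarrow> 'i set \<Rightarrow> ('i list \<Rightarrow> complex) \<Rightarrow> bool" where
  "has_joint_limit M a I \<phi> \<longleftrightarrow>
     (\<forall>w \<in> lists I.
        (\<forall>n. integrable M (\<lambda>\<omega>. mat_trace (mat_list_prod n (map (\<lambda>i. a i n \<omega>) w)))) \<and>
        (\<lambda>n. tau M n (\<lambda>\<omega>. mat_list_prod n (map (\<lambda>i. a i n \<omega>) w))) \<longlonglongrightarrow> \<phi> w)"

definition asymptotically_free ::
    "'w measure \<Rightarrow> ('i \<Rightarrow> nat \<Rightarrow> 'w \<Rightarrow> complex mat) \<Rightarrow> 'i set \<Rightarrow> ('i \<Rightarrow> 'g) \<Rightarrow> bool" where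
  "asymptotically_free M a I g \<longleftrightarrow> (\<exists>\<phi>. has_joint_limit M a I \<phi> \<and> free_family \<phi> I g)"

text \<open>The family \<open>{Y u : u \<in> U}\<close> is asymptotically free against the deterministic diagonal
  matrices: for all uniformly bounded sequences \<open>\<Delta> 0, \<Delta> 1, \<dots>\<close> of deterministic diagonal
  matrices that have a joint limit distribution, the two families \<open>{Y u : u \<in> U}\<close> and
  \<open>{\<Delta> 0, \<Delta> 1, \<dots>}\<close> are asymptotically free. (A finite family of \<open>\<Delta>\<close>'s is covered by
  repeating or adding zero matrices.)\<close>

definition asymptotically_free_from_diagonal ::
    "'w measure \<Rightarrow> ('u \<Rightarrow> nat \<Rightarrow> 'w \<Rightarrow> complex mat) \<Rightarrow> 'u set \<Rightarrow> bool" where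
  "asymptotically_free_from_diagonal M Y U \<longleftrightarrow>
     (\<forall>\<Delta> :: nat \<Rightarrow> nat \<Rightarrow> complex mat.
        (\<forall>i n. \<Delta> i n \<in> carrier_mat n n \<and> diagonal_mat (\<Delta> i n)) \<longrightarrow>
        (\<forall>i. \<exists>C. \<forall>n. mat_norm (\<Delta> i n) \<le> C) \<longrightarrow>
        (\<exists>\<psi>. has_joint_limit M (\<lambda>i n \<omega>. \<Delta> i n) UNIV \<psi>) \<longrightarrow>
        asymptotically_free M (case_sum Y (\<lambda>i n \<omega>. \<Delta> i n)) (U <+> UNIV) isl)"

text \<open>The limit distribution of a single matrix, as its sequence of moments.\<close>

definition has_limit_moments ::
    "'w measure \<Rightarrow> (nat \<Rightarrow> 'w \<Rightarrow> complex mat) \<Rightarrow> (nat \<Rightarrow> complex) \<Rightarrow> bool" where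
  "has_limit_moments M Y m \<longleftrightarrow> (\<forall>k. (\<lambda>n. tau M n (\<lambda>\<omega>. Y n \<omega> ^\<^sub>m k)) \<longlonglongrightarrow> m k)"

text \<open>Throughout, \<open>N j n\<close> is the \<open>j\<close>-th block size \<open>n\<^sub>j\<close> in dimension \<open>n\<close>, with \<open>j\<close> counted from 1;
  matrix indices are counted from 0.\<close>

definition block_diag :: "(nat \<Rightarrow> nat \<Rightarrow> nat) \<Rightarrow> nat \<Rightarrow> nat \<Rightarrow> complex mat" where
  "block_diag N j n = mat n n (\<lambda>(i, l).
     if i = l \<and> (\<Sum>m\<in>{1..<j}. N m n) \<le> i \<and> i < (\<Sum>m\<in>{1..j}. N m n) then 1 else 0)"

definition partial_tau ::
    "'w measure \<Rightarrow> (nat \<Rightarrow> nat \<Rightarrow> nat) \<Rightarrow> nat \<Rightarrow> nat \<Rightarrow> ('w \<Rightarrow> complex mat) \<Rightarrow> complex" where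
  "partial_tau M N j n A =
     (1 / of_nat (N j n)) * integral\<^sup>L M (\<lambda>\<omega>. mat_trace (block_diag N j n * A \<omega>))"

definition X_block ::
    "(nat \<Rightarrow> nat \<Rightarrow> nat) \<Rightarrow> ('u \<Rightarrow> nat \<Rightarrow> 'w \<Rightarrow> complex mat) \<Rightarrow> (nat \<Rightarrow> 'u) \<Rightarrow> nat \<Rightarrow> nat \<Rightarrow> 'w \<Rightarrow> complex mat"
  where
  "X_block N Y u l n \<omega> = block_diag N l n * Y (u l) n \<omega> * block_diag N (l + 1) n"

definition B_prod ::
    "nat \<Rightarrow> (nat \<Rightarrow> nat \<Rightarrow> nat) \<Rightarrow> ('u \<Rightarrow> nat \<Rightarrow> 'w \<Rightarrow> complex mat) \<Rightarrow> (nat \<Rightarrow> 'u) \<Rightarrow> nat \<Rightarrow> 'w \<Rightarrow> complex mat"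
  where
  "B_prod p N Y u n \<omega> = mat_list_prod n (map (\<lambda>l. X_block N Y u l n \<omega>) [1..<p + 1])"

section \<open>Words and coloured noncrossing pair partitions\<close>

datatype letter = Plain (letter_index: nat) | Star (letter_index: nat)

definition W_tilde :: "nat \<Rightarrow> letter list" where
  "W_tilde p = map Plain [1..<2 * p + 1] @ map Star (rev [1..<2 * p + 1])"

text \<open>The letters with index \<open>2j-1\<close> and \<open>2j\<close> carry the label \<open>u j\<close>.\<close>

definition W_labels :: "nat \<Rightarrow> (nat \<Rightarrow> 'u) \<Rightarrow> 'u list" where
  "W_labels p u = map (\<lambda>x. u ((letter_index x + 1) div 2)) (W_tilde p)"

text \<open>\<open>2i+1\<close> becomes \<open>(2i)\<^sup>*\<close> and \<open>(2i+1)\<^sup>*\<close> becomes \<open>2i\<close> for \<open>i \<ge> 1\<close>.\<close>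

fun W_subst :: "letter \<Rightarrow> letter" where
  "W_subst (Plain m) = (if odd m \<and> m \<ge> 3 then Star (m - 1) else Plain m)"
| "W_subst (Star m) = (if odd m \<and> m \<ge> 3 then Plain (m - 1) else Star m)"

definition W0 :: "nat \<Rightarrow> letter list" where
  "W0 p = map W_subst (W_tilde p)"

lemma W0_3:
  "W0 3 = [Plain 1, Plain 2, Star 2, Plain 4, Star 4, Plain 6, Star 6,
           Plain 4, Star 4, Plain 2, Star 2, Star 1]"
  by code_simp

definition word_power :: "'a list \<Rightarrow> nat \<Rightarrow> 'a list" where
  "word_power w k = concat (replicate k w)"

text \<open>Colour and label of the leg \<open>s\<close>; legs are counted from 1.\<close>

definition leg_colour :: "nat \<Rightarrow> nat \<Rightarrow> nat \<Rightarrow> letter" where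
  "leg_colour p k s = word_power (W0 p) k ! (s - 1)"

definition leg_label :: "nat \<Rightarrow> (nat \<Rightarrow> 'u) \<Rightarrow> nat \<Rightarrow> nat \<Rightarrow> 'u" where
  "leg_label p u k s = word_power (W_labels p u) k ! (s - 1)"

definition NC2_W0 :: "nat \<Rightarrow> (nat \<Rightarrow> 'u) \<Rightarrow> nat \<Rightarrow> nat set set set" where
  "NC2_W0 p u k = {\<sigma> \<in> NC2 (4 * p * k). \<forall>V\<in>\<sigma>.
     (\<exists>j \<in> {1} \<union> {2 * i | i. i \<in> {1..p}}. leg_colour p k ` V = {Plain j, Star j}) \<and>
     (\<exists>v. leg_label p u k ` V = {v})}"

definition block_label :: "nat \<Rightarrow> (nat \<Rightarrow> 'u) \<Rightarrow> nat \<Rightarrow> nat set \<Rightarrow> 'u" where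
  "block_label p u k V = leg_label p u k (Min V)"

definition inner_block :: "nat set \<Rightarrow> nat set \<Rightarrow> bool" where
  "inner_block V W \<longleftrightarrow> Min W < Min V \<and> Max V < Max W"

definition nearest_inner :: "nat set set \<Rightarrow> nat set \<Rightarrow> nat set \<Rightarrow> bool" where
  "nearest_inner \<sigma> V W \<longleftrightarrow> inner_block V W \<and> \<not> (\<exists>T\<in>\<sigma>. inner_block V T \<and> inner_block T W)"

definition num_nearest_inner :: "nat set set \<Rightarrow> nat set \<Rightarrow> nat" where
  "num_nearest_inner \<sigma> V = card {T \<in> \<sigma>. nearest_inner \<sigma> T V}"

definition depth :: "nat set set \<Rightarrow> nat set \<Rightarrow> nat" where
  "depth \<sigma> V = 1 + card {T \<in> \<sigma>. inner_block V T}"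

lemma depth_outermost:
  assumes "\<not> (\<exists>T\<in>\<sigma>. inner_block V T)"
  shows "depth \<sigma> V = 1"
proof -
  have "{T \<in> \<sigma>. inner_block V T} = {}" using assms by auto
  thus ?thesis unfolding depth_def by (metis card.empty add_0_right)
qed

lemma depth_nearest_outer:
  assumes s: "\<sigma> \<in> NC2 m" and V: "V \<in> \<sigma>" and W: "W \<in> \<sigma>" and near: "nearest_inner \<sigma> V W"
  shows "depth \<sigma> V = depth \<sigma> W + 1"
proof -
  have part: "partition_on {1..m} \<sigma>" and nc: "noncrossing \<sigma>" and c2: "\<And>T. T \<in> \<sigma> \<Longrightarrow> card T = 2"
    using s by (auto simp: NC2_def NC_def)
  have fin\<sigma>: "finite \<sigma>" using finite_elements[OF _ part] by simp
  have fin: "finite T" "T \<noteq> {}" if "T \<in> \<sigma>" for T using c2[OF that] by (auto intro: card_ge_0_finite)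
  have mem: "Min T \<in> T" "Max T \<in> T" "Min T \<le> Max T" if "T \<in> \<sigma>" for T
    using fin[OF that] by auto
  have inVW: "inner_block V W" using near by (simp add: nearest_inner_def)
  have "{T \<in> \<sigma>. inner_block V T} = insert W {T \<in> \<sigma>. inner_block W T}"
  proof (intro equalityI subsetI)
    fix T assume "T \<in> {T \<in> \<sigma>. inner_block V T}"
    hence T: "T \<in> \<sigma>" "inner_block V T" by auto
    show "T \<in> insert W {T \<in> \<sigma>. inner_block W T}"
    proof (cases "T = W")
      case False
      have disj: "T \<inter> W = {}" using part T W False by (auto simp: partition_on_def disjoint_def)
      have ne: "Min T \<noteq> Min W" "Max T \<noteq> Max W"
        using mem(1,2)[OF T(1)] mem(1,2)[OF W] disj by (metis disjoint_iff)+
      have nin: "\<not> inner_block T W" using near T by (auto simp: nearest_inner_def)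
      have lt: "Min T < Min V" "Max V < Max T" "Min W < Min V" "Max V < Max W" "Min V \<le> Max V"
        using T inVW mem[OF V] by (auto simp: inner_block_def)
      have a: "\<not> (Min T < Min W \<and> Max T < Max W)"
      proof
        assume "Min T < Min W \<and> Max T < Max W"
        moreover have "Min W < Max T" using lt by linarith
        ultimately show False using nc mem(1,2)[OF T(1)] mem(1,2)[OF W] T(1) W False
          unfolding noncrossing_def by blast
      qed
      have b: "\<not> (Min W < Min T \<and> Max W < Max T)"
      proof
        assume "Min W < Min T \<and> Max W < Max T"
        moreover have "Min T < Max W" using lt by linarith
        ultimately show False using nc mem(1,2)[OF T(1)] mem(1,2)[OF W] T(1) W False
          unfolding noncrossing_def by blast
      qed
      have "inner_block W T" using a b ne nin unfolding inner_block_def by linarith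
      thus ?thesis using T by simp
    qed simp
  next
    fix T assume "T \<in> insert W {T \<in> \<sigma>. inner_block W T}"
    thus "T \<in> {T \<in> \<sigma>. inner_block V T}" using W inVW by (auto simp: inner_block_def)
  qed
  moreover have "W \<notin> {T \<in> \<sigma>. inner_block W T}" by (auto simp: inner_block_def)
  ultimately show ?thesis using fin\<sigma> unfolding depth_def by simp
qed

text \<open>Index 1 gives \<open>d\<^sub>1\<close> and index \<open>2j\<close> gives \<open>d\<^sub>j\<^sub>+\<^sub>1\<close>; used for blocks of even depth only, where the
  colour pair \<open>(1, 1\<^sup>*)\<close> does not occur.\<close>

definition block_dim :: "nat \<Rightarrow> nat \<Rightarrow> (nat \<Rightarrow> real) \<Rightarrow> nat set \<Rightarrow> real" where
  "block_dim p k d V =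
     (let m = letter_index (leg_colour p k (Min V)) in if m = 1 then d 1 else d (m div 2 + 1))"

definition block_weight ::
    "nat \<Rightarrow> (nat \<Rightarrow> 'u) \<Rightarrow> nat \<Rightarrow> (nat \<Rightarrow> real) \<Rightarrow> ('u \<Rightarrow> nat \<Rightarrow> complex) \<Rightarrow> nat set set \<Rightarrow> nat set \<Rightarrow> complex"
  where
  "block_weight p u k d r \<sigma> V =
     (if odd (depth \<sigma> V) then r (block_label p u k V) (num_nearest_inner \<sigma> V + 1)
      else of_real (block_dim p k d V))"

end

theory Submission
  imports Defs
begin

text \<open>Up to the factor \<open>1 / d\<^sub>1\<close>, the limit of \<open>\<tau>\<^sub>1((BB\<^sup>*)\<^sup>k)\<close> is the value of the limit
functional \<open>\<phi>\<close> on one alternating word \<open>D Y D Y \<dots> Y D\<close> with \<open>2pk\<close> factors \<open>Y\<close>. Freeness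
evaluates such a word as a sum over the noncrossing partitions \<open>\<pi>\<close> of the \<open>Y\<close>'s: a block of
\<open>\<pi>\<close> contributes a free cumulant (which vanishes unless all its labels agree), and a block of the
Kreweras complement of \<open>\<pi>\<close> contributes \<open>\<phi>\<close> of the product of its \<open>D\<close>'s. Since the \<open>D\<close>'s are
orthogonal projections, this last factor is \<open>d\<^sub>f\<close> if all these \<open>D\<close>'s are equal to \<open>D\<^sub>f\<close>, and
0 otherwise. Now give every \<open>Y\<close> a left and a right leg. A block of \<open>\<pi>\<close> with \<open>s\<close> elements becomes a
pair of odd depth, which joins the outermost legs of the block, together with its \<open>s - 1\<close> nearest
inner pairs of even depth, which join the right leg of each element to the left leg of the next
one; this is why the odd pair carries \<open>r\<^sub>s\<close> with \<open>s\<close> equal to one plus its number of nearest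
inner blocks. Each pair of even depth encloses one block of the Kreweras complement, and hence carries
a dimension; the block that is not enclosed consists of \<open>D\<^sub>1\<close>'s and cancels \<open>1 / d\<^sub>1\<close>. The colours
of a pair are admissible exactly if the two \<open>D\<close>'s adjacent to its legs are equal; these lie outside
a pair of odd depth and inside a pair of even depth.

The formal proof never forms a Kreweras complement. Both sides satisfy the same recursion, and
\<open>word_pair_sum\<close> compares them by induction on the length of the word.

On the analytic side the recursion is the Schwinger-Dyson equation, which expands \<open>\<phi>(Y w)\<close> over
the block of \<open>\<pi>\<close> that contains the first letter. The key result is \<open>schwinger_dyson_extend\<close>:
if the equation for the letter \<open>u\<close> holds for words in the variables of the group of \<open>u\<close>, freeness of the groups
extends it to all words. It is used twice: freeness of the \<open>Y\<close>'s
among each other passes from the powers of one variable to words in all the \<open>Y\<close>'s, and freeness from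
the diagonal matrices passes to words in the \<open>Y\<close>'s and \<open>D\<close>'s. For the powers of one variable the
equation is the moment-cumulant formula, decomposed at the first element of a partition
(\<open>moments_schwinger_dyson\<close>).

On the combinatorial side the recursion removes the pair that contains the first leg
(\<open>pair_sum_rec\<close> and \<open>children_sum_rec\<close>). This splits a pairing into the part inside that pair,
where the parity of the depth is reversed, and the part to its right.\<close>

section \<open>Alternating centred words\<close>

text \<open>The value of a linear functional \<open>F\<close> on the product of the centred words
\<open>w\<^sub>1 - \<phi>(w\<^sub>1), \<dots>, w\<^sub>m - \<phi>(w\<^sub>m)\<close>. The product is expanded from the left, so that only values of
\<open>F\<close> on words occur and no arithmetic with polynomials is needed later on. A word comes
together with the name of the group that its letters belong to.\<close>

primrec centred_eval :: "('i list \<Rightarrow> complex) \<Rightarrow> ('g \<times> 'i list) list \<Rightarrow> ('i list \<Rightarrow> complex) \<Rightarrow> complex" where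
  "centred_eval \<phi> [] F = F []"
| "centred_eval \<phi> (p # ws) F = centred_eval \<phi> ws (\<lambda>x. F (snd p @ x)) - \<phi> (snd p) * centred_eval \<phi> ws F"

lemma centred_eval_add: "centred_eval \<phi> ws (\<lambda>x. F x + G x) = centred_eval \<phi> ws F + centred_eval \<phi> ws G"
  by (induction ws arbitrary: F G) (auto simp: algebra_simps)

lemma centred_eval_scale: "centred_eval \<phi> ws (\<lambda>x. c * F x) = c * centred_eval \<phi> ws F"
  by (induction ws arbitrary: F) (auto simp: algebra_simps)

lemma centred_eval_diff: "centred_eval \<phi> ws (\<lambda>x. F x - G x) = centred_eval \<phi> ws F - centred_eval \<phi> ws G"
  using centred_eval_add[of \<phi> ws F "\<lambda>x. -1 * G x"] centred_eval_scale[of \<phi> ws "-1" G] by simp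

lemma centred_eval_zero: "centred_eval \<phi> ws (\<lambda>x. 0) = 0"
  by (induction ws) auto

lemma centred_eval_sum: "centred_eval \<phi> ws (\<lambda>x. \<Sum>i\<in>A. F i x) = (\<Sum>i\<in>A. centred_eval \<phi> ws (F i))"
  by (induction A rule: infinite_finite_induct) (auto simp: centred_eval_zero centred_eval_add)

lemma centred_eval_snoc:
  "centred_eval \<phi> (ws @ [p]) F = centred_eval \<phi> ws (\<lambda>x. F (x @ snd p)) - \<phi> (snd p) * centred_eval \<phi> ws F"
  by (induction ws arbitrary: F) (simp_all add: right_diff_distrib)

definition group_words :: "'i set \<Rightarrow> ('i \<Rightarrow> 'g) \<Rightarrow> ('g \<times> 'i list) list \<Rightarrow> bool" where
  "group_words I g ws \<longleftrightarrow> (\<forall>p \<in> set ws. fst p \<in> g ` I \<and> snd p \<in> lists {i \<in> I. g i = fst p})"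

lemma group_words_simps [simp]:
  "group_words I g []"
  "group_words I g (p # ws) \<longleftrightarrow> fst p \<in> g ` I \<and> snd p \<in> lists {i \<in> I. g i = fst p} \<and> group_words I g ws"
  "group_words I g (vs @ ws) \<longleftrightarrow> group_words I g vs \<and> group_words I g ws"
  unfolding group_words_def by (simp_all add: ball_Un)

lemma lin_ext_superset:
  assumes "finite A" "\<And>w. P w \<noteq> 0 \<Longrightarrow> w \<in> A"
  shows "lin_ext F P = (\<Sum>w\<in>A. P w * F w)"
  unfolding lin_ext_def using assms by (intro sum.mono_neutral_left) auto

text \<open>The noncommutative polynomial \<open>w - \<phi>(w)\<close>, as a coefficient function.\<close>

definition centred_word :: "('i list \<Rightarrow> complex) \<Rightarrow> 'i list \<Rightarrow> 'i list \<Rightarrow> complex" where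
  "centred_word \<phi> w x = (if x = w then 1 else 0) - (if x = [] then \<phi> w else 0)"

lemma centred_word_in_ncpoly_set:
  assumes "w \<in> lists J" shows "centred_word \<phi> w \<in> ncpoly_set J"
proof -
  have "{x. centred_word \<phi> w x \<noteq> 0} \<subseteq> {w, []}" by (auto simp: centred_word_def split: if_splits)
  thus ?thesis using assms finite_subset[of _ "{w, []}"]
    unfolding ncpoly_set_def by (auto simp: centred_word_def split: if_splits)
qed

lemma lin_ext_centred_word:
  assumes "\<phi> [] = 1" shows "lin_ext \<phi> (centred_word \<phi> w) = 0"
proof -
  have "lin_ext \<phi> (centred_word \<phi> w) = (\<Sum>x\<in>{w, []}. centred_word \<phi> w x * \<phi> x)"
    by (rule lin_ext_superset) (auto simp: centred_word_def split: if_splits)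
  thus ?thesis using assms by (cases "w = []") (auto simp: centred_word_def)
qed

lemma ncpoly_mult_centred_word:
  "ncpoly_mult (centred_word \<phi> w) Q x =
     (if \<exists>y. x = w @ y then Q (drop (length w) x) else 0) - \<phi> w * Q x"
proof -
  have "ncpoly_mult (centred_word \<phi> w) Q x =
      (\<Sum>k\<le>length x. (if take k x = w then Q (drop k x) else 0))
      - (\<Sum>k\<le>length x. (if take k x = [] then \<phi> w * Q (drop k x) else 0))"
    unfolding ncpoly_mult_def centred_word_def sum_subtractf[symmetric]
    by (rule sum.cong) (auto simp: algebra_simps)
  moreover have "(\<Sum>k\<le>length x. (if take k x = [] then \<phi> w * Q (drop k x) else 0))
      = (\<Sum>k\<le>length x. (if k = 0 then \<phi> w * Q x else 0))"
    by (rule sum.cong) auto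
  moreover have "(\<Sum>k\<le>length x. (if take k x = w then Q (drop k x) else 0))
      = (\<Sum>k\<le>length x. (if k = length w then if \<exists>y. x = w @ y then Q (drop (length w) x) else 0 else 0))"
  proof (rule sum.cong)
    fix k assume "k \<in> {..length x}"
    hence "take k x = w \<longleftrightarrow> k = length w \<and> (\<exists>y. x = w @ y)"
      by (auto simp: append_eq_conv_conj) (metis append_take_drop_id)
    thus "(if take k x = w then Q (drop k x) else 0) =
        (if k = length w then if \<exists>y. x = w @ y then Q (drop (length w) x) else 0 else 0)" by auto
  qed simp
  moreover have "\<not> length w \<le> length x \<Longrightarrow> \<nexists>y. x = w @ y" by auto
  ultimately show ?thesis by (auto simp: sum.delta)
qed

lemma lin_ext_mult_centred_word:
  assumes fin: "finite {x. Q x \<noteq> 0}"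
  shows "finite {x. ncpoly_mult (centred_word \<phi> w) Q x \<noteq> 0}"
    and "lin_ext F (ncpoly_mult (centred_word \<phi> w) Q) = lin_ext (\<lambda>x. F (w @ x)) Q - \<phi> w * lin_ext F Q"
proof -
  let ?S = "{x. Q x \<noteq> 0}" let ?P = "ncpoly_mult (centred_word \<phi> w) Q"
  let ?A = "(@) w ` ?S \<union> ?S"
  have sup: "x \<in> ?A" if "?P x \<noteq> 0" for x
    using that by (auto simp: ncpoly_mult_centred_word split: if_splits)
  have finA: "finite ?A" using fin by auto
  show "finite {x. ?P x \<noteq> 0}" using sup by (intro finite_subset[OF _ finA]) auto
  let ?R = "\<lambda>x. if \<exists>y. x = w @ y then Q (drop (length w) x) else 0"
  have "lin_ext F ?P = (\<Sum>x\<in>?A. ?P x * F x)" by (rule lin_ext_superset[OF finA sup])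
  also have "\<dots> = (\<Sum>x\<in>?A. ?R x * F x) - \<phi> w * (\<Sum>x\<in>?A. Q x * F x)"
    unfolding ncpoly_mult_centred_word by (simp add: left_diff_distrib sum_subtractf sum_distrib_left mult.assoc)
  also have "(\<Sum>x\<in>?A. Q x * F x) = lin_ext F Q"
    by (rule lin_ext_superset[OF finA, symmetric]) auto
  also have "(\<Sum>x\<in>?A. ?R x * F x) = (\<Sum>x\<in>(@) w ` ?S. ?R x * F x)"
    by (rule sum.mono_neutral_right[OF finA]) auto
  also have "\<dots> = (\<Sum>x\<in>?S. Q x * F (w @ x))"
    by (subst sum.reindex) (auto simp: inj_on_def)
  finally show "lin_ext F ?P = lin_ext (\<lambda>x. F (w @ x)) Q - \<phi> w * lin_ext F Q"
    by (simp add: lin_ext_def)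
qed

lemma lin_ext_prod_centred_words:
  "finite {x. foldr ncpoly_mult (map (centred_word \<phi> \<circ> snd) ws) ncpoly_one x \<noteq> 0} \<and>
   lin_ext F (foldr ncpoly_mult (map (centred_word \<phi> \<circ> snd) ws) ncpoly_one) = centred_eval \<phi> ws F"
proof (induction ws arbitrary: F)
  case Nil
  have "{x :: 'a list. ncpoly_one x \<noteq> 0} = {[]}" by (auto simp: ncpoly_one_def)
  thus ?case by (simp add: lin_ext_def ncpoly_one_def)
next
  case (Cons p ws)
  thus ?case using lin_ext_mult_centred_word[of "foldr ncpoly_mult (map (centred_word \<phi> \<circ> snd) ws) ncpoly_one"]
    by (simp add: comp_def)
qed

text \<open>Freeness enters the proof through this equation. Nothing is lost by passing to centred words, since
they span the centred polynomials of each group.\<close>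

lemma free_family_centred_eval:
  assumes free: "free_family \<phi> I g" and unit: "\<phi> [] = 1"
    and ws: "group_words I g ws" "distinct_adj (map fst ws)" "ws \<noteq> []"
  shows "centred_eval \<phi> ws \<phi> = 0"
proof -
  let ?Ps = "map (\<lambda>(c, w). (c, centred_word \<phi> w)) ws"
  have "lin_ext \<phi> (foldr ncpoly_mult (map snd ?Ps) ncpoly_one) = 0"
  proof (rule free[unfolded free_family_def, rule_format])
    show "?Ps \<noteq> []" using ws by simp
    have "map fst ?Ps = map fst ws" by (simp add: case_prod_beta comp_def)
    thus "distinct_adj (map fst ?Ps)" using ws(2) by (simp only:)
    fix q assume "q \<in> set ?Ps"
    thus "case q of (c, P) \<Rightarrow> c \<in> g ` I \<and> P \<in> ncpoly_set {i \<in> I. g i = c} \<and> lin_ext \<phi> P = 0"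
      using ws(1) unfolding group_words_def
      by (force intro!: centred_word_in_ncpoly_set lin_ext_centred_word unit)
  qed
  moreover have "map snd ?Ps = map (centred_word \<phi> \<circ> snd) ws" by auto
  ultimately show ?thesis using lin_ext_prod_centred_words[of \<phi> ws \<phi>] by (simp only:)
qed

text \<open>Apart from the full product, expanding the centred words leads only to products of fewer
words.\<close>

lemma centred_eval_eq_concat:
  assumes "group_words I g ws"
    and "\<And>vs. group_words I g vs \<Longrightarrow> length vs < length ws \<Longrightarrow> F (concat (map snd vs)) = 0"
  shows "centred_eval \<phi> ws F = F (concat (map snd ws))"
  using assms
proof (induction ws arbitrary: F)
  case (Cons p ws)
  have "centred_eval \<phi> ws F = F (concat (map snd ws))"
    using Cons.prems by (intro Cons.IH) auto
  moreover have "F (concat (map snd ws)) = 0" using Cons.prems by auto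
  moreover have "centred_eval \<phi> ws (\<lambda>x. F (snd p @ x)) = F (snd p @ concat (map snd ws))"
  proof (rule Cons.IH)
    fix vs assume "group_words I g vs" "length vs < length ws"
    thus "F (snd p @ concat (map snd vs)) = 0"
      using Cons.prems(1) Cons.prems(2)[of "p # vs"] by simp
  qed (use Cons.prems in auto)
  ultimately show ?case by simp
qed simp

lemma not_distinct_adj_split:
  "\<not> distinct_adj (map f xs) \<Longrightarrow> \<exists>as x y bs. xs = as @ x # y # bs \<and> f x = f y"
proof (induction xs)
  case (Cons x xs)
  show ?case
  proof (cases "distinct_adj (map f xs)")
    case True
    with Cons.prems obtain y ys where "xs = y # ys" "f x = f y"
      by (cases xs) auto
    thus ?thesis by (metis append_Nil)
  next
    case False
    with Cons.IH show ?thesis by (metis append_Cons)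
  qed
qed simp

text \<open>Alternating products of centred words span all polynomials. By induction on the number of
factors: adjacent factors from the same group are merged, and an alternating product differs from
its centred version by products with fewer factors.\<close>

lemma zero_if_centred_eval_zero:
  assumes "\<And>ws. group_words I g ws \<Longrightarrow> distinct_adj (map fst ws) \<Longrightarrow> centred_eval \<phi> ws F = 0"
    and w: "w \<in> lists I"
  shows "F w = 0"
proof -
  have "F (concat (map snd ws)) = 0" if "group_words I g ws" for ws
    using that
  proof (induction "length ws" arbitrary: ws rule: less_induct)
    case less
    show ?case
    proof (cases "distinct_adj (map fst ws)")
      case True
      thus ?thesis using assms(1) less centred_eval_eq_concat[of I g ws F \<phi>] by auto
    next
      case False
      then obtain as p q bs where ws: "ws = as @ p # q # bs" "fst p = fst q"
        using not_distinct_adj_split by blast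
      have "F (concat (map snd (as @ (fst p, snd p @ snd q) # bs))) = 0"
        using less.prems ws by (intro less.hyps) auto
      thus ?thesis using ws by simp
    qed
  qed
  from this[of "map (\<lambda>i. (g i, [i])) w"] w show ?thesis
    by (auto simp: group_words_def comp_def)
qed

section \<open>The Schwinger-Dyson equation for free variables\<close>

text \<open>One step of the Schwinger-Dyson recursion: the choice of an occurrence of \<open>u\<close> splits a word into two
parts, which are then evaluated separately.\<close>

definition cut :: "'i \<Rightarrow> ('i list \<Rightarrow> complex) \<Rightarrow> ('i list \<Rightarrow> complex) \<Rightarrow> 'i list \<Rightarrow> complex" where
  "cut u A B w = (\<Sum>i | i < length w \<and> w ! i = u. A (take i w) * B (drop (Suc i) w))"

lemma cut_append:
  "cut u A B (v @ x) =
     (\<Sum>i | i < length v \<and> v ! i = u. A (take i v) * B (drop (Suc i) v @ x)) + cut u (\<lambda>y. A (v @ y)) B x"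
proof -
  let ?f = "\<lambda>i. A (take i (v @ x)) * B (drop (Suc i) (v @ x))"
  let ?J = "{i. i < length x \<and> x ! i = u}"
  have "{i. i < length (v @ x) \<and> (v @ x) ! i = u} =
      {i. i < length v \<and> v ! i = u} \<union> (\<lambda>i. length v + i) ` ?J"
  proof (intro equalityI subsetI)
    fix i assume i: "i \<in> {i. i < length (v @ x) \<and> (v @ x) ! i = u}"
    show "i \<in> {i. i < length v \<and> v ! i = u} \<union> (\<lambda>i. length v + i) ` ?J"
    proof (cases "i < length v")
      case False
      hence "i = length v + (i - length v)" "i - length v \<in> ?J" using i by (auto simp: nth_append)
      thus ?thesis by blast
    qed (use i in \<open>auto simp: nth_append\<close>)
  qed (auto simp: nth_append)
  hence "cut u A B (v @ x) = (\<Sum>i\<in>{i. i < length v \<and> v ! i = u} \<union> (\<lambda>i. length v + i) ` ?J. ?f i)"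
    unfolding cut_def by (simp only:)
  also have "\<dots> = (\<Sum>i | i < length v \<and> v ! i = u. ?f i) + (\<Sum>i\<in>(\<lambda>i. length v + i) ` ?J. ?f i)"
    by (rule sum.union_disjoint) auto
  also have "(\<Sum>i\<in>(\<lambda>i. length v + i) ` ?J. ?f i) = cut u (\<lambda>y. A (v @ y)) B x"
    unfolding cut_def by (subst sum.reindex) (auto simp: inj_on_def)
  also have "(\<Sum>i | i < length v \<and> v ! i = u. ?f i) = (\<Sum>i | i < length v \<and> v ! i = u. A (take i v) * B (drop (Suc i) v @ x))"
    by (rule sum.cong) auto
  finally show ?thesis .
qed

text \<open>Leibniz rule: the letter \<open>u\<close> is found in exactly one of the centred factors. The
factors before it are evaluated by \<open>A\<close> and those after it by \<open>B\<close>; the constant that is subtracted from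
the chosen factor contains no \<open>u\<close> and is lost.\<close>

lemma centred_eval_cut:
  "centred_eval \<phi> ws (cut u A B) =
     (\<Sum>j<length ws. \<Sum>i | i < length (snd (ws ! j)) \<and> snd (ws ! j) ! i = u.
        centred_eval \<phi> (take j ws) (\<lambda>x. A (x @ take i (snd (ws ! j)))) *
        centred_eval \<phi> (drop (Suc j) ws) (\<lambda>x. B (drop (Suc i) (snd (ws ! j)) @ x)))"
proof (induction ws arbitrary: A)
  case Nil
  show ?case by (simp add: cut_def)
next
  case (Cons p ws)
  let ?w = "snd p"
  let ?T = "\<lambda>A ws j. \<Sum>i | i < length (snd (ws ! j)) \<and> snd (ws ! j) ! i = u.
        centred_eval \<phi> (take j ws) (\<lambda>x. A (x @ take i (snd (ws ! j)))) *
        centred_eval \<phi> (drop (Suc j) ws) (\<lambda>x. B (drop (Suc i) (snd (ws ! j)) @ x))"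
  have "centred_eval \<phi> (p # ws) (cut u A B) =
      ?T A (p # ws) 0 + (\<Sum>j<length ws. ?T (\<lambda>y. A (?w @ y)) ws j) - \<phi> ?w * (\<Sum>j<length ws. ?T A ws j)"
    by (simp add: cut_append centred_eval_add centred_eval_sum centred_eval_scale Cons.IH)
  also have "(\<Sum>j<length ws. ?T (\<lambda>y. A (?w @ y)) ws j) - \<phi> ?w * (\<Sum>j<length ws. ?T A ws j)
      = (\<Sum>j<length ws. ?T A (p # ws) (Suc j))"
    unfolding sum_distrib_left sum_subtractf[symmetric]
    by (intro sum.cong) (auto simp: algebra_simps)
  hence "?T A (p # ws) 0 + (\<Sum>j<length ws. ?T (\<lambda>y. A (?w @ y)) ws j) - \<phi> ?w * (\<Sum>j<length ws. ?T A ws j)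
      = ?T A (p # ws) 0 + (\<Sum>j<length ws. ?T A (p # ws) (Suc j))" by simp
  also have "\<dots> = (\<Sum>j<length (p # ws). ?T A (p # ws) j)"
    by (simp add: sum.lessThan_Suc_shift del: sum.lessThan_Suc)
  finally show ?case .
qed

text \<open>The flanking words \<open>v\<close> and \<open>y\<close> are the sums of their centred parts and constants. Each of the
four resulting products is alternating and centred.\<close>

lemma centred_eval_flanked_zero:
  assumes free: "free_family \<phi> I g" and unit: "\<phi> [] = 1" and u: "u \<in> I"
    and vy: "v \<in> lists {i \<in> I. g i = g u}" "y \<in> lists {i \<in> I. g i = g u}"
    and ws: "group_words I g ws" "distinct_adj (map fst ws)" "ws \<noteq> []"
      "fst (hd ws) \<noteq> g u" "fst (last ws) \<noteq> g u"
  shows "centred_eval \<phi> ws (\<lambda>x. \<phi> (v @ x @ y)) = 0"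
proof -
  note zero = free_family_centred_eval[OF free unit]
  have hl: "hd (map fst ws) \<noteq> g u" "last (map fst ws) \<noteq> g u"
    using ws by (auto simp: hd_map last_map)
  have r: "distinct_adj (map fst (ws @ [(g u, y)]))"
    using ws hl by (simp add: distinct_adj_append_iff)
  have "distinct_adj (g u # map fst ws)" and "distinct_adj (g u # map fst (ws @ [(g u, y)]))"
    using ws hl r by (cases ws; simp add: distinct_adj_Cons)+
  hence "centred_eval \<phi> ((g u, v) # ws @ [(g u, y)]) \<phi> = 0" "centred_eval \<phi> ((g u, v) # ws) \<phi> = 0"
    "centred_eval \<phi> (ws @ [(g u, y)]) \<phi> = 0" "centred_eval \<phi> ws \<phi> = 0"
    using ws vy u r by (intro zero; auto)+
  thus ?thesis by (simp add: centred_eval_snoc)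
qed

text \<open>For \<open>t = 0\<close> this is the right-hand side of the Schwinger-Dyson equation for \<open>\<phi>(u w)\<close>: the sum over
all ways to choose further letters \<open>u\<close> in \<open>w = x\<^sub>1 u x\<^sub>2 u \<dots> u x\<^sub>s\<close> of
\<open>\<kappa>\<^sub>s \<phi>(x\<^sub>1) \<dots> \<phi>(x\<^sub>s)\<close>. The parameter \<open>t\<close> counts the letters \<open>u\<close> that have already been chosen after the
first one.\<close>

function schwinger_dyson ::
    "('i list \<Rightarrow> complex) \<Rightarrow> (nat \<Rightarrow> complex) \<Rightarrow> 'i \<Rightarrow> nat \<Rightarrow> 'i list \<Rightarrow> complex" where
  "schwinger_dyson \<phi> \<kappa> u t w = \<kappa> (Suc t) * \<phi> w +
     (\<Sum>i | i < length w \<and> w ! i = u. \<phi> (take i w) * schwinger_dyson \<phi> \<kappa> u (Suc t) (drop (Suc i) w))"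
  by auto
termination
  by (relation "Wellfounded.measure (\<lambda>(\<phi>, \<kappa>, u, t, w). length w)") auto

declare schwinger_dyson.simps [simp del]

lemma schwinger_dyson_cut:
  "schwinger_dyson \<phi> \<kappa> u t = (\<lambda>w. \<kappa> (Suc t) * \<phi> w + cut u \<phi> (schwinger_dyson \<phi> \<kappa> u (Suc t)) w)"
  by (rule ext) (subst schwinger_dyson.simps, simp add: cut_def)

text \<open>If some chosen letter \<open>u\<close> lies in one of the centred words, the gap before the first such
letter is an alternating product of centred words, flanked by words of the group of \<open>u\<close>, and
\<open>\<phi>\<close> vanishes on it. If none does, the last gap contains all the centred words, and \<open>\<phi>\<close> vanishes on it
as well.\<close>

lemma schwinger_dyson_centred_zero:
  assumes free: "free_family \<phi> I g" and unit: "\<phi> [] = 1" and u: "u \<in> I"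
    and v: "v \<in> lists {i \<in> I. g i = g u}"
    and ws: "group_words I g ws" "distinct_adj (map fst ws)" "ws \<noteq> []" "fst (hd ws) \<noteq> g u"
  shows "centred_eval \<phi> ws (\<lambda>x. schwinger_dyson \<phi> \<kappa> u t (v @ x)) = 0"
  using v
proof (induction "length v" arbitrary: v t rule: less_induct)
  case less
  let ?L = "schwinger_dyson \<phi> \<kappa> u"
  have "centred_eval \<phi> ((g u, v) # ws) \<phi> = 0"
  proof (rule free_family_centred_eval[OF free unit])
    show "distinct_adj (map fst ((g u, v) # ws))"
      using ws by (cases ws) (auto simp: distinct_adj_Cons)
  qed (use less.prems ws u in auto)
  moreover have "centred_eval \<phi> ws \<phi> = 0" using free_family_centred_eval[OF free unit] ws by blast
  ultimately have first: "centred_eval \<phi> ws (\<lambda>x. \<phi> (v @ x)) = 0" by simp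
  have inner: "centred_eval \<phi> ws (\<lambda>x. ?L (Suc t) (drop (Suc i) v @ x)) = 0" if "i < length v" for i
    using that less.prems by (intro less.hyps) (auto dest: in_set_dropD)
  have outer: "centred_eval \<phi> (take j ws) (\<lambda>x. \<phi> (v @ x @ take i (snd (ws ! j)))) = 0"
    if j: "j < length ws" and i: "i < length (snd (ws ! j))" "snd (ws ! j) ! i = u" for i j
  proof -
    have mem: "ws ! j \<in> set ws" using j by simp
    hence grp: "snd (ws ! j) \<in> lists {i \<in> I. g i = fst (ws ! j)}"
      using ws(1) unfolding group_words_def by blast
    moreover have "u \<in> set (snd (ws ! j))" using i by auto
    ultimately have gj: "fst (ws ! j) = g u" by auto
    have split: "ws = take j ws @ ws ! j # drop (Suc j) ws" using j by (rule id_take_nth_drop)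
    \<comment> \<open>The first centred word does not belong to the group of \<open>u\<close>, so the gap before this occurrence contains it.\<close>
    have j0: "j \<noteq> 0" using ws(3,4) gj by (metis hd_conv_nth)
    have ne: "take j ws \<noteq> []" using j0 ws(3) by simp
    have "distinct_adj (map fst (take j ws @ ws ! j # drop (Suc j) ws))"
      using ws(2) split by simp
    hence adj: "distinct_adj (map fst (take j ws))" "last (map fst (take j ws)) \<noteq> fst (ws ! j)"
      using ne by (auto simp: distinct_adj_append_iff simp del: take_map)
    show ?thesis
    proof (rule centred_eval_flanked_zero[OF free unit u less.prems _ _ adj(1) ne])
      show "take i (snd (ws ! j)) \<in> lists {i \<in> I. g i = g u}"
        using grp gj by (auto dest: in_set_takeD)
      show "group_words I g (take j ws)"
        using ws(1) split group_words_simps(3)[of I g "take j ws" "ws ! j # drop (Suc j) ws"] by simp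
      show "fst (hd (take j ws)) \<noteq> g u" using ws(4) j0 by (simp add: hd_take)
      show "fst (last (take j ws)) \<noteq> g u" using adj(2) ne gj by (simp add: last_map del: take_map)
    qed
  qed
  have "centred_eval \<phi> ws (\<lambda>x. cut u \<phi> (?L (Suc t)) (v @ x)) = 0"
    unfolding cut_append centred_eval_add centred_eval_sum centred_eval_scale centred_eval_cut
    using inner outer by (simp add: sum.neutral)
  thus ?case
    by (subst schwinger_dyson_cut) (simp add: centred_eval_add centred_eval_scale first)
qed

text \<open>Both sides are linear in \<open>w\<close>, so it suffices to compare them on alternating products of centred
words. Both vanish there, except if the product has at most one factor and this factor belongs to the group of
\<open>u\<close>; that case is the hypothesis \<open>base\<close>.\<close>

theorem schwinger_dyson_extend:
  assumes free: "free_family \<phi> I g" and unit: "\<phi> [] = 1" and u: "u \<in> I"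
    and base: "\<And>w. w \<in> lists {i \<in> I. g i = g u} \<Longrightarrow> \<phi> (u # w) = schwinger_dyson \<phi> \<kappa> u 0 w"
    and w: "w \<in> lists I"
  shows "\<phi> (u # w) = schwinger_dyson \<phi> \<kappa> u 0 w"
proof -
  let ?L = "schwinger_dyson \<phi> \<kappa> u 0" let ?G = "{i \<in> I. g i = g u}"
  define H where "H = (\<lambda>w. \<phi> (u # w) - ?L w)"
  have left: "centred_eval \<phi> ws (\<lambda>x. H (v @ x)) = 0"
    if ws: "group_words I g ws" "distinct_adj (map fst ws)" "ws \<noteq> []" "fst (hd ws) \<noteq> g u"
      and v: "v \<in> lists ?G" for ws v
  proof -
    have "distinct_adj (map fst ((g u, u # v) # ws))"
      using ws by (cases ws) (auto simp: distinct_adj_Cons)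
    hence "centred_eval \<phi> ((g u, u # v) # ws) \<phi> = 0" "centred_eval \<phi> ws \<phi> = 0"
      using ws v u by (intro free_family_centred_eval[OF free unit]; auto)+
    hence "centred_eval \<phi> ws (\<lambda>x. \<phi> (u # v @ x)) = 0" by simp
    thus ?thesis
      using schwinger_dyson_centred_zero[OF free unit u v ws] by (simp add: H_def centred_eval_diff)
  qed
  have "H w = 0"
  proof (rule zero_if_centred_eval_zero[OF _ w])
    fix ws assume ws: "group_words I g ws" "distinct_adj (map fst ws)"
    have H0: "H v = 0" if "v \<in> lists ?G" for v using base[OF that] by (simp add: H_def)
    show "centred_eval \<phi> ws H = 0"
    proof (cases ws)
      case Nil
      thus ?thesis using H0[of "[]"] by simp
    next
      case (Cons p vs)
      show ?thesis
      proof (cases "fst p = g u")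
        case False
        thus ?thesis using left[of ws "[]"] ws Cons by simp
      next
        case True
        hence p: "snd p \<in> lists ?G" using ws Cons by simp
        show ?thesis
        proof (cases "vs = []")
          case True
          thus ?thesis using H0[OF p] H0[of "[]"] Cons by simp
        next
          case False
          hence "fst (hd vs) \<noteq> g u" using ws Cons True by (cases vs) (auto simp: distinct_adj_Cons)
          hence "centred_eval \<phi> vs (\<lambda>x. H (snd p @ x)) = 0" "centred_eval \<phi> vs H = 0"
            using left[of vs "snd p"] left[of vs "[]"] p ws Cons False
            by (auto simp: distinct_adj_Cons)
          thus ?thesis using Cons by simp
        qed
      qed
    qed
  qed
  thus ?thesis by (simp add: H_def)
qed

section \<open>Decomposing noncrossing partitions at their first element\<close>

definition nc_interval :: "nat \<Rightarrow> nat \<Rightarrow> nat set set set" where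
  "nc_interval a b = {P. partition_on {a..<b} P \<and> noncrossing P}"

lemma finite_nc_interval: "finite (nc_interval a b)"
  unfolding nc_interval_def
  by (rule finite_subset[of _ "{P. partition_on {a..<b} P}"]) (auto simp: finitely_many_partition_on)

lemma nc_interval_finite: "P \<in> nc_interval a b \<Longrightarrow> finite P"
  unfolding nc_interval_def using finite_elements[of "{a..<b}" P] by auto

lemma nc_interval_block:
  assumes "P \<in> nc_interval a b" "V \<in> P"
  shows "V \<subseteq> {a..<b}" "V \<noteq> {}" "finite V"
proof -
  show "V \<subseteq> {a..<b}" "V \<noteq> {}" using assms by (auto simp: nc_interval_def partition_on_def)
  thus "finite V" using finite_subset by blast
qed

lemma nc_interval_disjoint:
  "P \<in> nc_interval a b \<Longrightarrow> V \<in> P \<Longrightarrow> W \<in> P \<Longrightarrow> x \<in> V \<Longrightarrow> x \<in> W \<Longrightarrow> V = W"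
  by (auto simp: nc_interval_def partition_on_def disjoint_def)

lemma nc_interval_cover: "P \<in> nc_interval a b \<Longrightarrow> a \<le> x \<Longrightarrow> x < b \<Longrightarrow> \<exists>V\<in>P. x \<in> V"
  by (auto simp: nc_interval_def partition_on_def)

lemma nc_interval_noncrossing:
  "P \<in> nc_interval a b \<Longrightarrow> S \<in> P \<Longrightarrow> T \<in> P \<Longrightarrow> w \<in> S \<Longrightarrow> x \<in> T \<Longrightarrow> y \<in> S \<Longrightarrow> z \<in> T \<Longrightarrow>
    w < x \<Longrightarrow> x < y \<Longrightarrow> y < z \<Longrightarrow> S = T"
  unfolding nc_interval_def noncrossing_def by blast

text \<open>A block is determined by any of its elements, so disjointness and the noncrossing property are both
phrased as the equality of two blocks.\<close>

lemma nc_intervalI: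
  assumes "\<And>V. V \<in> P \<Longrightarrow> V \<subseteq> {a..<b} \<and> V \<noteq> {}"
    and "\<And>V W x. V \<in> P \<Longrightarrow> W \<in> P \<Longrightarrow> x \<in> V \<Longrightarrow> x \<in> W \<Longrightarrow> V = W"
    and "\<And>x. a \<le> x \<Longrightarrow> x < b \<Longrightarrow> \<exists>V\<in>P. x \<in> V"
    and "\<And>S T w x y z. S \<in> P \<Longrightarrow> T \<in> P \<Longrightarrow> w \<in> S \<Longrightarrow> x \<in> T \<Longrightarrow> y \<in> S \<Longrightarrow> z \<in> T \<Longrightarrow>
      w < x \<Longrightarrow> x < y \<Longrightarrow> y < z \<Longrightarrow> S = T"
  shows "P \<in> nc_interval a b"
proof -
  have "\<Union>P = {a..<b}" using assms(1,3) by fastforce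
  moreover have "disjoint P" using assms(2) unfolding disjoint_def by blast
  moreover have "{} \<notin> P" using assms(1) by blast
  moreover have "noncrossing P" using assms(4) unfolding noncrossing_def by blast
  ultimately show ?thesis by (simp add: nc_interval_def partition_on_def)
qed

text \<open>A noncrossing partition of \<open>{a..<b}\<close> in which \<open>a\<close> is not alone is cut just before the successor
\<open>c\<close> of \<open>a\<close> in its block: one part partitions the gap between \<open>a\<close> and \<open>c\<close>, the other one is obtained by
forgetting \<open>a\<close>. The inverse operation attaches \<open>a\<close> to the block of \<open>c\<close>.\<close>

definition attach :: "nat \<Rightarrow> nat \<Rightarrow> nat set \<Rightarrow> nat set" where
  "attach a c V = (if c \<in> V then insert a V else V)"

definition nc_glue :: "nat \<Rightarrow> nat \<Rightarrow> nat set set \<Rightarrow> nat set set \<Rightarrow> nat set set" where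
  "nc_glue a c P1 P2 = P1 \<union> attach a c ` P2"

lemma nc_glue_in:
  assumes c: "a < c" "c < b" and P1: "P1 \<in> nc_interval (Suc a) c" and P2: "P2 \<in> nc_interval c b"
  shows "nc_glue a c P1 P2 \<in> nc_interval a b"
proof (rule nc_intervalI)
  note b1 = nc_interval_block[OF P1] and b2 = nc_interval_block[OF P2]
  have r1: "a < x \<and> x < c" if "V \<in> P1" "x \<in> V" for V x using b1(1)[OF that(1)] that(2) by auto
  have r2: "c \<le> x \<and> x < b" if "V \<in> P2" "x \<in> V" for V x using b2(1)[OF that(1)] that(2) by auto
  have at: "x \<in> attach a c V \<longleftrightarrow> x \<in> V \<or> (x = a \<and> c \<in> V)" for x V by (auto simp: attach_def)
  obtain V0 where V0: "V0 \<in> P2" "c \<in> V0" using nc_interval_cover[OF P2, of c] c by auto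
  { fix V assume "V \<in> nc_glue a c P1 P2"
    then consider "V \<in> P1" | V' where "V' \<in> P2" "V = attach a c V'"
      unfolding nc_glue_def by blast
    thus "V \<subseteq> {a..<b} \<and> V \<noteq> {}"
    proof cases
      case 1
      thus ?thesis using b1(1,2)[OF 1] c by auto
    next
      case 2
      thus ?thesis using b2(1,2)[OF 2(1)] c by (auto simp: attach_def)
    qed }
  { fix x assume x: "a \<le> x" "x < b"
    consider "x = a" | "a < x" "x < c" | "c \<le> x" using x by linarith
    thus "\<exists>V\<in>nc_glue a c P1 P2. x \<in> V"
    proof cases
      case 1
      thus ?thesis using V0 by (intro bexI[of _ "attach a c V0"]) (auto simp: nc_glue_def at)
    next
      case 2
      thus ?thesis using nc_interval_cover[OF P1, of x] by (auto simp: nc_glue_def)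
    next
      case 3
      then obtain W where "W \<in> P2" "x \<in> W" using nc_interval_cover[OF P2, of x] x by auto
      thus ?thesis by (intro bexI[of _ "attach a c W"]) (auto simp: nc_glue_def at)
    qed }
  { fix V W x assume V: "V \<in> nc_glue a c P1 P2" and W: "W \<in> nc_glue a c P1 P2" and x: "x \<in> V" "x \<in> W"
    consider "V \<in> P1" "W \<in> P1" | W' where "V \<in> P1" "W' \<in> P2" "W = attach a c W'"
      | V' where "V' \<in> P2" "V = attach a c V'" "W \<in> P1"
      | V' W' where "V' \<in> P2" "V = attach a c V'" "W' \<in> P2" "W = attach a c W'"
      using V W unfolding nc_glue_def by blast
    thus "V = W"
    proof cases
      case 1
      thus ?thesis using nc_interval_disjoint[OF P1] x by blast
    next
      case 2
      have "x \<in> W' \<or> x = a" using x(2) unfolding 2(3) at by blast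
      thus ?thesis using r1[OF 2(1) x(1)] r2[OF 2(2), of x] by auto
    next
      case 3
      have "x \<in> V' \<or> x = a" using x(1) unfolding 3(2) at by blast
      thus ?thesis using r1[OF 3(3) x(2)] r2[OF 3(1), of x] by auto
    next
      case 4
      have x': "x \<in> V' \<or> x = a \<and> c \<in> V'" "x \<in> W' \<or> x = a \<and> c \<in> W'"
        using x unfolding 4(2) 4(4) at by blast+
      have "x \<in> V' \<and> x \<in> W' \<or> c \<in> V' \<and> c \<in> W'"
        using x' r2[OF 4(1), of x] r2[OF 4(3), of x] c by auto
      hence "V' = W'" using nc_interval_disjoint[OF P2 4(1,3)] by blast
      thus ?thesis using 4 by simp
    qed }
  { fix S T w x y z
    assume S: "S \<in> nc_glue a c P1 P2" and T: "T \<in> nc_glue a c P1 P2"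
      and m: "w \<in> S" "x \<in> T" "y \<in> S" "z \<in> T" and l: "w < x" "x < y" "y < z"
    consider "S \<in> P1" "T \<in> P1" | T' where "S \<in> P1" "T' \<in> P2" "T = attach a c T'"
      | S' where "S' \<in> P2" "S = attach a c S'" "T \<in> P1"
      | S' T' where "S' \<in> P2" "S = attach a c S'" "T' \<in> P2" "T = attach a c T'"
      using S T unfolding nc_glue_def by blast
    thus "S = T"
    proof cases
      case 1
      thus ?thesis using nc_interval_noncrossing[OF P1 1 m l] by blast
    next
      case 2
      have "x \<in> T' \<or> x = a" using m(2) unfolding 2(3) at by blast
      thus ?thesis using r1[OF 2(1) m(1)] r1[OF 2(1) m(3)] r2[OF 2(2), of x] l by auto
    next
      case 3
      have "y \<in> S' \<or> y = a" using m(3) unfolding 3(2) at by blast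
      thus ?thesis using r1[OF 3(3) m(2)] r1[OF 3(3) m(4)] r2[OF 3(1), of y] l by auto
    next
      case 4
      have w: "w \<in> S' \<or> w = a \<and> c \<in> S'" using m(1) unfolding 4(2) at .
      hence ge: "a \<le> w" using r2[OF 4(1), of w] c by auto
      have "x \<in> T' \<or> x = a" "y \<in> S' \<or> y = a" "z \<in> T' \<or> z = a"
        using m(2-4) unfolding 4(2) 4(4) at by blast+
      hence m': "x \<in> T'" "y \<in> S'" "z \<in> T'" using l ge by auto
      have "S' = T'"
      proof (cases "w = a")
        case False
        hence "w \<in> S'" using w by blast
        thus ?thesis using nc_interval_noncrossing[OF P2 4(1,3) _ m' l] by blast
      next
        case True
        have "w \<notin> S'" using r2[OF 4(1), of w] True c by auto
        hence cS: "c \<in> S'" using w by blast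
        show ?thesis
        proof (cases "x = c")
          case True
          thus ?thesis using nc_interval_disjoint[OF P2 4(1,3) cS] m' by blast
        next
          case False
          hence "c < x" using r2[OF 4(3) m'(1)] by simp
          thus ?thesis using nc_interval_noncrossing[OF P2 4(1,3) cS m' _ l(2,3)] by blast
        qed
      qed
      thus ?thesis using 4 by simp
    qed }
qed

definition block_successor :: "nat \<Rightarrow> nat set set \<Rightarrow> nat" where
  "block_successor a P = Min {x. a < x \<and> (\<exists>V\<in>P. a \<in> V \<and> x \<in> V)}"

lemma block_successor_glue:
  assumes c: "a < c" "c < b" and P1: "P1 \<in> nc_interval (Suc a) c" and P2: "P2 \<in> nc_interval c b"
  shows "block_successor a (nc_glue a c P1 P2) = c"
    and "{W \<in> nc_glue a c P1 P2. W \<subseteq> {a<..<c}} = P1"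
    and "(\<lambda>W. W - {a}) ` {W \<in> nc_glue a c P1 P2. \<not> W \<subseteq> {a<..<c}} = P2"
    and "{a} \<notin> nc_glue a c P1 P2"
proof -
  have r1: "a < x \<and> x < c" if "V \<in> P1" "x \<in> V" for V x
    using nc_interval_block(1)[OF P1 that(1)] that(2) by auto
  have r2: "c \<le> x \<and> x < b" if "V \<in> P2" "x \<in> V" for V x
    using nc_interval_block(1)[OF P2 that(1)] that(2) by auto
  have sub1: "V \<subseteq> {a<..<c}" if "V \<in> P1" for V using r1[OF that] by auto
  have nsub2: "\<not> attach a c V \<subseteq> {a<..<c}" if "V \<in> P2" for V
  proof -
    have "V \<noteq> {}" using nc_interval_block(2)[OF P2 that] .
    then obtain x where "x \<in> V" by auto
    hence "x \<in> attach a c V" "x \<notin> {a<..<c}" using r2[OF that, of x] by (auto simp: attach_def)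
    thus ?thesis by blast
  qed
  have aV: "a \<notin> V" if "V \<in> P2" for V using r2[OF that, of a] c by auto
  show "{W \<in> nc_glue a c P1 P2. W \<subseteq> {a<..<c}} = P1"
    using sub1 nsub2 unfolding nc_glue_def by auto
  have "{W \<in> nc_glue a c P1 P2. \<not> W \<subseteq> {a<..<c}} = attach a c ` P2"
    using sub1 nsub2 unfolding nc_glue_def by auto
  moreover have "attach a c V - {a} = V" if "V \<in> P2" for V using aV[OF that] by (auto simp: attach_def)
  ultimately show "(\<lambda>W. W - {a}) ` {W \<in> nc_glue a c P1 P2. \<not> W \<subseteq> {a<..<c}} = P2"
    by (simp add: image_image)
  have aiff: "V \<in> nc_glue a c P1 P2 \<and> a \<in> V \<longleftrightarrow> (\<exists>V'\<in>P2. c \<in> V' \<and> V = insert a V')" for V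
  proof
    assume V: "V \<in> nc_glue a c P1 P2 \<and> a \<in> V"
    have "V \<notin> P1" using V r1[of V a] by auto
    then obtain V' where V': "V' \<in> P2" "V = attach a c V'" using V by (auto simp: nc_glue_def)
    have "c \<in> V'" using V V' aV[OF V'(1)] by (simp add: attach_def split: if_splits)
    thus "\<exists>V'\<in>P2. c \<in> V' \<and> V = insert a V'" using V' by (auto simp: attach_def)
  next
    assume "\<exists>V'\<in>P2. c \<in> V' \<and> V = insert a V'"
    then obtain V' where "V' \<in> P2" "V = attach a c V'" "c \<in> V'" by (auto simp: attach_def)
    thus "V \<in> nc_glue a c P1 P2 \<and> a \<in> V" by (simp add: nc_glue_def attach_def)
  qed
  show "{a} \<notin> nc_glue a c P1 P2"
  proof
    assume "{a} \<in> nc_glue a c P1 P2"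
    then obtain V' where "c \<in> V'" "{a} = insert a V'" using aiff[of "{a}"] by blast
    thus False using c by blast
  qed
  obtain V0 where V0: "V0 \<in> P2" "c \<in> V0" using nc_interval_cover[OF P2, of c] c by auto
  have uniq: "V' = V0" if "V' \<in> P2" "c \<in> V'" for V' using nc_interval_disjoint[OF P2 _ _ that(2) V0(2)] that V0 by blast
  have "{x. a < x \<and> (\<exists>V\<in>nc_glue a c P1 P2. a \<in> V \<and> x \<in> V)} = V0"
  proof (intro equalityI subsetI)
    fix x assume "x \<in> {x. a < x \<and> (\<exists>V\<in>nc_glue a c P1 P2. a \<in> V \<and> x \<in> V)}"
    then obtain V where "a < x" "V \<in> nc_glue a c P1 P2" "a \<in> V" "x \<in> V" by blast
    moreover from this obtain V' where "V' \<in> P2" "c \<in> V'" "V = insert a V'" using aiff[of V] by blast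
    ultimately show "x \<in> V0" using uniq[of V'] by auto
  next
    fix x assume "x \<in> V0"
    thus "x \<in> {x. a < x \<and> (\<exists>V\<in>nc_glue a c P1 P2. a \<in> V \<and> x \<in> V)}"
      using aiff[of "insert a V0"] V0 r2[OF V0(1), of x] c by (intro CollectI conjI bexI[of _ "insert a V0"]) auto
  qed
  moreover have "Min V0 = c"
    using nc_interval_block(3)[OF P2 V0(1)] V0 r2[OF V0(1)] by (intro Min_eqI) auto
  ultimately show "block_successor a (nc_glue a c P1 P2) = c" by (simp add: block_successor_def)
qed

text \<open>Since \<open>a\<close> and its successor \<open>c\<close> lie in the same block, no other block can reach across
\<open>c\<close>.\<close>

lemma nc_unglue:
  assumes P: "P \<in> nc_interval a b" and ab: "a < b" and na: "{a} \<notin> P"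
  defines "c \<equiv> block_successor a P"
  defines "P1 \<equiv> {W \<in> P. W \<subseteq> {a<..<c}}"
  defines "P2 \<equiv> (\<lambda>W. W - {a}) ` {W \<in> P. \<not> W \<subseteq> {a<..<c}}"
  shows "a < c" "c < b" "P1 \<in> nc_interval (Suc a) c" "P2 \<in> nc_interval c b" "nc_glue a c P1 P2 = P"
proof -
  obtain V where V: "V \<in> P" "a \<in> V" using nc_interval_cover[OF P, of a] ab by auto
  have rP: "a \<le> x \<and> x < b" if "W \<in> P" "x \<in> W" for W x
    using nc_interval_block(1)[OF P that(1)] that(2) by auto
  have uV: "W = V" if "W \<in> P" "a \<in> W" for W using nc_interval_disjoint[OF P] that V by blast
  have c_eq: "c = Min (V - {a})"
  proof -
    have "{x. a < x \<and> (\<exists>V\<in>P. a \<in> V \<and> x \<in> V)} = V - {a}"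
    proof (intro equalityI subsetI)
      fix x assume "x \<in> {x. a < x \<and> (\<exists>V\<in>P. a \<in> V \<and> x \<in> V)}"
      then obtain W where "a < x" "W \<in> P" "a \<in> W" "x \<in> W" by blast
      thus "x \<in> V - {a}" using uV[of W] by simp
    next
      fix x assume "x \<in> V - {a}"
      thus "x \<in> {x. a < x \<and> (\<exists>V\<in>P. a \<in> V \<and> x \<in> V)}" using V rP[OF V(1), of x] by auto
    qed
    thus ?thesis by (simp add: c_def block_successor_def)
  qed
  have ne: "V - {a} \<noteq> {}"
  proof
    assume "V - {a} = {}"
    hence "V = {a}" using V by blast
    thus False using V na by simp
  qed
  have finV: "finite (V - {a})" using nc_interval_block(3)[OF P V(1)] by simp
  have cV: "c \<in> V" "c \<noteq> a" using Min_in[OF finV ne] c_eq by auto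
  have cmin: "c \<le> x" if "x \<in> V" "x \<noteq> a" for x using Min_le[OF finV] that c_eq by auto
  show ac: "a < c" and cb: "c < b" using rP[OF V(1) cV(1)] cV by auto
  have dich: "W \<subseteq> {a<..<c} \<or> (\<forall>x\<in>W. c < x)" if W: "W \<in> P" "W \<noteq> V" for W
  proof (rule ccontr)
    assume not: "\<not> ?thesis"
    have naW: "a \<notin> W" using uV W by blast
    have ncW: "c \<notin> W" using nc_interval_disjoint[OF P W(1) V(1) _ cV(1)] W by blast
    from not obtain x y where "x \<in> W" "\<not> c < x" "y \<in> W" "y \<notin> {a<..<c}" by blast
    moreover from this naW ncW have "x \<noteq> a" "y \<noteq> a" "x \<noteq> c" "y \<noteq> c" by auto
    ultimately have "a < x" "x < c" "c < y" "x \<in> W" "y \<in> W" using rP[OF W(1), of x] rP[OF W(1), of y] by auto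
    hence "V = W" by (intro nc_interval_noncrossing[OF P V(1) W(1) V(2) _ cV(1)])
    thus False using W by simp
  qed
  have nV: "\<not> V \<subseteq> {a<..<c}" using V by auto
  have P2_eq: "P2 = insert (V - {a}) {W \<in> P. W \<noteq> V \<and> (\<forall>x\<in>W. c < x)}"
  proof -
    have "{W \<in> P. \<not> W \<subseteq> {a<..<c}} = insert V {W \<in> P. W \<noteq> V \<and> (\<forall>x\<in>W. c < x)}"
    proof (intro equalityI subsetI)
      fix W assume "W \<in> {W \<in> P. \<not> W \<subseteq> {a<..<c}}"
      thus "W \<in> insert V {W \<in> P. W \<noteq> V \<and> (\<forall>x\<in>W. c < x)}" using dich[of W] by auto
    next
      fix W assume W: "W \<in> insert V {W \<in> P. W \<noteq> V \<and> (\<forall>x\<in>W. c < x)}"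
      show "W \<in> {W \<in> P. \<not> W \<subseteq> {a<..<c}}"
      proof (cases "W = V")
        case False
        then obtain x where "x \<in> W" using W nc_interval_block(2)[OF P, of W] by auto
        moreover have "W \<in> P" "\<forall>x\<in>W. c < x" using W False by auto
        ultimately show ?thesis using order_less_asym by (metis (mono_tags, lifting) greaterThanLessThan_iff mem_Collect_eq subsetD)
      qed (use V nV in auto)
    qed
    hence "P2 = insert (V - {a}) ((\<lambda>W. W - {a}) ` {W \<in> P. W \<noteq> V \<and> (\<forall>x\<in>W. c < x)})"
      by (simp add: P2_def)
    also have "(\<lambda>W. W - {a}) ` {W \<in> P. W \<noteq> V \<and> (\<forall>x\<in>W. c < x)} = id ` {W \<in> P. W \<noteq> V \<and> (\<forall>x\<in>W. c < x)}"
      using uV by (intro image_cong) auto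
    finally show ?thesis by simp
  qed
  have m2: "\<exists>W'\<in>P. W = W' - {a}" if "W \<in> P2" for W using that unfolding P2_def by blast
  show "P1 \<in> nc_interval (Suc a) c"
  proof (rule nc_intervalI)
    fix W assume "W \<in> P1"
    hence "W \<subseteq> {a<..<c}" "W \<noteq> {}" using nc_interval_block(2)[OF P, of W] by (auto simp: P1_def)
    thus "W \<subseteq> {Suc a..<c} \<and> W \<noteq> {}" by auto
  next
    fix x assume x: "Suc a \<le> x" "x < c"
    then obtain W where W: "W \<in> P" "x \<in> W" using nc_interval_cover[OF P, of x] cb by auto
    hence "W \<noteq> V" using cmin[of x] x by auto
    hence "W \<subseteq> {a<..<c}" using dich[OF W(1)] W(2) x(2) by (meson order_less_asym)
    thus "\<exists>W\<in>P1. x \<in> W" using W by (auto simp: P1_def)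
  next
    fix W1 W2 x assume "W1 \<in> P1" "W2 \<in> P1" "x \<in> W1" "x \<in> W2"
    thus "W1 = W2" by (intro nc_interval_disjoint[OF P]) (auto simp: P1_def)
  next
    fix S T w x y z assume "S \<in> P1" "T \<in> P1" and m: "w \<in> S" "x \<in> T" "y \<in> S" "z \<in> T" "w < x" "x < y" "y < z"
    hence "S \<in> P" "T \<in> P" by (auto simp: P1_def)
    thus "S = T" using nc_interval_noncrossing[OF P _ _ m] by blast
  qed
  show "P2 \<in> nc_interval c b"
  proof (rule nc_intervalI)
    fix W assume "W \<in> P2"
    then consider "W = V - {a}" | "W \<in> P" "\<forall>x\<in>W. c < x" using P2_eq by blast
    thus "W \<subseteq> {c..<b} \<and> W \<noteq> {}"
    proof cases
      case 1
      thus ?thesis using ne cmin rP[OF V(1)] by auto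
    next
      case 2
      hence "c \<le> x \<and> x < b" if "x \<in> W" for x using rP[OF 2(1) that] that by auto
      thus ?thesis using nc_interval_block(2)[OF P 2(1)] by auto
    qed
  next
    fix x assume x: "c \<le> x" "x < b"
    then obtain W where W: "W \<in> P" "x \<in> W" using nc_interval_cover[OF P, of x] ac by auto
    show "\<exists>W\<in>P2. x \<in> W"
    proof (cases "W = V")
      case True
      thus ?thesis using W x ac P2_eq by auto
    next
      case False
      hence "\<forall>x\<in>W. c < x" using dich[OF W(1) False] W(2) x(1) by (meson greaterThanLessThan_iff not_le subsetD)
      thus ?thesis using W False P2_eq by auto
    qed
  next
    fix W1 W2 x assume "W1 \<in> P2" "W2 \<in> P2" "x \<in> W1" "x \<in> W2"
    then obtain W1' W2' where "W1' \<in> P" "W1 = W1' - {a}" "W2' \<in> P" "W2 = W2' - {a}" using m2 by blast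
    thus "W1 = W2" using nc_interval_disjoint[OF P, of W1' W2' x] \<open>x \<in> W1\<close> \<open>x \<in> W2\<close> by simp
  next
    fix S T w x y z assume "S \<in> P2" "T \<in> P2" and m: "w \<in> S" "x \<in> T" "y \<in> S" "z \<in> T" "w < x" "x < y" "y < z"
    then obtain S' T' where "S' \<in> P" "S = S' - {a}" "T' \<in> P" "T = T' - {a}" using m2 by blast
    thus "S = T" using nc_interval_noncrossing[OF P, of S' T' w x y z] m by auto
  qed
  have "attach a c ` P2 = insert V {W \<in> P. W \<noteq> V \<and> (\<forall>x\<in>W. c < x)}"
  proof -
    have "attach a c (V - {a}) = V" using V cV by (auto simp: attach_def)
    moreover have "attach a c W = W" if "\<forall>x\<in>W. c < x" for W using that by (auto simp: attach_def)
    ultimately show ?thesis by (simp add: P2_eq)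
  qed
  hence "nc_glue a c P1 P2 = {W \<in> P. W \<subseteq> {a<..<c}} \<union> insert V {W \<in> P. W \<noteq> V \<and> (\<forall>x\<in>W. c < x)}"
    by (simp add: nc_glue_def P1_def)
  also have "\<dots> = P" using dich V(1) by (intro equalityI subsetI) (blast, auto)
  finally show "nc_glue a c P1 P2 = P" .
qed

lemma nc_interval_insert_singleton:
  assumes "P \<in> nc_interval (Suc a) b" "a < b"
  shows "insert {a} P \<in> nc_interval a b" "{a} \<notin> P" "\<forall>V\<in>P. a \<notin> V"
proof -
  have r: "V \<subseteq> {Suc a..<b} \<and> V \<noteq> {}" if "V \<in> P" for V using nc_interval_block[OF assms(1) that] by simp
  show na: "\<forall>V\<in>P. a \<notin> V"
  proof
    fix V assume "V \<in> P"
    thus "a \<notin> V" using r[of V] subsetD[of V "{Suc a..<b}" a] by auto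
  qed
  thus "{a} \<notin> P" by blast
  show "insert {a} P \<in> nc_interval a b"
  proof (rule nc_intervalI)
    fix V assume "V \<in> insert {a} P"
    thus "V \<subseteq> {a..<b} \<and> V \<noteq> {}" using r[of V] assms(2) order_trans[of V "{Suc a..<b}" "{a..<b}"] by auto
  next
    fix V W x assume V: "V \<in> insert {a} P" and W: "W \<in> insert {a} P" and x: "x \<in> V" "x \<in> W"
    show "V = W"
    proof (cases "x = a")
      case True
      thus ?thesis using V W x na by blast
    next
      case False
      hence "V \<in> P" "W \<in> P" using V W x by blast+
      thus ?thesis using nc_interval_disjoint[OF assms(1) _ _ x] by blast
    qed
  next
    fix x assume "a \<le> x" "x < b"
    thus "\<exists>V\<in>insert {a} P. x \<in> V" using nc_interval_cover[OF assms(1), of x] by (cases "x = a") auto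
  next
    fix S T w x y z
    assume m: "S \<in> insert {a} P" "T \<in> insert {a} P" "w \<in> S" "x \<in> T" "y \<in> S" "z \<in> T" "w < x" "x < y" "y < z"
    have "S \<noteq> {a}" using m(3,5,7,8) by (metis less_trans less_irrefl singletonD)
    moreover have "T \<noteq> {a}" using m(4,6,8,9) by (metis less_trans less_irrefl singletonD)
    ultimately have "S \<in> P" "T \<in> P" using m(1,2) by simp_all
    thus "S = T" using nc_interval_noncrossing[OF assms(1) _ _ m(3-9)] by blast
  qed
qed

lemma nc_interval_remove_singleton:
  assumes P: "P \<in> nc_interval a b" and a: "{a} \<in> P"
  shows "P - {{a}} \<in> nc_interval (Suc a) b"
proof (rule nc_intervalI)
  fix V assume V: "V \<in> P - {{a}}"
  have a: "a \<notin> V"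
  proof
    assume "a \<in> V"
    hence "V = {a}" using nc_interval_disjoint[OF P _ a _ singletonI] V by blast
    thus False using V by blast
  qed
  have V': "V \<subseteq> {a..<b}" "V \<noteq> {}" using nc_interval_block[OF P, of V] V by blast+
  have "x \<in> {Suc a..<b}" if "x \<in> V" for x
  proof -
    have "x \<in> {a..<b}" "x \<noteq> a" using that a V' by blast+
    thus ?thesis by simp
  qed
  thus "V \<subseteq> {Suc a..<b} \<and> V \<noteq> {}" using V' by blast
next
  fix x assume "Suc a \<le> x" "x < b"
  then obtain V where "V \<in> P" "x \<in> V" "x \<noteq> a" using nc_interval_cover[OF P, of x] by auto
  thus "\<exists>V\<in>P - {{a}}. x \<in> V" by blast
next
  fix V W x assume "V \<in> P - {{a}}" "W \<in> P - {{a}}" "x \<in> V" "x \<in> W"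
  thus "V = W" using nc_interval_disjoint[OF P, of V W x] by simp
next
  fix S T w x y z
  assume "S \<in> P - {{a}}" "T \<in> P - {{a}}" and m: "w \<in> S" "x \<in> T" "y \<in> S" "z \<in> T" "w < x" "x < y" "y < z"
  hence "S \<in> P" "T \<in> P" by simp_all
  thus "S = T" using nc_interval_noncrossing[OF P _ _ m] by blast
qed

text \<open>The block of \<open>a\<close> is weighted as if it had \<open>t\<close> further elements. When the first element of a
block is removed, its weight is thereby passed on to the rest of the block.\<close>

definition nc_weight :: "(nat \<Rightarrow> complex) \<Rightarrow> nat \<Rightarrow> nat \<Rightarrow> nat set set \<Rightarrow> complex" where
  "nc_weight f t a P = (\<Prod>V\<in>P. f (card V + (if a \<in> V then t else 0)))"

definition nc_sum :: "(nat \<Rightarrow> complex) \<Rightarrow> nat \<Rightarrow> nat \<Rightarrow> nat \<Rightarrow> complex" where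
  "nc_sum f t a b = (\<Sum>P\<in>nc_interval a b. nc_weight f t a P)"

lemma nc_weight_insert_singleton:
  assumes "P \<in> nc_interval (Suc a) b" "a < b"
  shows "nc_weight f t a (insert {a} P) = f (Suc t) * nc_weight f 0 (Suc a) P"
proof -
  have "nc_weight f t a (insert {a} P) = f (Suc t) * (\<Prod>V\<in>P. f (card V + (if a \<in> V then t else 0)))"
    using nc_interval_insert_singleton(2)[OF assms] nc_interval_finite[OF assms(1)]
    by (simp add: nc_weight_def)
  also have "(\<Prod>V\<in>P. f (card V + (if a \<in> V then t else 0))) = nc_weight f 0 (Suc a) P"
    unfolding nc_weight_def using nc_interval_insert_singleton(3)[OF assms] by (intro prod.cong) auto
  finally show ?thesis .
qed

lemma nc_weight_glue:
  assumes c: "a < c" "c < b" and P1: "P1 \<in> nc_interval (Suc a) c" and P2: "P2 \<in> nc_interval c b"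
  shows "nc_weight f t a (nc_glue a c P1 P2) = nc_weight f 0 (Suc a) P1 * nc_weight f (Suc t) c P2"
proof -
  have r1: "V \<subseteq> {Suc a..<c} \<and> V \<noteq> {}" if "V \<in> P1" for V using nc_interval_block[OF P1 that] by simp
  have r2: "V \<subseteq> {c..<b} \<and> V \<noteq> {} \<and> finite V" if "V \<in> P2" for V using nc_interval_block[OF P2 that] by simp
  have a1: "a \<notin> V" if "V \<in> P1" for V using r1[OF that] subsetD[of V "{Suc a..<c}" a] by auto
  have a2: "a \<notin> V" if "V \<in> P2" for V using r2[OF that] c subsetD[of V "{c..<b}" a] by auto
  have disj: "P1 \<inter> attach a c ` P2 = {}"
  proof (intro equals0I)
    fix V assume "V \<in> P1 \<inter> attach a c ` P2"
    then obtain W where V: "V \<in> P1" and W: "W \<in> P2" "V = attach a c W" by blast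
    have "W \<subseteq> V" using W by (auto simp: attach_def)
    hence "W \<subseteq> {Suc a..<c} \<inter> {c..<b}" using r1[OF V] r2[OF W(1)] by blast
    moreover have "{Suc a..<c} \<inter> {c..<b} = {}" by auto
    ultimately show False using r2[OF W(1)] by blast
  qed
  have inj: "inj_on (attach a c) P2"
  proof (rule inj_onI)
    fix V W assume "V \<in> P2" "W \<in> P2" "attach a c V = attach a c W"
    moreover have "attach a c V - {a} = V" if "V \<in> P2" for V
      using a2[OF that] by (auto simp: attach_def)
    ultimately show "V = W" by metis
  qed
  have "nc_weight f t a (nc_glue a c P1 P2) =
      (\<Prod>V\<in>P1. f (card V + (if a \<in> V then t else 0))) *
      (\<Prod>V\<in>attach a c ` P2. f (card V + (if a \<in> V then t else 0)))"
    unfolding nc_weight_def nc_glue_def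
    using disj nc_interval_finite[OF P1] nc_interval_finite[OF P2] by (intro prod.union_disjoint) auto
  also have "(\<Prod>V\<in>P1. f (card V + (if a \<in> V then t else 0))) = nc_weight f 0 (Suc a) P1"
    unfolding nc_weight_def using a1 by (intro prod.cong) auto
  also have "(\<Prod>V\<in>attach a c ` P2. f (card V + (if a \<in> V then t else 0))) = nc_weight f (Suc t) c P2"
    unfolding nc_weight_def prod.reindex[OF inj] comp_def
    using a2 r2 by (intro prod.cong) (auto simp: attach_def)
  finally show ?thesis .
qed

lemma nc_sum_rec:
  assumes ab: "a < b"
  shows "nc_sum f t a b = f (Suc t) * nc_sum f 0 (Suc a) b +
    (\<Sum>c\<in>{a<..<b}. nc_sum f 0 (Suc a) c * nc_sum f (Suc t) c b)"
proof -
  let ?A = "{P \<in> nc_interval a b. {a} \<in> P}" and ?B = "{P \<in> nc_interval a b. {a} \<notin> P}"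
  have "nc_interval a b = ?A \<union> ?B" by blast
  hence "nc_sum f t a b = (\<Sum>P\<in>?A \<union> ?B. nc_weight f t a P)" unfolding nc_sum_def by simp
  also have "\<dots> = (\<Sum>P\<in>?A. nc_weight f t a P) + (\<Sum>P\<in>?B. nc_weight f t a P)"
    using finite_nc_interval by (intro sum.union_disjoint) auto
  also have "(\<Sum>P\<in>?A. nc_weight f t a P) = (\<Sum>P\<in>nc_interval (Suc a) b. f (Suc t) * nc_weight f 0 (Suc a) P)"
  proof (rule sum.reindex_bij_witness[where j = "\<lambda>P. P - {{a}}" and i = "insert {a}"], goal_cases)
    case (5 P)
    hence "P - {{a}} \<in> nc_interval (Suc a) b" using nc_interval_remove_singleton by blast
    from nc_weight_insert_singleton[OF this ab, of f t] show ?case using 5 by (simp add: insert_absorb)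
  qed (use ab nc_interval_insert_singleton nc_interval_remove_singleton in \<open>auto simp: insert_absorb\<close>)
  also have "\<dots> = f (Suc t) * nc_sum f 0 (Suc a) b" by (simp add: nc_sum_def sum_distrib_left)
  also have "(\<Sum>P\<in>?B. nc_weight f t a P) =
      (\<Sum>(c, P1, P2)\<in>(SIGMA c:{a<..<b}. nc_interval (Suc a) c \<times> nc_interval c b).
        nc_weight f 0 (Suc a) P1 * nc_weight f (Suc t) c P2)"
  proof (rule sum.reindex_bij_witness[where i = "\<lambda>(c, P1, P2). nc_glue a c P1 P2" and
        j = "\<lambda>P. let c = block_successor a P in
          (c, {W \<in> P. W \<subseteq> {a<..<c}}, (\<lambda>W. W - {a}) ` {W \<in> P. \<not> W \<subseteq> {a<..<c}})"], goal_cases)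
    case (1 P)
    thus ?case using nc_unglue(5)[of P a b] ab by (simp add: Let_def)
  next
    case (2 P)
    thus ?case using nc_unglue(1-4)[of P a b] ab by (simp add: Let_def)
  next
    case (3 q)
    then obtain c P1 P2 where q: "q = (c, P1, P2)" "a < c" "c < b" "P1 \<in> nc_interval (Suc a) c" "P2 \<in> nc_interval c b"
      by auto
    show ?case using block_successor_glue[OF q(2-5)] q(1) by (simp add: Let_def)
  next
    case (4 q)
    then obtain c P1 P2 where q: "q = (c, P1, P2)" "a < c" "c < b" "P1 \<in> nc_interval (Suc a) c" "P2 \<in> nc_interval c b"
      by auto
    show ?case using block_successor_glue(4)[OF q(2-5)] nc_glue_in[OF q(2-5)] q(1) by simp
  next
    case (5 P)
    hence P: "P \<in> nc_interval a b" "{a} \<notin> P" by auto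
    note u = nc_unglue[OF P(1) ab P(2)]
    show ?case using nc_weight_glue[OF u(1-4), of f t] unfolding u(5) by (simp add: Let_def)
  qed
  also have "\<dots> = (\<Sum>c\<in>{a<..<b}. nc_sum f 0 (Suc a) c * nc_sum f (Suc t) c b)"
    unfolding nc_sum_def sum_product
    by (subst sum.Sigma[symmetric]) (auto simp: finite_nc_interval sum.cartesian_product)
  finally show ?thesis .
qed

lemma nc_sum_rec_length:
  "nc_sum f t a (a + Suc m) = f (Suc t) * nc_sum f 0 (Suc a) (Suc a + m) +
    (\<Sum>i<m. nc_sum f 0 (Suc a) (Suc a + i) * nc_sum f (Suc t) (Suc a + i) (Suc a + i + Suc (m - Suc i)))"
proof -
  have "{a<..<a + Suc m} = (\<lambda>i. Suc a + i) ` {..<m}"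
  proof (intro equalityI subsetI)
    fix c assume "c \<in> {a<..<a + Suc m}"
    hence "c = Suc a + (c - Suc a)" "c - Suc a \<in> {..<m}" by auto
    thus "c \<in> (\<lambda>i. Suc a + i) ` {..<m}" by (rule image_eqI)
  qed auto
  hence "(\<Sum>c\<in>{a<..<a + Suc m}. nc_sum f 0 (Suc a) c * nc_sum f (Suc t) c (a + Suc m)) =
     (\<Sum>i<m. nc_sum f 0 (Suc a) (Suc a + i) * nc_sum f (Suc t) (Suc a + i) (a + Suc m))"
    by (simp add: sum.reindex inj_on_def)
  moreover have "Suc a + i + Suc (m - Suc i) = a + Suc m" if "i < m" for i using that by simp
  ultimately show ?thesis using nc_sum_rec[of a "a + Suc m" f t] by simp
qed

lemma nc_sum_empty: "nc_sum f t a a = 1"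
proof -
  have "nc_interval a a = {{}}"
  proof (intro equalityI subsetI)
    fix P assume P: "P \<in> nc_interval a a"
    have "V \<notin> P" for V using nc_interval_block(1,2)[OF P, of V]
      by (metis atLeastLessThan_empty order_refl subset_empty)
    thus "P \<in> {{}}" by auto
  next
    fix P :: "nat set set" assume "P \<in> {{}}"
    hence "P = {}" by simp
    show "P \<in> nc_interval a a" unfolding \<open>P = {}\<close> by (rule nc_intervalI) simp_all
  qed
  thus ?thesis by (simp add: nc_sum_def nc_weight_def)
qed

text \<open>The recursion depends on the length of the interval only, so no bijection between the partitions
of different intervals has to be constructed.\<close>

lemma nc_sum_shift: "nc_sum f t a (a + n) = nc_sum f t b (b + n)"
proof (induction n arbitrary: a b t rule: less_induct)
  case (less n)
  show ?case
  proof (cases n)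
    case 0
    thus ?thesis by (simp add: nc_sum_empty)
  next
    case (Suc m)
    have "nc_sum f 0 (Suc a) (Suc a + i) * nc_sum f (Suc t) (Suc a + i) (Suc a + i + Suc (m - Suc i)) =
        nc_sum f 0 (Suc b) (Suc b + i) * nc_sum f (Suc t) (Suc b + i) (Suc b + i + Suc (m - Suc i))"
      if "i < m" for i
    proof -
      have "nc_sum f 0 (Suc a) (Suc a + i) = nc_sum f 0 (Suc b) (Suc b + i)"
        using that Suc by (intro less.IH) simp
      moreover have "nc_sum f (Suc t) (Suc a + i) (Suc a + i + Suc (m - Suc i)) =
          nc_sum f (Suc t) (Suc b + i) (Suc b + i + Suc (m - Suc i))"
        using that Suc by (intro less.IH) simp
      ultimately show ?thesis by simp
    qed
    moreover have "nc_sum f 0 (Suc a) (Suc a + m) = nc_sum f 0 (Suc b) (Suc b + m)"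
      using Suc by (intro less.IH) simp
    ultimately show ?thesis
      using nc_sum_rec_length[of f t a m] nc_sum_rec_length[of f t b m] Suc by simp
  qed
qed

lemma nc_sum_free_cumulant:
  assumes "m 0 = 1"
  shows "nc_sum (free_cumulant m) 0 a (a + k) = m k"
proof (cases "k = 0")
  case True
  thus ?thesis using assms by (simp add: nc_sum_empty)
next
  case False
  have "nc_interval 1 (1 + k) = NC k"
    by (simp add: nc_interval_def NC_def atLeastLessThanSuc_atLeastAtMost)
  hence "nc_sum (free_cumulant m) 0 1 (1 + k) = m k"
    using False moment_free_cumulant[of k m] by (simp add: nc_sum_def nc_weight_def)
  thus ?thesis using nc_sum_shift[of "free_cumulant m" 0 a k 1] by simp
qed

text \<open>In a power of \<open>u\<close> every position is an occurrence of \<open>u\<close>, and choosing the next one is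
choosing the successor within the block of the first element.\<close>

lemma schwinger_dyson_replicate:
  assumes m: "\<And>k. \<phi> (replicate k u) = m k" and m0: "m 0 = 1"
  shows "schwinger_dyson \<phi> (free_cumulant m) u t (replicate n u) = nc_sum (free_cumulant m) t a (a + Suc n)"
proof (induction n arbitrary: t a rule: less_induct)
  case (less n)
  have "schwinger_dyson \<phi> (free_cumulant m) u t (replicate n u) =
      free_cumulant m (Suc t) * m n +
      (\<Sum>i<n. m i * schwinger_dyson \<phi> (free_cumulant m) u (Suc t) (replicate (n - Suc i) u))"
    by (subst schwinger_dyson.simps) (auto simp: m min_absorb1 intro!: sum.cong)
  also have "(\<Sum>i<n. m i * schwinger_dyson \<phi> (free_cumulant m) u (Suc t) (replicate (n - Suc i) u)) =
     (\<Sum>i<n. nc_sum (free_cumulant m) 0 (Suc a) (Suc a + i) *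
        nc_sum (free_cumulant m) (Suc t) (Suc a + i) (Suc a + i + Suc (n - Suc i)))"
    using nc_sum_free_cumulant[of m "Suc a"] m0
    by (intro sum.cong arg_cong2[where f = "(*)"] less.IH) auto
  also have "m n = nc_sum (free_cumulant m) 0 (Suc a) (Suc a + n)"
    by (rule nc_sum_free_cumulant[of m, OF m0, symmetric])
  finally show ?case by (simp only: nc_sum_rec_length[of _ t a n])
qed

lemma moments_schwinger_dyson:
  assumes m: "\<And>k. \<phi> (replicate k u) = m k" and m0: "m 0 = 1"
  shows "\<phi> (u # replicate n u) = schwinger_dyson \<phi> (free_cumulant m) u 0 (replicate n u)"
  using schwinger_dyson_replicate[of \<phi> u m 0 n 1, OF m m0] nc_sum_free_cumulant[of m 1 "Suc n", OF m0]
    m[of "Suc n"] by simp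

section \<open>Noncrossing pairings\<close>

definition pairings :: "nat \<Rightarrow> nat \<Rightarrow> nat set set set" where
  "pairings a b = {\<sigma> \<in> nc_interval a b. \<forall>V\<in>\<sigma>. card V = 2}"

lemma finite_pairings: "finite (pairings a b)"
  unfolding pairings_def using finite_nc_interval by simp

lemma pairings_finite: "\<sigma> \<in> pairings a b \<Longrightarrow> finite \<sigma>"
  unfolding pairings_def using nc_interval_finite by blast

lemma nc_interval_subset:
  assumes P: "P \<in> nc_interval a b" and sub: "Q \<subseteq> P"
    and V: "\<And>V. V \<in> Q \<Longrightarrow> V \<subseteq> {a'..<b'}"
    and cover: "\<And>x. a' \<le> x \<Longrightarrow> x < b' \<Longrightarrow> \<exists>V\<in>Q. x \<in> V"
  shows "Q \<in> nc_interval a' b'"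
proof (rule nc_intervalI)
  fix W assume "W \<in> Q"
  thus "W \<subseteq> {a'..<b'} \<and> W \<noteq> {}" using V nc_interval_block(2)[OF P] sub by blast
next
  fix V W x assume "V \<in> Q" "W \<in> Q" "x \<in> V" "x \<in> W"
  thus "V = W" using nc_interval_disjoint[OF P] sub by blast
next
  fix S T w x y z assume "S \<in> Q" "T \<in> Q" and m: "w \<in> S" "x \<in> T" "y \<in> S" "z \<in> T" "w < x" "x < y" "y < z"
  hence "S \<in> P" "T \<in> P" using sub by blast+
  thus "S = T" using nc_interval_noncrossing[OF P _ _ m] by blast
qed (use cover in blast)

lemma pairing_block:
  assumes "\<sigma> \<in> pairings a b" "V \<in> \<sigma>"
  shows "a \<le> Min V" "Min V < Max V" "Max V < b" "V = {Min V, Max V}"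
proof -
  have nc: "\<sigma> \<in> nc_interval a b" and c2: "card V = 2" using assms by (auto simp: pairings_def)
  note b = nc_interval_block[OF nc assms(2)]
  obtain x y where xy: "V = {x, y}" "x < y"
    using c2 by (metis card_2_iff insert_commute linorder_neqE_nat)
  hence "Min V = x" "Max V = y" by auto
  thus "a \<le> Min V" "Min V < Max V" "Max V < b" "V = {Min V, Max V}" using b(1) xy by auto
qed

text \<open>The inner pairing \<open>\<sigma>1\<close> lives on the legs between \<open>a\<close> and its partner \<open>c\<close>, and \<open>\<sigma>2\<close> on the legs
to the right of \<open>c\<close>.\<close>

definition pair_glue :: "nat \<Rightarrow> nat \<Rightarrow> nat set set \<Rightarrow> nat set set \<Rightarrow> nat set set" where
  "pair_glue a c \<sigma>1 \<sigma>2 = insert {a, c} (\<sigma>1 \<union> \<sigma>2)"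

lemma pair_glue_in:
  assumes c: "a < c" "c < b" and s1: "\<sigma>1 \<in> pairings (Suc a) c" and s2: "\<sigma>2 \<in> pairings (Suc c) b"
  shows "pair_glue a c \<sigma>1 \<sigma>2 \<in> pairings a b"
proof -
  have P1: "\<sigma>1 \<in> nc_interval (Suc a) c" and P2: "\<sigma>2 \<in> nc_interval (Suc c) b"
    using s1 s2 by (auto simp: pairings_def)
  have r1: "a < x \<and> x < c" if "V \<in> \<sigma>1" "x \<in> V" for V x
    using subsetD[OF nc_interval_block(1)[OF P1 that(1)] that(2)] by simp
  have r2: "c < x \<and> x < b" if "V \<in> \<sigma>2" "x \<in> V" for V x
    using subsetD[OF nc_interval_block(1)[OF P2 that(1)] that(2)] by simp
  let ?s = "pair_glue a c \<sigma>1 \<sigma>2"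
  have which: "V = {a, c} \<and> (x = a \<or> x = c) \<or> V \<in> \<sigma>1 \<and> a < x \<and> x < c \<or> V \<in> \<sigma>2 \<and> c < x \<and> x < b"
    if "V \<in> ?s" "x \<in> V" for V x
    using that r1 r2 unfolding pair_glue_def by blast
  have "?s \<in> nc_interval a b"
  proof (rule nc_intervalI)
    fix V assume V: "V \<in> ?s"
    have "x \<in> {a..<b}" if "x \<in> V" for x using which[OF V that] c by auto
    moreover have "V \<noteq> {}"
      using V nc_interval_block(2)[OF P1] nc_interval_block(2)[OF P2] unfolding pair_glue_def by blast
    ultimately show "V \<subseteq> {a..<b} \<and> V \<noteq> {}" by blast
  next
    fix V W x assume V: "V \<in> ?s" and W: "W \<in> ?s" and x: "x \<in> V" "x \<in> W"
    consider "V = {a, c}" "W = {a, c}" | "V \<in> \<sigma>1" "W \<in> \<sigma>1" | "V \<in> \<sigma>2" "W \<in> \<sigma>2"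
      using which[OF V x(1)] which[OF W x(2)] c by (metis less_asym less_irrefl)
    thus "V = W"
      by cases (use nc_interval_disjoint[OF P1 _ _ x] nc_interval_disjoint[OF P2 _ _ x] in blast)+
  next
    fix x assume x: "a \<le> x" "x < b"
    consider "x = a \<or> x = c" | "Suc a \<le> x" "x < c" | "Suc c \<le> x" "x < b" using x by linarith
    thus "\<exists>V\<in>?s. x \<in> V"
    proof cases
      case 1
      thus ?thesis by (auto simp: pair_glue_def)
    next
      case 2
      thus ?thesis using nc_interval_cover[OF P1 2] by (auto simp: pair_glue_def)
    next
      case 3
      thus ?thesis using nc_interval_cover[OF P2 3] by (auto simp: pair_glue_def)
    qed
  next
    fix S T w x y z
    assume S: "S \<in> ?s" and T: "T \<in> ?s" and m: "w \<in> S" "x \<in> T" "y \<in> S" "z \<in> T" and l: "w < x" "x < y" "y < z"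
    have d1: "V = W" if "V \<in> ?s" "W \<in> \<sigma>1" "q \<in> V" "q \<in> W" for V W q
      using which[OF that(1,3)] r1[OF that(2,4)] nc_interval_disjoint[OF P1 _ that(2,3,4)] by auto
    consider "S = {a, c}" "w = a" "y = c" | "S \<in> \<sigma>1" | "S \<in> \<sigma>2"
      using which[OF S m(1)] which[OF S m(3)] l c S unfolding pair_glue_def by (smt (verit) insertE UnE less_trans less_irrefl)
    thus "S = T"
    proof cases
      case 1
      hence "T \<in> \<sigma>1" using which[OF T m(2)] l by auto
      thus ?thesis using r1[OF _ m(4)] 1 l by auto
    next
      case 2
      hence "T \<in> \<sigma>1" using which[OF T m(2)] r1[OF 2 m(1)] r1[OF 2 m(3)] l by auto
      thus ?thesis using nc_interval_noncrossing[OF P1 2 _ m l] by blast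
    next
      case 3
      hence "T \<in> \<sigma>2" using which[OF T m(2)] r2[OF 3 m(1)] l c by auto
      thus ?thesis using nc_interval_noncrossing[OF P2 3 _ m l] by blast
    qed
  qed
  moreover have "card {a, c} = 2" using c by simp
  ultimately show ?thesis using s1 s2 unfolding pairings_def pair_glue_def by blast
qed

text \<open>In a pairing, the successor of \<open>a\<close> within its block is the partner of \<open>a\<close>.\<close>

lemma pair_glue_recover:
  assumes c: "a < c" "c < b" and s1: "\<sigma>1 \<in> pairings (Suc a) c" and s2: "\<sigma>2 \<in> pairings (Suc c) b"
  shows "block_successor a (pair_glue a c \<sigma>1 \<sigma>2) = c"
    and "{W \<in> pair_glue a c \<sigma>1 \<sigma>2. W \<subseteq> {a<..<c}} = \<sigma>1"
    and "{W \<in> pair_glue a c \<sigma>1 \<sigma>2. W \<subseteq> {c<..<b}} = \<sigma>2"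
proof -
  have r1: "V \<subseteq> {a<..<c} \<and> \<not> V \<subseteq> {c<..<b} \<and> a \<notin> V" if "V \<in> \<sigma>1" for V
  proof -
    note p = pairing_block[OF s1 that]
    have "V \<subseteq> {a<..<c}" by (subst p(4)) (use p(1-3) in auto)
    moreover have "Min V \<in> V" by (subst (2) p(4)) simp
    hence "\<not> V \<subseteq> {c<..<b}" using p(2,3) by (metis greaterThanLessThan_iff less_asym less_trans subsetD)
    ultimately show ?thesis by (meson greaterThanLessThan_iff less_irrefl subsetD)
  qed
  have r2: "V \<subseteq> {c<..<b} \<and> \<not> V \<subseteq> {a<..<c} \<and> a \<notin> V" if "V \<in> \<sigma>2" for V
  proof -
    note p = pairing_block[OF s2 that]
    have "V \<subseteq> {c<..<b}" by (subst p(4)) (use p(1-3) in auto)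
    moreover have m: "Min V \<in> V" by (subst (2) p(4)) simp
    hence "\<not> V \<subseteq> {a<..<c}" using p(1) by (metis Suc_le_eq greaterThanLessThan_iff less_asym subsetD)
    ultimately show ?thesis using c by (meson greaterThanLessThan_iff less_asym subsetD)
  qed
  have ac: "\<not> {a, c} \<subseteq> {a<..<c}" "\<not> {a, c} \<subseteq> {c<..<b}" by auto
  show "{W \<in> pair_glue a c \<sigma>1 \<sigma>2. W \<subseteq> {a<..<c}} = \<sigma>1"
    using r1 r2 ac unfolding pair_glue_def by blast
  show "{W \<in> pair_glue a c \<sigma>1 \<sigma>2. W \<subseteq> {c<..<b}} = \<sigma>2"
    using r1 r2 ac unfolding pair_glue_def by blast
  have "V = {a, c}" if "V \<in> pair_glue a c \<sigma>1 \<sigma>2" "a \<in> V" for V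
    using that r1 r2 unfolding pair_glue_def by blast
  hence "{x. a < x \<and> (\<exists>V\<in>pair_glue a c \<sigma>1 \<sigma>2. a \<in> V \<and> x \<in> V)} = {c}"
    using c(1) unfolding pair_glue_def by auto
  thus "block_successor a (pair_glue a c \<sigma>1 \<sigma>2) = c" by (simp add: block_successor_def)
qed

lemma pair_unglue:
  assumes s: "\<sigma> \<in> pairings a b" and ab: "a < b"
  defines "c \<equiv> block_successor a \<sigma>"
  defines "\<sigma>1 \<equiv> {W \<in> \<sigma>. W \<subseteq> {a<..<c}}"
  defines "\<sigma>2 \<equiv> {W \<in> \<sigma>. W \<subseteq> {c<..<b}}"
  shows "a < c" "c < b" "\<sigma>1 \<in> pairings (Suc a) c" "\<sigma>2 \<in> pairings (Suc c) b" "pair_glue a c \<sigma>1 \<sigma>2 = \<sigma>"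
proof -
  have P: "\<sigma> \<in> nc_interval a b" using s by (simp add: pairings_def)
  obtain V where V: "V \<in> \<sigma>" "a \<in> V" using nc_interval_cover[OF P, of a] ab by blast
  note p = pairing_block[OF s V(1)]
  have aV: "a = Min V" using V(2) p by (metis insertE not_le singletonD order_antisym_conv less_or_eq_imp_le)
  have uV: "W = V" if "W \<in> \<sigma>" "a \<in> W" for W using nc_interval_disjoint[OF P that(1) V(1) that(2) V(2)] .
  have "{x. a < x \<and> (\<exists>V\<in>\<sigma>. a \<in> V \<and> x \<in> V)} = {Max V}"
  proof (intro equalityI subsetI)
    fix x assume "x \<in> {x. a < x \<and> (\<exists>V\<in>\<sigma>. a \<in> V \<and> x \<in> V)}"
    then obtain W where "a < x" "W \<in> \<sigma>" "a \<in> W" "x \<in> W" by blast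
    hence "a < x" "x \<in> V" using uV[of W] by simp_all
    thus "x \<in> {Max V}" using p(4) aV by (metis insertE less_irrefl)
  next
    fix x assume "x \<in> {Max V}"
    hence x: "x = Max V" by simp
    have "x \<in> V" unfolding x by (subst (2) p(4)) simp
    thus "x \<in> {x. a < x \<and> (\<exists>V\<in>\<sigma>. a \<in> V \<and> x \<in> V)}" using V p(2) aV x by auto
  qed
  hence c: "c = Max V" by (simp add: c_def block_successor_def)
  have Vac: "V = {a, c}" using p(4) aV c by simp
  show ac: "a < c" and cb: "c < b" using p aV c by simp_all
  have dich: "W = V \<or> W \<subseteq> {a<..<c} \<or> W \<subseteq> {c<..<b}" if W: "W \<in> \<sigma>" for W
  proof (rule ccontr)
    assume not: "\<not> ?thesis"
    note q = pairing_block[OF s W]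
    have nin: "a \<notin> W" "c \<notin> W" using uV[OF W] nc_interval_disjoint[OF P W V(1), of c] not Vac by blast+
    have mm: "Min W \<in> W" "Max W \<in> W" by (subst (2) q(4), simp)+
    have ne: "Min W \<noteq> a" "Max W \<noteq> a" "Min W \<noteq> c" "Max W \<noteq> c" using nin mm by metis+
    have sub: "W \<subseteq> A" if "Min W \<in> A" "Max W \<in> A" for A using that q(4) by (metis empty_subsetI insert_subset)
    have "\<not> (a < Min W \<and> Max W < c)" using sub[of "{a<..<c}"] not q(1-3) by auto
    moreover have "\<not> c < Min W" using sub[of "{c<..<b}"] not q(1-3) by auto
    ultimately have "a < Min W" "Min W < c" "c < Max W" using q(1-3) ne by linarith+
    hence "V = W" using nc_interval_noncrossing[OF P V(1) W V(2) mm(1) _ mm(2)] Vac by blast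
    thus False using not by simp
  qed
  have cover: "\<exists>W\<in>\<sigma>. x \<in> W \<and> (W \<subseteq> {a<..<c} \<or> W \<subseteq> {c<..<b})" if "a < x" "x < b" "x \<noteq> c" for x
  proof -
    obtain W where W: "W \<in> \<sigma>" "x \<in> W" using nc_interval_cover[OF P, of x] \<open>a < x\<close> \<open>x < b\<close> by auto
    hence "W \<noteq> V" using that Vac by blast
    thus ?thesis using W dich by blast
  qed
  have "\<sigma>1 \<in> nc_interval (Suc a) c"
  proof (rule nc_interval_subset[OF P])
    fix W assume "W \<in> \<sigma>1"
    thus "W \<subseteq> {Suc a..<c}" unfolding \<sigma>1_def by (simp add: atLeastSucLessThan_greaterThanLessThan)
  next
    fix x assume x: "Suc a \<le> x" "x < c"
    then obtain W where W: "W \<in> \<sigma>" "x \<in> W" "W \<subseteq> {a<..<c} \<or> W \<subseteq> {c<..<b}" using cover[of x] cb by auto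
    moreover have "\<not> W \<subseteq> {c<..<b}" using W(2) x by (meson greaterThanLessThan_iff less_asym subsetD)
    ultimately show "\<exists>W\<in>\<sigma>1. x \<in> W" unfolding \<sigma>1_def by blast
  qed (simp add: \<sigma>1_def)
  thus "\<sigma>1 \<in> pairings (Suc a) c" using s by (simp add: pairings_def \<sigma>1_def)
  have "\<sigma>2 \<in> nc_interval (Suc c) b"
  proof (rule nc_interval_subset[OF P])
    fix W assume "W \<in> \<sigma>2"
    thus "W \<subseteq> {Suc c..<b}" unfolding \<sigma>2_def by (simp add: atLeastSucLessThan_greaterThanLessThan)
  next
    fix x assume x: "Suc c \<le> x" "x < b"
    then obtain W where W: "W \<in> \<sigma>" "x \<in> W" "W \<subseteq> {a<..<c} \<or> W \<subseteq> {c<..<b}" using cover[of x] ac by auto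
    moreover have "\<not> W \<subseteq> {a<..<c}" using W(2) x by (meson greaterThanLessThan_iff less_asym subsetD Suc_le_eq)
    ultimately show "\<exists>W\<in>\<sigma>2. x \<in> W" unfolding \<sigma>2_def by blast
  qed (simp add: \<sigma>2_def)
  thus "\<sigma>2 \<in> pairings (Suc c) b" using s by (simp add: pairings_def \<sigma>2_def)
  show "pair_glue a c \<sigma>1 \<sigma>2 = \<sigma>"
    using dich V(1) unfolding pair_glue_def \<sigma>1_def \<sigma>2_def Vac[symmetric] by blast
qed

lemma sum_pairings:
  assumes ab: "a < b"
  shows "(\<Sum>\<sigma>\<in>pairings a b. F \<sigma>) =
    (\<Sum>c\<in>{a<..<b}. \<Sum>\<sigma>1\<in>pairings (Suc a) c. \<Sum>\<sigma>2\<in>pairings (Suc c) b. F (pair_glue a c \<sigma>1 \<sigma>2))"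
proof -
  have "(\<Sum>\<sigma>\<in>pairings a b. F \<sigma>) =
    (\<Sum>(c, \<sigma>1, \<sigma>2)\<in>(SIGMA c:{a<..<b}. pairings (Suc a) c \<times> pairings (Suc c) b). F (pair_glue a c \<sigma>1 \<sigma>2))"
  proof (rule sum.reindex_bij_witness[where i = "\<lambda>(c, \<sigma>1, \<sigma>2). pair_glue a c \<sigma>1 \<sigma>2" and
        j = "\<lambda>\<sigma>. let c = block_successor a \<sigma> in (c, {W \<in> \<sigma>. W \<subseteq> {a<..<c}}, {W \<in> \<sigma>. W \<subseteq> {c<..<b}})"], goal_cases)
    case (1 \<sigma>)
    thus ?case using pair_unglue(5)[of \<sigma> a b] ab by (simp add: Let_def)
  next
    case (2 \<sigma>)
    thus ?case using pair_unglue(1-4)[of \<sigma> a b] ab by (simp add: Let_def)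
  next
    case (3 q)
    then obtain c s1 s2 where q: "q = (c, s1, s2)" "a < c" "c < b" "s1 \<in> pairings (Suc a) c" "s2 \<in> pairings (Suc c) b"
      by auto
    show ?case using pair_glue_recover[OF q(2-5)] q(1) by (simp add: Let_def)
  next
    case (4 q)
    then obtain c s1 s2 where q: "q = (c, s1, s2)" "a < c" "c < b" "s1 \<in> pairings (Suc a) c" "s2 \<in> pairings (Suc c) b"
      by auto
    show ?case using pair_glue_in[OF q(2-5)] q(1) by simp
  next
    case (5 \<sigma>)
    thus ?case using pair_unglue(5)[of \<sigma> a b] ab by (simp add: Let_def)
  qed
  thus ?thesis
    by (subst (asm) sum.Sigma[symmetric]) (auto simp: finite_pairings sum.cartesian_product)
qed

lemma pairings_empty: "pairings a a = {{}}"
proof (intro equalityI subsetI)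
  fix \<sigma> assume s: "\<sigma> \<in> pairings a a"
  have "V \<notin> \<sigma>" for V using pairing_block(1-3)[OF s, of V] by linarith
  thus "\<sigma> \<in> {{}}" by blast
next
  fix \<sigma> :: "nat set set" assume "\<sigma> \<in> {{}}"
  hence "\<sigma> = {}" by simp
  have "{} \<in> nc_interval a a" by (rule nc_intervalI) simp_all
  thus "\<sigma> \<in> pairings a a" unfolding \<open>\<sigma> = {}\<close> by (simp add: pairings_def)
qed

definition outer_blocks :: "nat set set \<Rightarrow> nat set set" where
  "outer_blocks \<sigma> = {V \<in> \<sigma>. \<forall>T\<in>\<sigma>. \<not> inner_block V T}"

text \<open>The pair \<open>{a, c}\<close> is outer to all blocks of \<open>\<sigma>1\<close> and unrelated to those of \<open>\<sigma>2\<close>. Hence it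
raises the depths in \<open>\<sigma>1\<close> by one, and its nearest inner blocks are the outermost blocks of
\<open>\<sigma>1\<close>.\<close>

lemma glue_statistics:
  assumes c: "a < c" "c < b" and s1: "\<sigma>1 \<in> pairings (Suc a) c" and s2: "\<sigma>2 \<in> pairings (Suc c) b"
  defines "\<sigma> \<equiv> pair_glue a c \<sigma>1 \<sigma>2"
  shows "V \<in> \<sigma>1 \<Longrightarrow> depth \<sigma> V = Suc (depth \<sigma>1 V)"
    and "V \<in> \<sigma>2 \<Longrightarrow> depth \<sigma> V = depth \<sigma>2 V"
    and "depth \<sigma> {a, c} = 1"
    and "V \<in> \<sigma>1 \<Longrightarrow> num_nearest_inner \<sigma> V = num_nearest_inner \<sigma>1 V"
    and "V \<in> \<sigma>2 \<Longrightarrow> num_nearest_inner \<sigma> V = num_nearest_inner \<sigma>2 V"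
    and "num_nearest_inner \<sigma> {a, c} = card (outer_blocks \<sigma>1)"
    and "card (outer_blocks \<sigma>) = Suc (card (outer_blocks \<sigma>2))"
    and "{a, c} \<notin> \<sigma>1 \<union> \<sigma>2" "\<sigma>1 \<inter> \<sigma>2 = {}"
proof -
  have m1: "a < Min V \<and> Min V < Max V \<and> Max V < c" if "V \<in> \<sigma>1" for V
    using pairing_block(1-3)[OF s1 that] by simp
  have m2: "c < Min V \<and> Min V < Max V" if "V \<in> \<sigma>2" for V
    using pairing_block(1-3)[OF s2 that] by simp
  have m0: "Min {a, c} = a" "Max {a, c} = c" using c by auto
  have mem: "T \<in> \<sigma> \<longleftrightarrow> T = {a, c} \<or> T \<in> \<sigma>1 \<or> T \<in> \<sigma>2" for T by (auto simp: \<sigma>_def pair_glue_def)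
  have ex: "(\<exists>S\<in>\<sigma>. R S) \<longleftrightarrow> R {a, c} \<or> (\<exists>S\<in>\<sigma>1. R S) \<or> (\<exists>S\<in>\<sigma>2. R S)" for R
    by (auto simp: \<sigma>_def pair_glue_def)
  have nearest: "inner_block T W" if "nearest_inner \<rho> T W" for \<rho> T W
    using that by (simp add: nearest_inner_def)
  have i10: "inner_block V {a, c}" if "V \<in> \<sigma>1" for V using m1[OF that] m0 by (simp add: inner_block_def)
  have i12: "\<not> inner_block V T" if "V \<in> \<sigma>1" "T \<in> \<sigma>2" for V T
    using m1[OF that(1)] m2[OF that(2)] c by (simp add: inner_block_def)
  have i21: "\<not> inner_block V T" if "V \<in> \<sigma>2" "T \<in> \<sigma>1" for V T
    using m2[OF that(1)] m1[OF that(2)] c by (simp add: inner_block_def)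
  have i20: "\<not> inner_block V {a, c}" if "V \<in> \<sigma>2" for V
    using m2[OF that] m0 by (simp add: inner_block_def)
  have i01: "\<not> inner_block {a, c} V" if "V \<in> \<sigma>1" for V
    using m1[OF that] m0 by (simp add: inner_block_def)
  have i02: "\<not> inner_block {a, c} V" if "V \<in> \<sigma>2" for V
    using m2[OF that] m0 c by (simp add: inner_block_def)
  have i00: "\<not> inner_block {a, c} {a, c}" by (simp add: inner_block_def)
  have n1: "{a, c} \<notin> \<sigma>1" using m1[of "{a, c}"] m0 by auto
  have n2: "{a, c} \<notin> \<sigma>2" using m2[of "{a, c}"] m0 by auto
  show "{a, c} \<notin> \<sigma>1 \<union> \<sigma>2" using n1 n2 by blast
  show "\<sigma>1 \<inter> \<sigma>2 = {}"
  proof (intro equals0I)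
    fix V assume "V \<in> \<sigma>1 \<inter> \<sigma>2"
    thus False using m1[of V] m2[of V] by auto
  qed
  have fin: "finite \<sigma>1" "finite \<sigma>2" using pairings_finite s1 s2 by blast+
  { assume V: "V \<in> \<sigma>1"
    have "{T \<in> \<sigma>. inner_block V T} = insert {a, c} {T \<in> \<sigma>1. inner_block V T}"
      using i10[OF V] i12[OF V] by (auto simp: mem)
    thus "depth \<sigma> V = Suc (depth \<sigma>1 V)" using n1 fin by (simp add: depth_def)
    have "nearest_inner \<sigma> T V \<longleftrightarrow> nearest_inner \<sigma>1 T V" if "T \<in> \<sigma>1" for T
      unfolding nearest_inner_def ex using i01[OF V] i12[OF that] by blast
    moreover have "T \<in> \<sigma>1" if "T \<in> \<sigma>" "inner_block T V" for T
      using that i01[OF V] i21[OF _ V] unfolding mem by blast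
    ultimately have "T \<in> \<sigma> \<and> nearest_inner \<sigma> T V \<longleftrightarrow> T \<in> \<sigma>1 \<and> nearest_inner \<sigma>1 T V" for T
      by (metis mem nearest)
    thus "num_nearest_inner \<sigma> V = num_nearest_inner \<sigma>1 V" by (simp add: num_nearest_inner_def) }
  { assume V: "V \<in> \<sigma>2"
    have "{T \<in> \<sigma>. inner_block V T} = {T \<in> \<sigma>2. inner_block V T}"
      using i20[OF V] i21[OF V] by (auto simp: mem)
    thus "depth \<sigma> V = depth \<sigma>2 V" by (simp add: depth_def)
    have "nearest_inner \<sigma> T V \<longleftrightarrow> nearest_inner \<sigma>2 T V" if "T \<in> \<sigma>2" for T
      unfolding nearest_inner_def ex using i02[OF V] i12[OF _ V] by blast
    moreover have "T \<in> \<sigma>2" if "T \<in> \<sigma>" "inner_block T V" for T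
      using that i02[OF V] i12[OF _ V] unfolding mem by blast
    ultimately have "T \<in> \<sigma> \<and> nearest_inner \<sigma> T V \<longleftrightarrow> T \<in> \<sigma>2 \<and> nearest_inner \<sigma>2 T V" for T
      by (metis mem nearest)
    thus "num_nearest_inner \<sigma> V = num_nearest_inner \<sigma>2 V" by (simp add: num_nearest_inner_def) }
  have "{T \<in> \<sigma>. inner_block {a, c} T} = {}" using i00 i01 i02 by (auto simp: mem)
  thus "depth \<sigma> {a, c} = 1" unfolding depth_def by (metis card.empty add_0_right)
  have "nearest_inner \<sigma> T {a, c} \<longleftrightarrow> T \<in> outer_blocks \<sigma>1" if "T \<in> \<sigma>" for T
    using that unfolding mem nearest_inner_def ex outer_blocks_def using i00 i10 i20 i12 n1 by blast
  moreover have "outer_blocks \<sigma>1 \<subseteq> \<sigma>" by (auto simp: outer_blocks_def mem)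
  ultimately have "{T \<in> \<sigma>. nearest_inner \<sigma> T {a, c}} = outer_blocks \<sigma>1" by blast
  thus "num_nearest_inner \<sigma> {a, c} = card (outer_blocks \<sigma>1)" by (simp add: num_nearest_inner_def)
  have "V \<in> outer_blocks \<sigma> \<longleftrightarrow> V = {a, c} \<or> V \<in> outer_blocks \<sigma>2" for V
    using ex[of "inner_block V"] mem[of V] i00 i01 i02 i10[of V] i20[of V] i21[of V]
    unfolding outer_blocks_def by blast
  hence "outer_blocks \<sigma> = insert {a, c} (outer_blocks \<sigma>2)" by blast
  moreover have "{a, c} \<notin> outer_blocks \<sigma>2" "finite (outer_blocks \<sigma>2)"
    using n2 fin by (simp_all add: outer_blocks_def)
  ultimately show "card (outer_blocks \<sigma>) = Suc (card (outer_blocks \<sigma>2))" by simp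
qed

section \<open>Weighted pairings and alternating words\<close>

text \<open>The weight of a block depends on its left leg, on the parity of its depth and, in the odd case, on
its number of nearest inner blocks; \<open>ok\<close> tells which pairs are admissible.\<close>

locale pairing_weights =
  fixes ok :: "nat \<Rightarrow> nat \<Rightarrow> bool" and odd_weight :: "nat \<Rightarrow> nat \<Rightarrow> complex" and even_weight :: "nat \<Rightarrow> complex"
begin

text \<open>The flag says whether blocks of odd depth are to be weighted as odd ones: inside another block the
parity is reversed. Inadmissible blocks have weight 0, which turns a sum over admissible pairings into
a sum over all noncrossing pairings.\<close>

definition pair_weight :: "bool \<Rightarrow> nat set set \<Rightarrow> nat set \<Rightarrow> complex" where
  "pair_weight e \<sigma> V =
     (if \<not> ok (Min V) (Max V) then 0
      else if odd (depth \<sigma> V) = e then odd_weight (Min V) (num_nearest_inner \<sigma> V) else even_weight (Min V))"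

definition pair_sum :: "bool \<Rightarrow> nat \<Rightarrow> nat \<Rightarrow> complex" where
  "pair_sum e a b = (\<Sum>\<sigma>\<in>pairings a b. \<Prod>V\<in>\<sigma>. pair_weight e \<sigma> V)"

text \<open>The weighted sum over the pairings strictly inside a block of odd depth with left leg \<open>x\<close>,
including the weight of that block itself, whose nearest inner blocks are the outermost blocks of the
pairing and \<open>t\<close> further ones to the left of it.\<close>

definition children_sum :: "nat \<Rightarrow> nat \<Rightarrow> nat \<Rightarrow> nat \<Rightarrow> complex" where
  "children_sum x t a b =
     (\<Sum>\<sigma>\<in>pairings a b. odd_weight x (t + card (outer_blocks \<sigma>)) * (\<Prod>V\<in>\<sigma>. pair_weight False \<sigma> V))"

lemma pair_sum_empty: "pair_sum e a a = 1"
  by (simp add: pair_sum_def pairings_empty)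

lemma children_sum_empty: "children_sum x t a a = odd_weight x t"
  by (simp add: children_sum_def pairings_empty outer_blocks_def)

lemma prod_pair_weight_glue:
  assumes c: "a < c" "c < b" and s: "\<sigma>1 \<in> pairings (Suc a) c" "\<sigma>2 \<in> pairings (Suc c) b"
  shows "(\<Prod>V\<in>pair_glue a c \<sigma>1 \<sigma>2. pair_weight e (pair_glue a c \<sigma>1 \<sigma>2) V) =
    (if ok a c then (if e then odd_weight a (card (outer_blocks \<sigma>1)) else even_weight a) else 0) *
    (\<Prod>V\<in>\<sigma>1. pair_weight (\<not> e) \<sigma>1 V) * (\<Prod>V\<in>\<sigma>2. pair_weight e \<sigma>2 V)"
proof -
  let ?s = "pair_glue a c \<sigma>1 \<sigma>2"
  note st = glue_statistics[OF c s]
  have fin: "finite \<sigma>1" "finite \<sigma>2" using s pairings_finite by blast+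
  have "(\<Prod>V\<in>?s. pair_weight e ?s V) =
      pair_weight e ?s {a, c} * ((\<Prod>V\<in>\<sigma>1. pair_weight e ?s V) * (\<Prod>V\<in>\<sigma>2. pair_weight e ?s V))"
    unfolding pair_glue_def using st(8,9) fin by (simp add: prod.union_disjoint)
  also have "pair_weight e ?s {a, c} = (if ok a c then (if e then odd_weight a (card (outer_blocks \<sigma>1)) else even_weight a) else 0)"
    using c st(3,6) by (simp add: pair_weight_def)
  also have "(\<Prod>V\<in>\<sigma>1. pair_weight e ?s V) = (\<Prod>V\<in>\<sigma>1. pair_weight (\<not> e) \<sigma>1 V)"
    using st(1,4) by (intro prod.cong) (auto simp: pair_weight_def)
  also have "(\<Prod>V\<in>\<sigma>2. pair_weight e ?s V) = (\<Prod>V\<in>\<sigma>2. pair_weight e \<sigma>2 V)"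
    using st(2,5) by (intro prod.cong) (auto simp: pair_weight_def)
  finally show ?thesis by (simp only: mult.assoc)
qed

lemma pair_sum_rec:
  assumes "a < b"
  shows "pair_sum True a b =
    (\<Sum>c\<in>{a<..<b}. if ok a c then children_sum a 0 (Suc a) c * pair_sum True (Suc c) b else 0)"
  unfolding pair_sum_def sum_pairings[OF assms]
proof (rule sum.cong[OF refl])
  fix c assume c: "c \<in> {a<..<b}"
  have "(\<Sum>s1\<in>pairings (Suc a) c. \<Sum>s2\<in>pairings (Suc c) b.
      \<Prod>V\<in>pair_glue a c s1 s2. pair_weight True (pair_glue a c s1 s2) V) =
    (\<Sum>s1\<in>pairings (Suc a) c. \<Sum>s2\<in>pairings (Suc c) b. (if ok a c then
      (odd_weight a (card (outer_blocks s1)) * (\<Prod>V\<in>s1. pair_weight False s1 V)) * (\<Prod>V\<in>s2. pair_weight True s2 V) else 0))"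
    using c by (intro sum.cong refl) (simp add: prod_pair_weight_glue[where b = b])
  also have "\<dots> = (if ok a c then children_sum a 0 (Suc a) c *
      (\<Sum>s2\<in>pairings (Suc c) b. \<Prod>V\<in>s2. pair_weight True s2 V) else 0)"
    by (simp add: children_sum_def sum_product)
  finally show "(\<Sum>s1\<in>pairings (Suc a) c. \<Sum>s2\<in>pairings (Suc c) b.
      \<Prod>V\<in>pair_glue a c s1 s2. pair_weight True (pair_glue a c s1 s2) V) = \<dots>" .
qed

lemma children_sum_rec:
  assumes "a < b"
  shows "children_sum x t a b =
    (\<Sum>c\<in>{a<..<b}. if ok a c then even_weight a * pair_sum True (Suc a) c * children_sum x (Suc t) (Suc c) b else 0)"
  unfolding children_sum_def sum_pairings[OF assms]
proof (rule sum.cong[OF refl])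
  fix c assume c: "c \<in> {a<..<b}"
  have "(\<Sum>s1\<in>pairings (Suc a) c. \<Sum>s2\<in>pairings (Suc c) b.
      odd_weight x (t + card (outer_blocks (pair_glue a c s1 s2))) *
      (\<Prod>V\<in>pair_glue a c s1 s2. pair_weight False (pair_glue a c s1 s2) V)) =
    (\<Sum>s1\<in>pairings (Suc a) c. \<Sum>s2\<in>pairings (Suc c) b. (if ok a c then
      (even_weight a * (\<Prod>V\<in>s1. pair_weight True s1 V)) *
      (odd_weight x (Suc t + card (outer_blocks s2)) * (\<Prod>V\<in>s2. pair_weight False s2 V)) else 0))"
    using c by (intro sum.cong refl) (simp add: prod_pair_weight_glue[where b = b] glue_statistics(7)[where b = b])
  also have "\<dots> = (if ok a c then even_weight a * pair_sum True (Suc a) c *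
      (\<Sum>s2\<in>pairings (Suc c) b. odd_weight x (Suc t + card (outer_blocks s2)) * (\<Prod>V\<in>s2. pair_weight False s2 V)) else 0)"
    unfolding pair_sum_def sum_distrib_left[of "even_weight a"] sum_product by simp
  finally show "(\<Sum>s1\<in>pairings (Suc a) c. \<Sum>s2\<in>pairings (Suc c) b.
      odd_weight x (t + card (outer_blocks (pair_glue a c s1 s2))) *
      (\<Prod>V\<in>pair_glue a c s1 s2. pair_weight False (pair_glue a c s1 s2) V)) = \<dots>" .
qed

end

text \<open>The word \<open>D\<^sub>i Y\<^sub>i D\<^sub>i\<^sub>+\<^sub>1 \<dots> Y\<^sub>j\<^sub>-\<^sub>1 D\<^sub>j\<close>, where \<open>Y\<^sub>t\<close> has the label \<open>lab t\<close> and \<open>D\<^sub>t\<close> is the projection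
with number \<open>face t\<close>.\<close>

definition path_word :: "(nat \<Rightarrow> 'u) \<Rightarrow> (nat \<Rightarrow> 'c) \<Rightarrow> nat \<Rightarrow> nat \<Rightarrow> ('u + 'c) list" where
  "path_word lab face i j = Inr (face i) # concat (map (\<lambda>t. [Inl (lab t), Inr (face (Suc t))]) [i..<j])"

lemma path_word_refl: "path_word lab face i i = [Inr (face i)]"
  by (simp add: path_word_def)

lemma path_word_step: "i < j \<Longrightarrow> path_word lab face i j = Inr (face i) # Inl (lab i) # path_word lab face (Suc i) j"
  by (simp add: path_word_def upt_conv_Cons)

lemma cut_path_word:
  assumes "i \<le> j"
  shows "cut (Inl u) A B (path_word lab face i j) =
    (\<Sum>v\<in>{i..<j}. if lab v = u then A (path_word lab face i v) * B (path_word lab face (Suc v) j) else 0)"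
  using assms
proof (induction "j - i" arbitrary: i A)
  case 0
  thus ?case by (auto simp: path_word_refl cut_def intro!: sum.neutral)
next
  case (Suc n)
  hence ij: "i < j" by simp
  let ?h = "[Inr (face i), Inl (lab i)]"
  have ix: "{x. x < length ?h \<and> ?h ! x = Inl u} = (if lab i = u then {1} else {})"
    by (auto simp: less_Suc_eq nth_Cons' split: if_splits)
  have "cut (Inl u) A B (path_word lab face i j) = cut (Inl u) A B (?h @ path_word lab face (Suc i) j)"
    using ij by (simp add: path_word_step)
  also have "\<dots> = (if lab i = u then A [Inr (face i)] * B (path_word lab face (Suc i) j) else 0) +
      cut (Inl u) (\<lambda>y. A (?h @ y)) B (path_word lab face (Suc i) j)"
    unfolding cut_append ix by simp
  also have "cut (Inl u) (\<lambda>y. A (?h @ y)) B (path_word lab face (Suc i) j) =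
      (\<Sum>v\<in>{Suc i..<j}. if lab v = u then A (?h @ path_word lab face (Suc i) v) * B (path_word lab face (Suc v) j) else 0)"
    using Suc ij by (intro Suc.hyps) auto
  also have "\<dots> = (\<Sum>v\<in>{Suc i..<j}. if lab v = u then A (path_word lab face i v) * B (path_word lab face (Suc v) j) else 0)"
    by (intro sum.cong) (auto simp: path_word_step[of i])
  finally show ?case using ij by (simp add: sum.atLeast_Suc_lessThan path_word_refl)
qed

lemma sum_over_odd:
  fixes f :: "nat \<Rightarrow> complex"
  assumes "\<And>c. even c \<Longrightarrow> f c = 0"
  shows "(\<Sum>c\<in>{2 * i + 2<..<2 * v + 2}. f c) = (\<Sum>w\<in>{i<..v}. f (2 * w + 1))"
proof -
  have "(\<Sum>c\<in>{2 * i + 2<..<2 * v + 2}. f c) = (\<Sum>c\<in>(\<lambda>w. 2 * w + 1) ` {i<..v}. f c)"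
  proof (rule sum.mono_neutral_right)
    show "\<forall>c\<in>{2 * i + 2<..<2 * v + 2} - (\<lambda>w. 2 * w + 1) ` {i<..v}. f c = 0"
    proof
      fix c assume c: "c \<in> {2 * i + 2<..<2 * v + 2} - (\<lambda>w. 2 * w + 1) ` {i<..v}"
      have "even c"
      proof (rule ccontr)
        assume "odd c"
        then obtain w where "c = 2 * w + 1" by (rule oddE)
        moreover from this c have "w \<in> {i<..v}" by auto
        ultimately show False using c by blast
      qed
      thus "f c = 0" by (rule assms)
    qed
  qed auto
  thus ?thesis by (simp add: sum.reindex inj_on_def)
qed

lemma sum_over_even:
  fixes f :: "nat \<Rightarrow> complex"
  assumes "\<And>c. odd c \<Longrightarrow> f c = 0"
  shows "(\<Sum>c\<in>{2 * i + 1<..<2 * j + 1}. f c) = (\<Sum>v\<in>{i..<j}. f (2 * v + 2))"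
proof -
  have "(\<Sum>c\<in>{2 * i + 1<..<2 * j + 1}. f c) = (\<Sum>c\<in>(\<lambda>v. 2 * v + 2) ` {i..<j}. f c)"
  proof (rule sum.mono_neutral_right)
    show "\<forall>c\<in>{2 * i + 1<..<2 * j + 1} - (\<lambda>v. 2 * v + 2) ` {i..<j}. f c = 0"
    proof
      fix c assume c: "c \<in> {2 * i + 1<..<2 * j + 1} - (\<lambda>v. 2 * v + 2) ` {i..<j}"
      have "odd c"
      proof (rule ccontr)
        assume "\<not> odd c"
        then obtain w where "c = 2 * w" by blast
        moreover from this c have "w - 1 \<in> {i..<j}" "c = 2 * (w - 1) + 2" by auto
        ultimately show False using c by blast
      qed
      thus "f c = 0" by (rule assms)
    qed
  qed auto
  thus ?thesis by (simp add: sum.reindex inj_on_def)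
qed

text \<open>The factor \<open>Y\<^sub>t\<close> of a word has the left leg \<open>2t+1\<close> and the right leg \<open>2t+2\<close>. So the leg \<open>a\<close> belongs
to the factor \<open>(a-1) div 2\<close>, and it is adjacent to the face \<open>a div 2\<close>.\<close>

definition legs_ok :: "(nat \<Rightarrow> 'u) \<Rightarrow> (nat \<Rightarrow> 'c) \<Rightarrow> nat \<Rightarrow> nat \<Rightarrow> bool" where
  "legs_ok lab face a c \<longleftrightarrow>
     odd a \<noteq> odd c \<and> face (a div 2) = face (c div 2) \<and> lab ((a - 1) div 2) = lab ((c - 1) div 2)"

definition leg_cumulant :: "('u \<Rightarrow> nat \<Rightarrow> complex) \<Rightarrow> (nat \<Rightarrow> 'u) \<Rightarrow> nat \<Rightarrow> nat \<Rightarrow> complex" where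
  "leg_cumulant \<kappa> lab a m = \<kappa> (lab ((a - 1) div 2)) (Suc m)"

definition leg_dim :: "('c \<Rightarrow> complex) \<Rightarrow> (nat \<Rightarrow> 'c) \<Rightarrow> nat \<Rightarrow> complex" where
  "leg_dim face_dim face a = face_dim (face (a div 2))"

text \<open>What is needed of the limit functional: its values on single projections, traciality together with
the orthogonality of the projections (\<open>rotate\<close>), and the Schwinger-Dyson equation.\<close>

locale path_functional =
  fixes lab :: "nat \<Rightarrow> 'u" and face :: "nat \<Rightarrow> 'c" and \<phi> :: "('u + 'c) list \<Rightarrow> complex"
    and \<kappa> :: "'u \<Rightarrow> nat \<Rightarrow> complex" and face_dim :: "'c \<Rightarrow> complex"
  assumes single: "\<phi> [Inr (face i)] = face_dim (face i)"
    and rotate: "i < j \<Longrightarrow> \<phi> (path_word lab face i j) =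
      (if face i = face j then \<phi> (Inl (lab i) # path_word lab face (Suc i) j) else 0)"
    and dyson: "i < j \<Longrightarrow> \<phi> (Inl (lab i) # path_word lab face (Suc i) j) =
      schwinger_dyson \<phi> (\<kappa> (lab i)) (Inl (lab i)) 0 (path_word lab face (Suc i) j)"
begin

sublocale pairing_weights "legs_ok lab face" "leg_cumulant \<kappa> lab" "leg_dim face_dim face" .

abbreviation "word \<equiv> path_word lab face"

text \<open>The letters chosen by the Schwinger-Dyson recursion form one block of a noncrossing partition;
the factor \<open>v\<close> is its last element. Between two consecutive chosen letters there is a word of the
same type, which by the hypothesis \<open>IH\<close> vanishes unless its two end faces agree, and otherwise has as its value
the dimension carried by a pair of even depth times the sum over the pairings inside that pair. Therefore the gaps before the last element add up to a
\<open>children_sum\<close>.\<close>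

lemma schwinger_dyson_word:
  assumes i: "i < j" and x: "lab ((x - 1) div 2) = lab i"
    and IH: "\<And>v w. v \<le> w \<Longrightarrow> w - v < j - i \<Longrightarrow>
      \<phi> (word v w) = (if face v = face w then face_dim (face v) * pair_sum True (2 * v + 1) (2 * w + 1) else 0)"
  shows "schwinger_dyson \<phi> (\<kappa> (lab i)) (Inl (lab i)) t (word (Suc i) j) =
    (\<Sum>v\<in>{i..<j}. if lab v = lab i then children_sum x t (2 * i + 2) (2 * v + 2) * \<phi> (word (Suc v) j) else 0)"
  using i x IH
proof (induction "j - i" arbitrary: i t rule: less_induct)
  case less
  let ?u = "lab i"
  let ?L = "schwinger_dyson \<phi> (\<kappa> ?u) (Inl ?u)"
  let ?C = "\<lambda>t w v. children_sum x t (2 * w + 2) (2 * v + 2)"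
  let ?I = "{Suc i..<j}"
  \<comment> \<open>The pair at the right leg of the factor \<open>i\<close> ends at the left leg of the next element \<open>w\<close> of the block.\<close>
  have children: "?C t i v = (\<Sum>w\<in>?I. if w \<le> v \<and> lab w = ?u then \<phi> (word (Suc i) w) * ?C (Suc t) w v else 0)"
    if v: "v \<in> ?I" for v
  proof -
    let ?f = "\<lambda>c. if legs_ok lab face (2 * i + 2) c then leg_dim face_dim face (2 * i + 2) *
      pair_sum True (Suc (2 * i + 2)) c * children_sum x (Suc t) (Suc c) (2 * v + 2) else 0"
    have "?C t i v = (\<Sum>c\<in>{2 * i + 2<..<2 * v + 2}. ?f c)"
      using v by (intro children_sum_rec) auto
    also have "\<dots> = (\<Sum>w\<in>{i<..v}. ?f (2 * w + 1))"
      by (rule sum_over_odd) (simp add: legs_ok_def)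
    also have "\<dots> = (\<Sum>w\<in>{i<..v}. if lab w = ?u then \<phi> (word (Suc i) w) * ?C (Suc t) w v else 0)"
    proof (rule sum.cong[OF refl])
      fix w assume w: "w \<in> {i<..v}"
      have "\<phi> (word (Suc i) w) = (if face (Suc i) = face w
          then face_dim (face (Suc i)) * pair_sum True (2 * Suc i + 1) (2 * w + 1) else 0)"
        using w v by (intro less.prems(3)) auto
      thus "?f (2 * w + 1) = (if lab w = ?u then \<phi> (word (Suc i) w) * ?C (Suc t) w v else 0)"
        by (auto simp: legs_ok_def leg_dim_def)
    qed
    also have "\<dots> = (\<Sum>w\<in>?I. if w \<le> v \<and> lab w = ?u then \<phi> (word (Suc i) w) * ?C (Suc t) w v else 0)"
      using v by (intro sum.mono_neutral_cong_left) auto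
    finally show ?thesis .
  qed
  have "?L t (word (Suc i) j) = \<kappa> ?u (Suc t) * \<phi> (word (Suc i) j) +
      (\<Sum>w\<in>?I. if lab w = ?u then \<phi> (word (Suc i) w) * ?L (Suc t) (word (Suc w) j) else 0)"
    using less.prems(1) by (subst schwinger_dyson_cut) (simp add: cut_path_word)
  also have "(\<Sum>w\<in>?I. if lab w = ?u then \<phi> (word (Suc i) w) * ?L (Suc t) (word (Suc w) j) else 0) =
      (\<Sum>w\<in>?I. \<Sum>v\<in>?I. if lab v = ?u \<and> w \<le> v \<and> lab w = ?u
        then \<phi> (word (Suc i) w) * ?C (Suc t) w v * \<phi> (word (Suc v) j) else 0)"
  proof (rule sum.cong[OF refl])
    fix w assume w: "w \<in> ?I"
    show "(if lab w = ?u then \<phi> (word (Suc i) w) * ?L (Suc t) (word (Suc w) j) else 0) =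
      (\<Sum>v\<in>?I. if lab v = ?u \<and> w \<le> v \<and> lab w = ?u
        then \<phi> (word (Suc i) w) * ?C (Suc t) w v * \<phi> (word (Suc v) j) else 0)"
    proof (cases "lab w = ?u")
      case True
      have "?L (Suc t) (word (Suc w) j) =
        (\<Sum>v\<in>{w..<j}. if lab v = lab w then ?C (Suc t) w v * \<phi> (word (Suc v) j) else 0)"
        unfolding True[symmetric]
      proof (rule less.hyps)
        show "lab ((x - 1) div 2) = lab w" using less.prems True by simp
        fix v' w' assume "v' \<le> w'" "w' - v' < j - w"
        thus "\<phi> (word v' w') = (if face v' = face w' then face_dim (face v') * pair_sum True (2 * v' + 1) (2 * w' + 1) else 0)"
          using w by (intro less.prems(3)) auto
      qed (use w in auto)
      also have "\<dots> = (\<Sum>v\<in>?I. if lab v = ?u \<and> w \<le> v then ?C (Suc t) w v * \<phi> (word (Suc v) j) else 0)"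
        using w True by (intro sum.mono_neutral_cong_left) auto
      finally show ?thesis using True by (auto simp: sum_distrib_left mult.assoc intro!: sum.cong)
    qed simp
  qed
  also have "\<dots> = (\<Sum>v\<in>?I. \<Sum>w\<in>?I. if lab v = ?u \<and> w \<le> v \<and> lab w = ?u
        then \<phi> (word (Suc i) w) * ?C (Suc t) w v * \<phi> (word (Suc v) j) else 0)"
    by (rule sum.swap)
  also have "\<dots> = (\<Sum>v\<in>?I. if lab v = ?u then ?C t i v * \<phi> (word (Suc v) j) else 0)"
  proof (rule sum.cong[OF refl])
    fix v assume v: "v \<in> ?I"
    show "(\<Sum>w\<in>?I. if lab v = ?u \<and> w \<le> v \<and> lab w = ?u
        then \<phi> (word (Suc i) w) * ?C (Suc t) w v * \<phi> (word (Suc v) j) else 0) =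
      (if lab v = ?u then ?C t i v * \<phi> (word (Suc v) j) else 0)"
      unfolding children[OF v] sum_distrib_right by (auto intro!: sum.cong sum.neutral)
  qed
  also have "\<kappa> ?u (Suc t) * \<phi> (word (Suc i) j) + \<dots> =
      (\<Sum>v\<in>{i..<j}. if lab v = ?u then ?C t i v * \<phi> (word (Suc v) j) else 0)"
    using less.prems(1,2) by (simp add: sum.atLeast_Suc_lessThan children_sum_empty leg_cumulant_def)
  finally show ?case .
qed

text \<open>The pair that contains the first leg ends at the right leg of the last element of the block of the first
factor, and the remaining word starts after it.\<close>

theorem word_pair_sum:
  assumes "i \<le> j"
  shows "\<phi> (word i j) = (if face i = face j then face_dim (face i) * pair_sum True (2 * i + 1) (2 * j + 1) else 0)"
  using assms
proof (induction "j - i" arbitrary: i j rule: less_induct)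
  case less
  show ?case
  proof (cases "i = j")
    case True
    thus ?thesis by (simp add: path_word_refl single pair_sum_empty)
  next
    case False
    hence ij: "i < j" using less.prems by simp
    show ?thesis
    proof (cases "face i = face j")
      case True
      let ?f = "\<lambda>c. if legs_ok lab face (2 * i + 1) c then children_sum (2 * i + 1) 0 (Suc (2 * i + 1)) c *
        pair_sum True (Suc c) (2 * j + 1) else 0"
      have "\<phi> (word i j) = schwinger_dyson \<phi> (\<kappa> (lab i)) (Inl (lab i)) 0 (word (Suc i) j)"
        using rotate[OF ij] dyson[OF ij] True by simp
      also have "\<dots> = (\<Sum>v\<in>{i..<j}. if lab v = lab i
          then children_sum (2 * i + 1) 0 (2 * i + 2) (2 * v + 2) * \<phi> (word (Suc v) j) else 0)"
        by (rule schwinger_dyson_word[OF ij]) (use less.hyps in auto)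
      also have "\<dots> = (\<Sum>v\<in>{i..<j}. face_dim (face i) * ?f (2 * v + 2))"
      proof (rule sum.cong[OF refl])
        fix v assume v: "v \<in> {i..<j}"
        have "\<phi> (word (Suc v) j) = (if face (Suc v) = face j
            then face_dim (face (Suc v)) * pair_sum True (2 * Suc v + 1) (2 * j + 1) else 0)"
          using v by (intro less.hyps) auto
        thus "(if lab v = lab i then children_sum (2 * i + 1) 0 (2 * i + 2) (2 * v + 2) * \<phi> (word (Suc v) j) else 0) =
            face_dim (face i) * ?f (2 * v + 2)"
          using True by (auto simp: legs_ok_def)
      qed
      also have "\<dots> = face_dim (face i) * (\<Sum>c\<in>{2 * i + 1<..<2 * j + 1}. ?f c)"
        unfolding sum_distrib_left[symmetric]
        by (subst sum_over_even[of ?f]) (auto simp: legs_ok_def)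
      also have "(\<Sum>c\<in>{2 * i + 1<..<2 * j + 1}. ?f c) = pair_sum True (2 * i + 1) (2 * j + 1)"
        using ij by (subst pair_sum_rec) auto
      finally show ?thesis using True by simp
    next
      case False
      thus ?thesis using rotate[OF ij] by simp
    qed
  qed
qed

end

section \<open>Block matrices\<close>

lemma mat_trace_commute:
  assumes "A \<in> carrier_mat n n" "B \<in> carrier_mat n n"
  shows "mat_trace (A * B) = mat_trace (B * A)"
proof -
  have "mat_trace (A * B) = (\<Sum>i<n. \<Sum>j<n. A $$ (i, j) * B $$ (j, i))"
    using assms by (auto simp: mat_trace_def scalar_prod_def lessThan_atLeast0 intro!: sum.cong)
  also have "\<dots> = (\<Sum>j<n. \<Sum>i<n. B $$ (j, i) * A $$ (i, j))"
    by (subst sum.swap) (simp add: mult.commute)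
  also have "\<dots> = mat_trace (B * A)"
    using assms by (auto simp: mat_trace_def scalar_prod_def lessThan_atLeast0 intro!: sum.cong)
  finally show ?thesis .
qed

lemma mat_adjoint_eq:
  fixes A :: "complex mat"
  assumes "A \<in> carrier_mat n n"
  shows "mat_adjoint A = mat n n (\<lambda>(i, j). cnj (A $$ (j, i)))"
  using assms by (intro eq_matI) (auto simp: mat_adjoint_def mat_of_rows_def)

lemma mat_adjoint_mult:
  fixes A B :: "complex mat"
  assumes "A \<in> carrier_mat n n" "B \<in> carrier_mat n n"
  shows "mat_adjoint (A * B) = mat_adjoint B * mat_adjoint A"
proof -
  have AB: "A * B \<in> carrier_mat n n" using assms by simp
  show ?thesis
    unfolding mat_adjoint_eq[OF AB] mat_adjoint_eq[OF assms(1)] mat_adjoint_eq[OF assms(2)]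
    using assms by (intro eq_matI) (auto simp: scalar_prod_def mult.commute intro!: sum.cong)
qed

lemma mat_list_prod_Cons: "mat_list_prod n (A # As) = A * mat_list_prod n As"
  by (simp add: mat_list_prod_def)

lemma mat_list_prod_Nil: "mat_list_prod n [] = 1\<^sub>m n"
  by (simp add: mat_list_prod_def)

lemma mat_list_prod_carrier:
  "set As \<subseteq> carrier_mat n n \<Longrightarrow> mat_list_prod n As \<in> carrier_mat n n"
  by (induction As) (auto simp: mat_list_prod_Cons mat_list_prod_Nil)

lemma mat_list_prod_append:
  "set As \<subseteq> carrier_mat n n \<Longrightarrow> set Bs \<subseteq> carrier_mat n n \<Longrightarrow>
    mat_list_prod n (As @ Bs) = mat_list_prod n As * mat_list_prod n Bs"
proof (induction As)
  case Nil
  thus ?case using mat_list_prod_carrier[of Bs n] by (simp add: mat_list_prod_Nil)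
next
  case (Cons A As)
  thus ?case using mat_list_prod_carrier[of Bs n] mat_list_prod_carrier[of As n]
    by (simp add: mat_list_prod_Cons assoc_mult_mat[of _ n n _ n _ n])
qed

lemma mat_list_prod_replicate:
  assumes "A \<in> carrier_mat n n"
  shows "mat_list_prod n (replicate k A) = A ^\<^sub>m k"
proof (induction k)
  case 0
  thus ?case using assms by (simp add: mat_list_prod_Nil)
next
  case (Suc k)
  have "mat_list_prod n (replicate (Suc k) A) = mat_list_prod n (replicate k A @ [A])"
    by (simp add: replicate_append_same)
  also have "\<dots> = A ^\<^sub>m k * A"
    using assms Suc by (subst mat_list_prod_append) (auto simp: mat_list_prod_Cons mat_list_prod_Nil)
  finally show ?case by simp
qed

lemma block_diag_carrier [simp]: "block_diag N j n \<in> carrier_mat n n"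
  by (simp add: block_diag_def)

lemma block_diag_diagonal: "diagonal_mat (block_diag N j n)"
  by (auto simp: diagonal_mat_def block_diag_def)

lemma block_ranges_disjoint:
  fixes f :: "nat \<Rightarrow> nat"
  assumes "j \<noteq> j'" "(\<Sum>m\<in>{1..<j}. f m) \<le> i" "i < (\<Sum>m\<in>{1..j}. f m)"
    "(\<Sum>m\<in>{1..<j'}. f m) \<le> i" "i < (\<Sum>m\<in>{1..j'}. f m)"
  shows False
proof -
  have le: "(\<Sum>m\<in>{1..a}. f m) \<le> (\<Sum>m\<in>{1..<b}. f m)" if "a < b" for a b
    using that by (intro sum_mono2) auto
  from assms(1) consider "j < j'" | "j' < j" by linarith
  thus False using le[of j j'] le[of j' j] assms(2-5) by cases linarith+
qed

lemma diag_mult: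
  "mat n n (\<lambda>(i, l). if i = l \<and> P i then 1 else 0) * mat n n (\<lambda>(i, l). if i = l \<and> Q i then 1 else 0)
    = (mat n n (\<lambda>(i, l). if i = l \<and> P i \<and> Q i then 1 else 0) :: complex mat)"
proof (rule eq_matI)
  fix i l assume "i < dim_row (mat n n (\<lambda>(i, l). if i = l \<and> P i \<and> Q i then 1 else 0) :: complex mat)"
    "l < dim_col (mat n n (\<lambda>(i, l). if i = l \<and> P i \<and> Q i then 1 else 0) :: complex mat)"
  hence il: "i < n" "l < n" by auto
  have "(mat n n (\<lambda>(i, l). if i = l \<and> P i then 1 else 0) * mat n n (\<lambda>(i, l). if i = l \<and> Q i then 1 else 0)
      :: complex mat) $$ (i, l) =
      (\<Sum>k\<in>{0..<n}. (if i = k \<and> P i then 1 else 0) * (if k = l \<and> Q k then 1 else 0))"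
    using il by (simp add: scalar_prod_def)
  also have "\<dots> = (\<Sum>k\<in>{0..<n}. if k = i then (if i = l \<and> P i \<and> Q i then 1 else 0) else 0)"
    by (rule sum.cong) auto
  also have "\<dots> = (if i = l \<and> P i \<and> Q i then 1 else 0)" using il by simp
  finally show "(mat n n (\<lambda>(i, l). if i = l \<and> P i then 1 else 0) *
      mat n n (\<lambda>(i, l). if i = l \<and> Q i then 1 else 0) :: complex mat) $$ (i, l) =
      mat n n (\<lambda>(i, l). if i = l \<and> P i \<and> Q i then 1 else 0) $$ (i, l)" using il by simp
qed auto

lemma block_diag_mult:
  "block_diag N j n * block_diag N j' n = (if j = j' then block_diag N j n else 0\<^sub>m n n)"
proof -
  let ?R = "\<lambda>j i. (\<Sum>m\<in>{1..<j}. N m n) \<le> i \<and> i < (\<Sum>m\<in>{1..j}. N m n)"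
  have "block_diag N j n * block_diag N j' n = mat n n (\<lambda>(i, l). if i = l \<and> ?R j i \<and> ?R j' i then 1 else 0)"
    unfolding block_diag_def by (rule diag_mult)
  moreover have "\<not> (?R j i \<and> ?R j' i)" if "j \<noteq> j'" for i
    using block_ranges_disjoint[OF that, of "\<lambda>m. N m n" i] by blast
  ultimately show ?thesis by (auto simp: block_diag_def intro!: eq_matI)
qed

lemma block_diag_adjoint: "mat_adjoint (block_diag N j n) = block_diag N j n"
  unfolding mat_adjoint_eq[OF block_diag_carrier] by (rule eq_matI) (auto simp: block_diag_def)

lemma block_diag_trace:
  assumes "(\<Sum>m\<in>{1..p + 1}. N m n) = n"
  shows "mat_trace (block_diag N j n) = (if j \<in> {1..p + 1} then of_nat (N j n) else 0)"
proof -
  let ?a = "\<Sum>m\<in>{1..<j}. N m n" and ?b = "\<Sum>m\<in>{1..j}. N m n"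
  have "mat_trace (block_diag N j n) = (\<Sum>i<n. if ?a \<le> i \<and> i < ?b then 1 else 0)"
    unfolding mat_trace_def block_diag_def by (intro sum.cong) auto
  also have "\<dots> = of_nat (card ({..<n} \<inter> {?a..<?b}))"
    by (subst sum.inter_filter[symmetric]) (auto simp: Int_def intro: arg_cong[where f = card])
  finally have tr: "mat_trace (block_diag N j n) = of_nat (card ({..<n} \<inter> {?a..<?b}))" .
  consider "j \<in> {1..p + 1}" | "j = 0" | "p + 1 < j" by fastforce
  thus ?thesis
  proof cases
    case 1
    have "?b \<le> (\<Sum>m\<in>{1..p + 1}. N m n)" using 1 by (intro sum_mono2) auto
    hence "{..<n} \<inter> {?a..<?b} = {?a..<?b}" using assms by auto
    moreover have "{1..j} = insert j {1..<j}" using 1 by auto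
    hence "?b = N j n + ?a" by simp
    ultimately show ?thesis using tr 1 by simp
  next
    case 2
    thus ?thesis using tr by simp
  next
    case 3
    have "(\<Sum>m\<in>{1..p + 1}. N m n) \<le> ?a" using 3 by (intro sum_mono2) auto
    hence "{..<n} \<inter> {?a..<?b} = {}" using assms by auto
    thus ?thesis using tr 3 by simp
  qed
qed

text \<open>Uniform boundedness is required of the diagonal matrices to which asymptotic freeness is
applied.\<close>

lemma block_diag_norm: "mat_norm (block_diag N j n) \<le> 1"
  unfolding mat_norm_def
proof (rule cSUP_least)
  have "0\<^sub>v n \<in> {v \<in> carrier_vec (dim_col (block_diag N j n)). l2_norm v \<le> 1}"
    by (simp add: block_diag_def l2_norm_def)
  thus "{v \<in> carrier_vec (dim_col (block_diag N j n)). l2_norm v \<le> 1} \<noteq> {}" by blast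
next
  fix v :: "complex Matrix.vec" assume v: "v \<in> {v \<in> carrier_vec (dim_col (block_diag N j n)). l2_norm v \<le> 1}"
  hence vn: "dim_vec v = n" by (auto simp: block_diag_def)
  have entry: "cmod ((block_diag N j n *\<^sub>v v) $ i) \<le> cmod (v $ i)" if i: "i < n" for i
  proof -
    let ?c = "(\<Sum>m\<in>{1..<j}. N m n) \<le> i \<and> i < (\<Sum>m\<in>{1..j}. N m n)"
    have "(block_diag N j n *\<^sub>v v) $ i = (\<Sum>l\<in>{0..<n}. (if i = l \<and> ?c then 1 else 0) * v $ l)"
      using i vn by (simp add: block_diag_def scalar_prod_def)
    also have "\<dots> = (\<Sum>l\<in>{0..<n}. if l = i then (if ?c then v $ i else 0) else 0)"
      by (rule sum.cong) auto
    finally show ?thesis using i by simp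
  qed
  have "l2_norm (block_diag N j n *\<^sub>v v) \<le> l2_norm v"
    unfolding l2_norm_def using vn entry
    by (intro real_sqrt_le_mono) (auto simp: block_diag_def intro!: sum_mono power_mono)
  thus "l2_norm (block_diag N j n *\<^sub>v v) \<le> 1" using v by simp
qed

locale block_path =
  fixes n :: nat and y :: "'u \<Rightarrow> complex mat" and D :: "nat \<Rightarrow> complex mat"
    and lab :: "nat \<Rightarrow> 'u" and face :: "nat \<Rightarrow> nat"
  assumes y: "y (lab t) \<in> carrier_mat n n" and D: "D c \<in> carrier_mat n n" and DD: "D c * D c = D c"
begin

definition path_mat :: "nat \<Rightarrow> nat \<Rightarrow> complex mat" where
  "path_mat i j = mat_list_prod n (map (case_sum y D) (path_word lab face i j))"

lemma path_mat_refl: "path_mat i i = D (face i)"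
  using D[of "face i"] by (simp add: path_mat_def path_word_refl mat_list_prod_Cons mat_list_prod_Nil)

lemma path_mat_step: "i < j \<Longrightarrow> path_mat i j = D (face i) * (y (lab i) * path_mat (Suc i) j)"
  by (simp add: path_mat_def path_word_step mat_list_prod_Cons)

lemma path_mat_carrier: "path_mat i j \<in> carrier_mat n n"
  unfolding path_mat_def using y D by (intro mat_list_prod_carrier) (auto simp: path_word_def)

lemma path_mat_absorb_left: "i \<le> j \<Longrightarrow> D (face i) * path_mat i j = path_mat i j"
proof (cases "i = j")
  case True
  thus ?thesis by (simp add: path_mat_refl DD)
next
  case False
  moreover assume "i \<le> j"
  ultimately show ?thesis
    using assoc_mult_mat[OF D[of "face i"] D[of "face i"], of "y (lab i) * path_mat (Suc i) j" n]
      y[of i] path_mat_carrier[of "Suc i" j]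
    by (simp add: path_mat_step DD)
qed

lemma path_mat_step_absorbed:
  "i < j \<Longrightarrow> path_mat i j = D (face i) * y (lab i) * D (face (Suc i)) * path_mat (Suc i) j"
  using D[of "face i"] D[of "face (Suc i)"] y[of i] path_mat_carrier[of "Suc i" j] path_mat_absorb_left[of "Suc i" j]
  by (simp add: path_mat_step assoc_mult_mat[of _ n n _ n _ n])

lemma path_mat_compose: "i \<le> j \<Longrightarrow> j \<le> l \<Longrightarrow> path_mat i j * path_mat j l = path_mat i l"
proof (induction "j - i" arbitrary: i)
  case 0
  thus ?case by (simp add: path_mat_refl path_mat_absorb_left)
next
  case (Suc m)
  hence i: "i < j" "i < l" by auto
  have IH: "path_mat (Suc i) j * path_mat j l = path_mat (Suc i) l" using Suc i by (intro Suc.hyps) auto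
  note c = D[of "face i"] y[of i] path_mat_carrier[of "Suc i" j] path_mat_carrier[of j l]
  have "path_mat i j * path_mat j l = D (face i) * (y (lab i) * (path_mat (Suc i) j * path_mat j l))"
    using c i by (simp add: path_mat_step assoc_mult_mat[of _ n n _ n _ n])
  thus ?case using i by (simp add: IH path_mat_step)
qed

lemma path_mat_snoc: "i \<le> j \<Longrightarrow> path_mat i (Suc j) = path_mat i j * y (lab j) * D (face (Suc j))"
proof -
  assume ij: "i \<le> j"
  note c = D[of "face j"] D[of "face (Suc j)"] y[of j] path_mat_carrier[of i j]
  have "path_mat i (Suc j) = path_mat i j * path_mat j (Suc j)"
    using ij by (simp add: path_mat_compose)
  also have "\<dots> = (path_mat i j * path_mat j j) * y (lab j) * D (face (Suc j))"
    using c by (simp add: path_mat_step path_mat_refl assoc_mult_mat[of _ n n _ n _ n])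
  also have "path_mat i j * path_mat j j = path_mat i j" using ij by (simp add: path_mat_compose)
  finally show ?thesis .
qed

text \<open>The word of \<open>B\<^sup>*\<close> is the mirror image of the word of \<open>B\<close>; so it continues the latter if faces and
labels are symmetric about the position \<open>p\<close>.\<close>

lemma path_mat_adjoint:
  assumes sym: "\<And>t. t \<le> p \<Longrightarrow> face (2 * p - t) = face t" "\<And>t. t < p \<Longrightarrow> lab (2 * p - Suc t) = lab t"
    and herm: "\<And>t. mat_adjoint (y (lab t)) = y (lab t)" "\<And>c. mat_adjoint (D c) = D c" and i: "i \<le> p"
  shows "mat_adjoint (path_mat i p) = path_mat p (2 * p - i)"
  using i
proof (induction "p - i" arbitrary: i)
  case 0
  thus ?case by (simp add: path_mat_refl herm)
next
  case (Suc m)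
  hence i: "i < p" by simp
  note c = D[of "face i"] y[of i] path_mat_carrier[of "Suc i" p]
  have IH: "mat_adjoint (path_mat (Suc i) p) = path_mat p (2 * p - Suc i)"
    using Suc i by (intro Suc.hyps) auto
  have "mat_adjoint (path_mat i p) = mat_adjoint (path_mat (Suc i) p) * y (lab i) * D (face i)"
    using c i by (simp add: path_mat_step mat_adjoint_mult[of _ n] herm)
  also have "\<dots> = path_mat p (2 * p - Suc i) * y (lab (2 * p - Suc i)) * D (face (Suc (2 * p - Suc i)))"
    using i IH sym(1)[of i] sym(2)[of i] by (simp add: Suc_diff_Suc)
  also have "\<dots> = path_mat p (Suc (2 * p - Suc i))"
    using i by (simp add: path_mat_snoc)
  finally show ?case using i by (simp add: Suc_diff_Suc)
qed

lemma path_mat_shift: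
  assumes "\<And>t. face (t + m) = face t" "\<And>t. lab (t + m) = lab t"
  shows "path_mat (i + m * k) (j + m * k) = path_mat i j"
proof -
  have f: "face (t + m * k) = face t" "lab (t + m * k) = lab t" for t
  proof (induction k)
    case (Suc k)
    have "t + m * Suc k = (t + m * k) + m" by simp
    thus "face (t + m * Suc k) = face t" "lab (t + m * Suc k) = lab t"
      using Suc assms by (simp_all only:)
  qed simp_all
  have "map (\<lambda>t. [Inl (lab t), Inr (face (Suc t))]) [i + m * k..<j + m * k] =
      (map (\<lambda>t. [Inl (lab t), Inr (face (Suc t))]) [i..<j] :: ('u + nat) list list)"
  proof (rule nth_equalityI)
    fix x assume "x < length (map (\<lambda>t. [Inl (lab t), Inr (face (Suc t))]) [i + m * k..<j + m * k] :: ('u + nat) list list)"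
    thus "(map (\<lambda>t. [Inl (lab t), Inr (face (Suc t))]) [i + m * k..<j + m * k] :: ('u + nat) list list) ! x =
        map (\<lambda>t. [Inl (lab t), Inr (face (Suc t))]) [i..<j] ! x"
      using f(1)[of "Suc (i + x)"] f(2)[of "i + x"] by (simp add: ac_simps)
  qed simp
  thus ?thesis by (simp add: path_mat_def path_word_def f)
qed

text \<open>For \<open>k = 0\<close> the factor \<open>D (face 0)\<close> turns the identity matrix into the word that consists of a
single projection.\<close>

lemma path_mat_power:
  assumes "\<And>t. face (t + m) = face t" "\<And>t. lab (t + m) = lab t"
  shows "D (face 0) * path_mat 0 m ^\<^sub>m k = path_mat 0 (m * k)"
proof (induction k)
  case 0
  have "dim_row (path_mat 0 m) = n" using path_mat_carrier[of 0 m] by auto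
  thus ?case using D[of "face 0"] by (simp add: path_mat_refl)
next
  case (Suc k)
  have "D (face 0) * path_mat 0 m ^\<^sub>m Suc k = D (face 0) * path_mat 0 m ^\<^sub>m k * path_mat 0 m"
    using D path_mat_carrier pow_carrier_mat[OF path_mat_carrier[of 0 m], of k]
    by (simp add: assoc_mult_mat[of _ n n _ n _ n])
  also have "\<dots> = path_mat 0 (m * k) * path_mat (0 + m * k) (m + m * k)"
    using Suc path_mat_shift[OF assms, of 0 k m] by simp
  finally show ?case by (simp add: path_mat_compose)
qed

end

section \<open>Colours and labels of the legs\<close>

lemma word_power_nth:
  assumes "x < k * length w"
  shows "word_power w k ! x = w ! (x mod length w)"
  using assms
proof (induction k arbitrary: x)
  case (Suc k)
  have wp: "word_power w (Suc k) = w @ word_power w k" by (simp add: word_power_def)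
  show ?case
  proof (cases "x < length w")
    case True
    thus ?thesis by (simp add: wp nth_append)
  next
    case False
    hence "word_power w (Suc k) ! x = word_power w k ! (x - length w)" by (simp add: wp nth_append)
    also have "\<dots> = w ! ((x - length w) mod length w)" using Suc False by (intro Suc.IH) auto
    also have "(x - length w) mod length w = x mod length w" using False by (simp add: le_mod_geq)
    finally show ?thesis .
  qed
qed simp

text \<open>The faces and labels of \<open>(BB\<^sup>*)\<^sup>k\<close>, which repeat with period \<open>2p\<close>: the word runs from \<open>D\<^sub>1\<close> up to
\<open>D\<^sub>p\<^sub>+\<^sub>1\<close> and back. The factor \<open>Y(u\<^sub>j)\<close> stands between \<open>D\<^sub>j\<close> and \<open>D\<^sub>j\<^sub>+\<^sub>1\<close>.\<close>

definition face_index :: "nat \<Rightarrow> nat \<Rightarrow> nat" where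
  "face_index p t = (let q = t mod (2 * p) in if q \<le> p then q + 1 else 2 * p - q + 1)"

definition label_index :: "nat \<Rightarrow> nat \<Rightarrow> nat" where
  "label_index p t = (let q = t mod (2 * p) in if q < p then q + 1 else 2 * p - q)"

definition face_letter_index :: "nat \<Rightarrow> nat" where
  "face_letter_index f = (if f = 1 then 1 else 2 * (f - 1))"

text \<open>The colour of a leg that is adjacent to the face \<open>f\<close>. Left legs are starred and right legs are
not, but for \<open>f = 1\<close> it is the other way round, because the first letter of the word is \<open>1\<close> and not
\<open>1\<^sup>*\<close>.\<close>

definition leg_letter :: "nat \<Rightarrow> bool \<Rightarrow> letter" where
  "leg_letter f left = (if left = (f \<noteq> 1) then Star (face_letter_index f) else Plain (face_letter_index f))"

lemma W_tilde_nth: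
  assumes "x < 4 * p"
  shows "W_tilde p ! x = (if x < 2 * p then Plain (x + 1) else Star (4 * p - x))"
proof (cases "x < 2 * p")
  case True
  thus ?thesis by (simp add: W_tilde_def nth_append del: upt_Suc)
next
  case False
  hence "W_tilde p ! x = Star (rev [1..<2 * p + 1] ! (x - 2 * p))"
    using assms by (simp add: W_tilde_def nth_append del: upt_Suc)
  also have "rev [1..<2 * p + 1] ! (x - 2 * p) = 4 * p - x"
    using assms False by (subst rev_nth) (simp_all del: upt_Suc)
  finally show ?thesis using False by simp
qed

lemma length_W_tilde: "length (W_tilde p) = 4 * p"
  by (simp add: W_tilde_def)

text \<open>The substitution of letters that defines \<open>W\<^sub>0\<close> is made precisely so that the two legs adjacent
to the same projection get the same index.\<close>

lemma face_index_of_leg: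
  assumes "x < 4 * p"
  shows "W0 p ! x = leg_letter (face_index p ((x + 1) div 2)) (even x)"
proof -
  have W: "W0 p ! x = W_subst (if x < 2 * p then Plain (x + 1) else Star (4 * p - x))"
    using assms by (simp add: W0_def length_W_tilde W_tilde_nth)
  consider (a) q where "x = 2 * q" "q < p" | (b) q where "x = 2 * q + 1" "q < p"
    | (c) q where "x = 4 * p - 2 * q" "1 \<le> q" "q \<le> p" | (d) q where "x = 4 * p - (2 * q + 1)" "q < p"
  proof (cases "x < 2 * p")
    case True
    thus ?thesis using a b by (cases "even x") (auto elim!: evenE oddE)
  next
    case False
    obtain m where m: "x = 4 * p - m" "1 \<le> m" "m \<le> 2 * p"
      using assms False by (intro that[of "4 * p - x"]) auto
    show ?thesis
    proof (cases "even m")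
      case True
      then obtain q where "m = 2 * q" by blast
      thus ?thesis using m by (intro c[of q]) auto
    next
      case False
      then obtain q where "m = 2 * q + 1" by (rule oddE)
      thus ?thesis using m by (intro d[of q]) auto
    qed
  qed
  thus ?thesis
  proof cases
    case a
    have "(x + 1) div 2 = q" using a by simp
    moreover have "q mod (2 * p) = q" using a by simp
    ultimately show ?thesis using a
      unfolding W by (auto simp: face_index_def Let_def leg_letter_def face_letter_index_def)
  next
    case b
    have "(x + 1) div 2 = q + 1" using b by simp
    moreover have "(q + 1) mod (2 * p) = q + 1" using b by simp
    ultimately show ?thesis using b
      unfolding W by (auto simp: face_index_def Let_def leg_letter_def face_letter_index_def)
  next
    case c
    have "(x + 1) div 2 = 2 * p - q" using c by linarith
    moreover have "(2 * p - q) mod (2 * p) = 2 * p - q" using c by simp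
    moreover have "4 * p - x = 2 * q" "\<not> x < 2 * p" "even x" using c by auto
    moreover have "2 * p - q \<le> p \<longleftrightarrow> q = p" "2 * p - (2 * p - q) = q" using c by auto
    ultimately show ?thesis using c
      unfolding W by (auto simp: face_index_def Let_def leg_letter_def face_letter_index_def)
  next
    case d
    have x: "(x + 1) div 2 = 2 * p - q" using d by linarith
    have y: "4 * p - x = 2 * q + 1" "\<not> x < 2 * p" "odd x" using d by auto
    show ?thesis
    proof (cases "q = 0")
      case True
      thus ?thesis using x y unfolding W by (simp add: face_index_def leg_letter_def face_letter_index_def)
    next
      case False
      hence "(2 * p - q) mod (2 * p) = 2 * p - q" using d by simp
      moreover have "\<not> 2 * p - q \<le> p" "2 * p - (2 * p - q) = q" using d by auto
      ultimately show ?thesis using x y False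
        unfolding W by (auto simp: face_index_def Let_def leg_letter_def face_letter_index_def)
    qed
  qed
qed

lemma label_index_of_leg:
  assumes "x < 4 * p"
  shows "(letter_index (W_tilde p ! x) + 1) div 2 = label_index p (x div 2)"
proof -
  have q: "x div 2 < 2 * p" using assms by auto
  show ?thesis
  proof (cases "x < 2 * p")
    case True
    hence "x div 2 < p" by auto
    thus ?thesis using True q assms by (simp add: W_tilde_nth label_index_def)
  next
    case False
    hence "\<not> x div 2 < p" by auto
    moreover have "(4 * p - x + 1) div 2 = 2 * p - x div 2" using assms by linarith
    ultimately show ?thesis using False q assms by (simp add: W_tilde_nth label_index_def)
  qed
qed

lemma face_index_mod: "face_index p (t mod (2 * p)) = face_index p t"
  by (simp add: face_index_def)

lemma label_index_mod: "label_index p (t mod (2 * p)) = label_index p t"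
  by (simp add: label_index_def)

lemma face_index_periodic: "face_index p (t + 2 * p) = face_index p t"
  by (simp add: face_index_def)

lemma label_index_periodic: "label_index p (t + 2 * p) = label_index p t"
  by (simp add: label_index_def)

lemma face_index_range: "1 \<le> p \<Longrightarrow> face_index p t \<in> {1..p + 1}"
  by (auto simp: face_index_def Let_def)

lemma label_index_range:
  assumes "1 \<le> p" shows "label_index p t \<in> {1..p}"
proof -
  have "t mod (2 * p) < 2 * p" using assms by simp
  thus ?thesis by (auto simp: label_index_def Let_def)
qed

lemma leg_position:
  fixes s p :: nat
  assumes s: "1 \<le> s" and p: "1 \<le> p"
  defines "x \<equiv> (s - 1) mod (4 * p)"
  shows "x < 4 * p" "even x = odd s"
    "((x + 1) div 2) mod (2 * p) = (s div 2) mod (2 * p)" "(x div 2) mod (2 * p) = ((s - 1) div 2) mod (2 * p)"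
proof -
  show "x < 4 * p" using p by (simp add: x_def)
  define m where "m = (s - 1) div (4 * p)"
  have "s - 1 = 4 * p * m + x" by (simp add: m_def x_def)
  hence s': "s = 2 * (2 * p * m) + (x + 1)" "s - 1 = 2 * (2 * p * m) + x" using s by auto
  show "even x = odd s" unfolding s'(1) by simp
  have "s div 2 = 2 * p * m + (x + 1) div 2" unfolding s'(1) by simp
  thus "((x + 1) div 2) mod (2 * p) = (s div 2) mod (2 * p)" by simp
  have "(s - 1) div 2 = 2 * p * m + x div 2" unfolding s'(2) by simp
  thus "(x div 2) mod (2 * p) = ((s - 1) div 2) mod (2 * p)" by simp
qed

lemma leg_colour_eq:
  assumes "s \<in> {1..4 * p * k}" "1 \<le> p"
  shows "leg_colour p k s = leg_letter (face_index p (s div 2)) (odd s)"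
proof -
  let ?x = "(s - 1) mod (4 * p)"
  note x = leg_position[of s p]
  have "leg_colour p k s = W0 p ! ?x"
    unfolding leg_colour_def using assms
    by (subst word_power_nth) (auto simp: W0_def length_W_tilde mult.commute mult.left_commute)
  also have "\<dots> = leg_letter (face_index p ((?x + 1) div 2)) (even ?x)"
    using x(1) assms by (intro face_index_of_leg) auto
  also have "face_index p ((?x + 1) div 2) = face_index p (s div 2)"
    using x(3) assms face_index_mod by (metis atLeastAtMost_iff)
  finally show ?thesis using x(2) assms by simp
qed

lemma leg_label_eq:
  assumes "s \<in> {1..4 * p * k}" "1 \<le> p"
  shows "leg_label p u k s = u (label_index p ((s - 1) div 2))"
proof -
  let ?x = "(s - 1) mod (4 * p)"
  note x = leg_position[of s p]
  have "leg_label p u k s = W_labels p u ! ?x"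
    unfolding leg_label_def using assms
    by (subst word_power_nth) (auto simp: W_labels_def length_W_tilde mult.commute mult.left_commute)
  also have "\<dots> = u ((letter_index (W_tilde p ! ?x) + 1) div 2)"
    using x(1) assms by (simp add: W_labels_def length_W_tilde)
  also have "(letter_index (W_tilde p ! ?x) + 1) div 2 = label_index p (?x div 2)"
    using x(1) assms by (intro label_index_of_leg) auto
  also have "label_index p (?x div 2) = label_index p ((s - 1) div 2)"
    using x(4) assms label_index_mod by (metis atLeastAtMost_iff)
  finally show ?thesis .
qed

text \<open>The letter index determines the face, and among the legs of one face the star distinguishes the left
legs from the right ones.\<close>

lemma letter_pair_iff:
  assumes f: "f \<in> {1..p + 1}" "f' \<in> {1..p + 1}"
  shows "(\<exists>j \<in> {1} \<union> {2 * i | i. i \<in> {1..p}}. {leg_letter f e, leg_letter f' e'} = {Plain j, Star j})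
    \<longleftrightarrow> e \<noteq> e' \<and> f = f'"
proof
  assume "\<exists>j \<in> {1} \<union> {2 * i | i. i \<in> {1..p}}. {leg_letter f e, leg_letter f' e'} = {Plain j, Star j}"
  then obtain j where j: "{leg_letter f e, leg_letter f' e'} = {Plain j, Star j}" by blast
  have idx: "letter_index (leg_letter f e) = face_letter_index f" for f e by (simp add: leg_letter_def)
  have "letter_index ` {leg_letter f e, leg_letter f' e'} = {j}" unfolding j by simp
  hence "face_letter_index f = face_letter_index f'" by (simp add: idx)
  moreover have "f = f'" if "face_letter_index f = face_letter_index f'"
  proof -
    have "odd (face_letter_index h) \<longleftrightarrow> h = 1" for h by (simp add: face_letter_index_def)
    from this[of f] this[of f'] that have "f = 1 \<longleftrightarrow> f' = 1" by simp
    thus ?thesis using that f by (cases "f = 1") (auto simp: face_letter_index_def)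
  qed
  ultimately have ff: "f = f'" by simp
  moreover have "e \<noteq> e'"
  proof
    assume "e = e'"
    hence "{Plain j, Star j} = {leg_letter f e}" using j ff by simp
    thus False by (metis doubleton_eq_iff insert_absorb2 letter.distinct(1))
  qed
  ultimately show "e \<noteq> e' \<and> f = f'" by simp
next
  assume ee: "e \<noteq> e' \<and> f = f'"
  have "face_letter_index f \<in> {1} \<union> {2 * i | i. i \<in> {1..p}}"
    using f by (auto simp: face_letter_index_def intro!: exI[of _ "f - 1"])
  moreover have "{leg_letter f e, leg_letter f' e'} = {Plain (face_letter_index f), Star (face_letter_index f)}"
    using ee by (cases e; cases e'; cases "f = 1") (auto simp: leg_letter_def)
  ultimately show "\<exists>j \<in> {1} \<union> {2 * i | i. i \<in> {1..p}}. {leg_letter f e, leg_letter f' e'} = {Plain j, Star j}"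
    by blast
qed

section \<open>The limit distribution\<close>

lemma joint_limit_eqI:
  assumes "has_joint_limit M a I \<phi>" "w \<in> lists I" "w' \<in> lists I"
    and "\<And>n \<omega>. \<omega> \<in> space M \<Longrightarrow>
      mat_trace (mat_list_prod n (map (\<lambda>i. a i n \<omega>) w)) = mat_trace (mat_list_prod n (map (\<lambda>i. a i n \<omega>) w'))"
  shows "\<phi> w = \<phi> w'"
proof -
  have "tau M n (\<lambda>\<omega>. mat_list_prod n (map (\<lambda>i. a i n \<omega>) w)) =
      tau M n (\<lambda>\<omega>. mat_list_prod n (map (\<lambda>i. a i n \<omega>) w'))" for n
    unfolding tau_def using assms(4)
    by (intro arg_cong2[where f = "(*)"] refl Bochner_Integration.integral_cong) auto
  moreover have lim: "(\<lambda>n. tau M n (\<lambda>\<omega>. mat_list_prod n (map (\<lambda>i. a i n \<omega>) v))) \<longlonglongrightarrow> \<phi> v" if "v \<in> lists I" for v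
    using assms(1) that unfolding has_joint_limit_def by blast
  ultimately show ?thesis using lim[OF assms(2)] lim[OF assms(3)] LIMSEQ_unique by simp
qed

lemma joint_limit_zero:
  assumes "has_joint_limit M a I \<phi>" "w \<in> lists I"
    and "\<And>n \<omega>. \<omega> \<in> space M \<Longrightarrow> mat_trace (mat_list_prod n (map (\<lambda>i. a i n \<omega>) w)) = 0"
  shows "\<phi> w = 0"
proof -
  have "tau M n (\<lambda>\<omega>. mat_list_prod n (map (\<lambda>i. a i n \<omega>) w)) = 0" for n
  proof -
    have "integral\<^sup>L M (\<lambda>\<omega>. mat_trace (mat_list_prod n (map (\<lambda>i. a i n \<omega>) w))) = integral\<^sup>L M (\<lambda>\<omega>. 0)"
      using assms(3) by (intro Bochner_Integration.integral_cong) auto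
    thus ?thesis by (simp add: tau_def)
  qed
  moreover have "(\<lambda>n. tau M n (\<lambda>\<omega>. mat_list_prod n (map (\<lambda>i. a i n \<omega>) w))) \<longlonglongrightarrow> \<phi> w"
    using assms(1,2) by (auto simp: has_joint_limit_def)
  ultimately show ?thesis using LIMSEQ_unique[OF _ tendsto_const] by simp
qed

lemma mat_trace_one: "mat_trace (1\<^sub>m n) = of_nat n"
  by (simp add: mat_trace_def)

lemma tau_one_limit:
  assumes "prob_space M" shows "(\<lambda>n. tau M n (\<lambda>\<omega>. 1\<^sub>m n)) \<longlonglongrightarrow> 1"
proof -
  have "\<forall>\<^sub>F n in sequentially. tau M n (\<lambda>\<omega>. 1\<^sub>m n) = 1"
    using eventually_gt_at_top[of 0]
    by eventually_elim (simp add: tau_def mat_trace_one prob_space.prob_space[OF assms])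
  thus ?thesis by (rule tendsto_eventually)
qed

lemma mat_list_prod_block_diag:
  "mat_list_prod n (map (\<lambda>c. block_diag N c n) (c # w)) = (if \<forall>b\<in>set w. b = c then block_diag N c n else 0\<^sub>m n n)"
proof (induction w arbitrary: c)
  case Nil
  thus ?case using right_mult_one_mat[OF block_diag_carrier[of N c n]]
    by (simp add: mat_list_prod_Cons mat_list_prod_Nil)
next
  case (Cons b w)
  have "mat_list_prod n (map (\<lambda>c. block_diag N c n) (c # b # w)) =
      block_diag N c n * (if \<forall>x\<in>set w. x = b then block_diag N b n else 0\<^sub>m n n)"
    using Cons by (simp add: mat_list_prod_Cons)
  thus ?case using right_mult_zero_mat[OF block_diag_carrier] by (auto simp: block_diag_mult)
qed

lemma block_diag_tau_limit:
  assumes sums: "\<And>n. (\<Sum>j\<in>{1..p + 1}. N j n) = n"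
    and conv: "\<And>j. j \<in> {1..p + 1} \<Longrightarrow> (\<lambda>n. real (N j n) / real n) \<longlonglongrightarrow> d j"
    and M: "prob_space M"
  shows "(\<lambda>n. tau M n (\<lambda>\<omega>. block_diag N c n)) \<longlonglongrightarrow> (if c \<in> {1..p + 1} then of_real (d c) else 0)"
proof (cases "c \<in> {1..p + 1}")
  case True
  have "tau M n (\<lambda>\<omega>. block_diag N c n) = of_real (real (N c n) / real n)" for n
    using True block_diag_trace[where p = p and N = N and n = n and j = c, OF sums] by (simp add: tau_def prob_space.prob_space[OF M])
  thus ?thesis using True tendsto_of_real[OF conv[OF True], where 'a = complex] by simp
next
  case False
  have "mat_trace (block_diag N c n) = 0" for n
    using block_diag_trace[where p = p and N = N and n = n and j = c, OF sums] unfolding if_not_P[OF False] .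
  thus ?thesis unfolding if_not_P[OF False] by (simp add: tau_def)
qed

lemma block_diag_joint_limit:
  assumes sums: "\<And>n. (\<Sum>j\<in>{1..p + 1}. N j n) = n"
    and conv: "\<And>j. j \<in> {1..p + 1} \<Longrightarrow> (\<lambda>n. real (N j n) / real n) \<longlonglongrightarrow> d j"
    and M: "prob_space M"
  shows "\<exists>\<psi>. has_joint_limit M (\<lambda>i n \<omega>. block_diag N i n) UNIV \<psi>"
proof -
  interpret prob_space M by (rule M)
  have "\<exists>l. (\<lambda>n. tau M n (\<lambda>\<omega>. mat_list_prod n (map (\<lambda>i. block_diag N i n) w))) \<longlonglongrightarrow> l" for w
  proof (cases w)
    case Nil
    thus ?thesis using tau_one_limit[OF M] by (auto simp: mat_list_prod_Nil)
  next
    case (Cons c v)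
    show ?thesis
    proof (cases "\<forall>b\<in>set v. b = c")
      case True
      thus ?thesis using block_diag_tau_limit[OF sums conv M, of c] unfolding Cons mat_list_prod_block_diag
        by auto
    next
      case False
      have "tau M n (\<lambda>\<omega>. mat_list_prod n (map (\<lambda>i. block_diag N i n) w)) = 0" for n
        unfolding Cons mat_list_prod_block_diag if_not_P[OF False] by (simp add: tau_def mat_trace_def)
      thus ?thesis by auto
    qed
  qed
  then obtain \<psi> where "(\<lambda>n. tau M n (\<lambda>\<omega>. mat_list_prod n (map (\<lambda>i. block_diag N i n) w))) \<longlonglongrightarrow> \<psi> w" for w
    by metis
  thus ?thesis by (auto simp: has_joint_limit_def)
qed

text \<open>This transports the Schwinger-Dyson equation from the joint distribution of the \<open>Y\<close>'s alone to the
joint distribution of the \<open>Y\<close>'s and the diagonal matrices.\<close>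

lemma schwinger_dyson_map:
  assumes f: "inj f" and eq: "\<And>w. w \<in> lists U \<Longrightarrow> \<phi> (map f w) = \<phi>' w" and w: "w \<in> lists U"
  shows "schwinger_dyson \<phi> \<kappa> (f u) t (map f w) = schwinger_dyson \<phi>' \<kappa> u t w"
  using w
proof (induction "length w" arbitrary: w t rule: less_induct)
  case less
  have "schwinger_dyson \<phi> \<kappa> (f u) t (map f w) = \<kappa> (Suc t) * \<phi>' w +
     (\<Sum>i | i < length w \<and> w ! i = u. \<phi>' (take i w) * schwinger_dyson \<phi>' \<kappa> u (Suc t) (drop (Suc i) w))"
  proof (subst schwinger_dyson.simps, intro arg_cong2[where f = "(+)"] arg_cong2[where f = "(*)"] refl sum.cong)
    show "\<phi> (map f w) = \<phi>' w" using less.prems by (rule eq)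
    show "{i. i < length (map f w) \<and> map f w ! i = f u} = {i. i < length w \<and> w ! i = u}"
      using f by (auto simp: inj_eq)
    fix i assume i: "i \<in> {i. i < length w \<and> w ! i = u}"
    have "take i w \<in> lists U" "drop (Suc i) w \<in> lists U"
      using less.prems by (auto dest: in_set_takeD in_set_dropD)
    thus "\<phi> (take i (map f w)) = \<phi>' (take i w)"
      "schwinger_dyson \<phi> \<kappa> (f u) (Suc t) (drop (Suc i) (map f w)) = schwinger_dyson \<phi>' \<kappa> u (Suc t) (drop (Suc i) w)"
      using i eq less.hyps[of "drop (Suc i) w"] by (auto simp: take_map drop_map)
  qed
  thus ?case by (subst (2) schwinger_dyson.simps)
qed

lemma NC2_pairings: "NC2 m = pairings 1 (m + 1)"
  by (simp add: NC2_def NC_def pairings_def nc_interval_def atLeastLessThanSuc_atLeastAtMost)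

text \<open>Whether a pair is admissible, and which weight it has, depends on the letters of \<open>W\<^sub>0\<close> only through
the faces and labels at its legs. The remaining noncrossing pairings can be added, because they have
weight 0.\<close>

lemma NC2_W0_sum:
  fixes p k :: nat and u :: "nat \<Rightarrow> 'u" and d :: "nat \<Rightarrow> real" and \<kappa> :: "'u \<Rightarrow> nat \<Rightarrow> complex"
  assumes p: "1 \<le> p"
  defines "lab \<equiv> \<lambda>t. u (label_index p t)"
  shows "(\<Sum>\<sigma>\<in>NC2_W0 p u k. \<Prod>V\<in>\<sigma>. block_weight p u k d \<kappa> \<sigma> V) =
    pairing_weights.pair_sum (legs_ok lab (face_index p)) (leg_cumulant \<kappa> lab)
      (leg_dim (\<lambda>f. of_real (d f)) (face_index p)) True 1 (4 * p * k + 1)"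
proof -
  interpret pairing_weights "legs_ok lab (face_index p)" "leg_cumulant \<kappa> lab"
    "leg_dim (\<lambda>f. of_real (d f)) (face_index p)" .
  let ?good = "\<lambda>V. (\<exists>j \<in> {1} \<union> {2 * i | i. i \<in> {1..p}}. leg_colour p k ` V = {Plain j, Star j}) \<and>
     (\<exists>v. leg_label p u k ` V = {v})"
  have block: "?good V \<longleftrightarrow> legs_ok lab (face_index p) (Min V) (Max V)"
    and weight: "legs_ok lab (face_index p) (Min V) (Max V) \<Longrightarrow> block_weight p u k d \<kappa> \<sigma> V = pair_weight True \<sigma> V"
    if s: "\<sigma> \<in> NC2 (4 * p * k)" and V: "V \<in> \<sigma>" for \<sigma> V
  proof -
    note b = pairing_block[OF s[unfolded NC2_pairings] V]
    let ?a = "Min V" and ?c = "Max V"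
    have a: "?a \<in> {1..4 * p * k}" and c: "?c \<in> {1..4 * p * k}" using b(1-3) by auto
    have im: "h ` V = {h ?a, h ?c}" for h :: "nat \<Rightarrow> 'z"
      by (subst b(4)) simp
    note f = face_index_range[OF p]
    have "(\<exists>j \<in> {1} \<union> {2 * i | i. i \<in> {1..p}}. leg_colour p k ` V = {Plain j, Star j}) \<longleftrightarrow>
        odd ?a \<noteq> odd ?c \<and> face_index p (?a div 2) = face_index p (?c div 2)"
      unfolding im leg_colour_eq[OF a p] leg_colour_eq[OF c p] by (rule letter_pair_iff[OF f f])
    moreover have "(\<exists>v. leg_label p u k ` V = {v}) \<longleftrightarrow> lab ((?a - 1) div 2) = lab ((?c - 1) div 2)"
      unfolding im leg_label_eq[OF a p] leg_label_eq[OF c p] lab_def by auto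
    ultimately show "?good V \<longleftrightarrow> legs_ok lab (face_index p) ?a ?c"
      unfolding legs_ok_def by blast
    assume ok: "legs_ok lab (face_index p) ?a ?c"
    have "block_label p u k V = lab ((?a - 1) div 2)"
      unfolding block_label_def leg_label_eq[OF a p] lab_def ..
    moreover have "block_dim p k d V = d (face_index p (?a div 2))"
      using f[of "?a div 2"]
      by (auto simp: block_dim_def leg_colour_eq[OF a p] leg_letter_def face_letter_index_def Let_def)
    ultimately show "block_weight p u k d \<kappa> \<sigma> V = pair_weight True \<sigma> V"
      using ok by (simp add: block_weight_def pair_weight_def leg_cumulant_def leg_dim_def)
  qed
  have sub: "NC2_W0 p u k = {\<sigma> \<in> NC2 (4 * p * k). \<forall>V\<in>\<sigma>. legs_ok lab (face_index p) (Min V) (Max V)}"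
    unfolding NC2_W0_def by (intro Collect_cong conj_cong ball_cong refl block)
  have "(\<Sum>\<sigma>\<in>NC2_W0 p u k. \<Prod>V\<in>\<sigma>. block_weight p u k d \<kappa> \<sigma> V) =
      (\<Sum>\<sigma>\<in>NC2_W0 p u k. \<Prod>V\<in>\<sigma>. pair_weight True \<sigma> V)"
    unfolding sub by (intro sum.cong prod.cong refl weight) auto
  also have "\<dots> = (\<Sum>\<sigma>\<in>NC2 (4 * p * k). \<Prod>V\<in>\<sigma>. pair_weight True \<sigma> V)"
  proof (rule sum.mono_neutral_left)
    show "\<forall>\<sigma>\<in>NC2 (4 * p * k) - NC2_W0 p u k. (\<Prod>V\<in>\<sigma>. pair_weight True \<sigma> V) = 0"
    proof
      fix \<sigma> assume s: "\<sigma> \<in> NC2 (4 * p * k) - NC2_W0 p u k"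
      then obtain V where "V \<in> \<sigma>" "\<not> legs_ok lab (face_index p) (Min V) (Max V)" unfolding sub by blast
      moreover have "finite \<sigma>" using s pairings_finite unfolding NC2_pairings by blast
      ultimately show "(\<Prod>V\<in>\<sigma>. pair_weight True \<sigma> V) = 0"
        by (intro prod_zero) (auto simp: pair_weight_def intro!: bexI[of _ V])
    qed
  qed (auto simp: sub NC2_pairings finite_pairings)
  also have "\<dots> = pair_sum True 1 (4 * p * k + 1)"
    by (simp add: pair_sum_def NC2_pairings)
  finally show ?thesis .
qed

text \<open>Consecutive factors \<open>X\<^sub>l X\<^sub>l\<^sub>+\<^sub>1\<close>, the middle of \<open>BB\<^sup>*\<close> and consecutive factors \<open>BB\<^sup>*\<close> all meet in a square
of a projection, which is again the projection.\<close>

lemma B_prod_path_mat: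
  fixes N :: "nat \<Rightarrow> nat \<Rightarrow> nat" and Y :: "'u \<Rightarrow> nat \<Rightarrow> 'w \<Rightarrow> complex mat"
  assumes p: "1 \<le> p" and Y: "\<And>l. l \<in> {1..p} \<Longrightarrow> Y (u l) n \<omega> \<in> carrier_mat n n \<and> hermitian_mat (Y (u l) n \<omega>)"
  defines "B \<equiv> B_prod p N Y u n \<omega>"
  shows "block_diag N 1 n * (B * mat_adjoint B) ^\<^sub>m k =
    mat_list_prod n (map (case_sum (\<lambda>v. Y v n \<omega>) (\<lambda>c. block_diag N c n))
      (path_word (\<lambda>t. u (label_index p t)) (face_index p) 0 (2 * p * k)))"
proof -
  let ?lab = "\<lambda>t. u (label_index p t)" and ?face = "face_index p"
  let ?D = "\<lambda>c. block_diag N c n" and ?y = "\<lambda>v. Y v n \<omega>"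
  interpret block_path n ?y ?D ?lab ?face
    using Y label_index_range[OF p] by unfold_locales (auto simp: block_diag_mult)
  have face: "?face t = t + 1" if "t \<le> p" for t using that p by (simp add: face_index_def)
  have lab: "?lab t = u (t + 1)" if "t < p" for t using that by (simp add: label_index_def)
  have "mat_list_prod n (map (\<lambda>l. X_block N Y u l n \<omega>) [Suc i..<p + 1]) = path_mat i p" if "i < p" for i
    using that
  proof (induction "p - Suc i" arbitrary: i)
    case 0
    hence i: "Suc i = p" by simp
    have "path_mat i p = ?D (?face i) * (?y (?lab i) * ?D (?face p))"
      using path_mat_step[of i p] path_mat_refl[of p] 0 unfolding i by simp
    also have "\<dots> = X_block N Y u p n \<omega>"
      using i face[of i] face[of p] lab[of i] y[of i] assoc_mult_mat[OF D[of "?face i"] y[of i] D[of "?face p"]]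
      by (simp add: X_block_def)
    also have "\<dots> = X_block N Y u p n \<omega> * 1\<^sub>m n"
    proof (rule right_mult_one_mat[symmetric])
      show "X_block N Y u p n \<omega> \<in> carrier_mat n n"
        using Y[of p] p by (auto simp: X_block_def intro!: mult_carrier_mat[of _ n n])
    qed
    also have "\<dots> = mat_list_prod n (map (\<lambda>l. X_block N Y u l n \<omega>) [Suc i..<p + 1])"
      unfolding i by (simp add: mat_list_prod_Cons mat_list_prod_Nil)
    finally show ?case by simp
  next
    case (Suc m)
    hence i: "Suc i < p" by simp
    have "mat_list_prod n (map (\<lambda>l. X_block N Y u l n \<omega>) [Suc i..<p + 1]) =
        X_block N Y u (Suc i) n \<omega> * mat_list_prod n (map (\<lambda>l. X_block N Y u l n \<omega>) [Suc (Suc i)..<p + 1])"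
      using i by (subst upt_conv_Cons) (simp_all add: mat_list_prod_Cons del: upt_Suc)
    also have "mat_list_prod n (map (\<lambda>l. X_block N Y u l n \<omega>) [Suc (Suc i)..<p + 1]) = path_mat (Suc i) p"
      using Suc i by (intro Suc.hyps) auto
    also have "X_block N Y u (Suc i) n \<omega> = ?D (?face i) * ?y (?lab i) * ?D (?face (Suc i))"
      using i face[of i] face[of "Suc i"] lab[of i] by (simp add: X_block_def)
    finally show ?case using i by (simp add: path_mat_step_absorbed)
  qed
  from this[of 0] have B: "B = path_mat 0 p" using p by (simp add: B_def B_prod_def)
  have Bs: "mat_adjoint B = path_mat p (2 * p)"
    unfolding B
  proof (subst path_mat_adjoint[where i = 0])
    fix t
    show "?face (2 * p - t) = ?face t" if "t \<le> p"
      using that p by (cases "t = 0"; cases "t = p") (auto simp: face_index_def Let_def)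
    show "?lab (2 * p - Suc t) = ?lab t" if "t < p"
      using that by (auto simp: label_index_def Let_def intro!: arg_cong[where f = u])
    show "mat_adjoint (?y (?lab t)) = ?y (?lab t)"
      using Y[OF label_index_range[OF p]] by (simp add: hermitian_mat_def)
  qed (auto simp: block_diag_adjoint)
  have "B * mat_adjoint B = path_mat 0 (2 * p)" unfolding Bs unfolding B by (simp add: path_mat_compose)
  moreover have "?D 1 = ?D (?face 0)" using face[of 0] by simp
  ultimately have "?D 1 * (B * mat_adjoint B) ^\<^sub>m k = path_mat 0 (2 * p * k)"
    using path_mat_power[of "2 * p" k] by (simp add: face_index_periodic label_index_periodic)
  thus ?thesis by (simp add: path_mat_def)
qed

theorem theorem4p1:
  fixes p :: nat
    and N :: "nat \<Rightarrow> nat \<Rightarrow> nat"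
    and d :: "nat \<Rightarrow> real"
    and M :: "'w measure"
    and U :: "'u set"
    and Y :: "'u \<Rightarrow> nat \<Rightarrow> 'w \<Rightarrow> complex mat"
    and \<nu> :: "'u \<Rightarrow> nat \<Rightarrow> complex"
    and u :: "nat \<Rightarrow> 'u"
    and k :: nat
  assumes "p \<ge> 1"
    and "\<And>n. (\<Sum>j\<in>{1..p + 1}. N j n) = n"
    and "\<And>j. j \<in> {1..p + 1} \<Longrightarrow> (\<lambda>n. real (N j n) / real n) \<longlonglongrightarrow> d j"
    and "\<And>j. j \<in> {1..p + 1} \<Longrightarrow> d j > 0"
    and "prob_space M"
    and "finite U"
    and "\<And>v n \<omega>. v \<in> U \<Longrightarrow> \<omega> \<in> space M \<Longrightarrow> Y v n \<omega> \<in> carrier_mat n n \<and> hermitian_mat (Y v n \<omega>)"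
    and "\<And>n. indep_matrices M n (\<lambda>v. Y v n) U"
    and A1: "asymptotically_free M Y U id"
    and A2: "asymptotically_free_from_diagonal M Y U"
    and A3: "AE \<omega> in M. \<exists>C. \<forall>v\<in>U. \<forall>n. mat_norm (Y v n \<omega>) \<le> C"
    and "\<And>v. v \<in> U \<Longrightarrow> has_limit_moments M (Y v) (\<nu> v)"
    and "\<And>l. l \<in> {1..p} \<Longrightarrow> u l \<in> U"
  shows "(\<lambda>n. partial_tau M N 1 n
            (\<lambda>\<omega>. (B_prod p N Y u n \<omega> * mat_adjoint (B_prod p N Y u n \<omega>)) ^\<^sub>m k))
         \<longlonglongrightarrow> (\<Sum>\<sigma> \<in> NC2_W0 p u k. \<Prod>V\<in>\<sigma>. block_weight p u k d (\<lambda>v. free_cumulant (\<nu> v)) \<sigma> V)"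
proof -
  note p = assms(1) and sums = assms(2) and conv = assms(3) and M = assms(5) and Y = assms(7)
    and moments = assms(12) and uU = assms(13)
  define \<Delta> where "\<Delta> = (\<lambda>i n. block_diag N i n)"
  define a where "a = case_sum Y (\<lambda>i n \<omega>. \<Delta> i n)"
  define dm :: "nat \<Rightarrow> complex" where "dm = (\<lambda>f. of_real (d f))"
  define lab where "lab = (\<lambda>t. u (label_index p t))"
  define \<kappa> where "\<kappa> = (\<lambda>v. free_cumulant (\<nu> v))"
  let ?face = "face_index p" and ?I = "U <+> (UNIV :: nat set)"
  let ?path = "path_word lab ?face"
  have "asymptotically_free M a ?I isl"
    unfolding a_def
  proof (rule A2[unfolded asymptotically_free_from_diagonal_def, rule_format])
    show "\<exists>\<psi>. has_joint_limit M (\<lambda>i n \<omega>. \<Delta> i n) UNIV \<psi>"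
      unfolding \<Delta>_def using sums conv M by (rule block_diag_joint_limit)
    show "\<exists>C. \<forall>n. mat_norm (\<Delta> i n) \<le> C" for i
      unfolding \<Delta>_def using block_diag_norm by blast
  qed (simp_all add: \<Delta>_def block_diag_diagonal)
  then obtain \<phi> where lim: "has_joint_limit M a ?I \<phi>" and free: "free_family \<phi> ?I isl"
    by (auto simp: asymptotically_free_def)
  from A1 obtain \<phi>' where lim': "has_joint_limit M Y U \<phi>'" and free': "free_family \<phi>' U id"
    by (auto simp: asymptotically_free_def)
  have tau_lim: "(\<lambda>n. tau M n (\<lambda>\<omega>. mat_list_prod n (map (\<lambda>i. a i n \<omega>) w))) \<longlonglongrightarrow> \<phi> w" if "w \<in> lists ?I" for w
    using lim that by (auto simp: has_joint_limit_def)
  have tau_lim': "(\<lambda>n. tau M n (\<lambda>\<omega>. mat_list_prod n (map (\<lambda>i. Y i n \<omega>) w))) \<longlonglongrightarrow> \<phi>' w" if "w \<in> lists U" for w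
    using lim' that by (auto simp: has_joint_limit_def)
  have unit: "\<phi> [] = 1" and unit': "\<phi>' [] = 1"
    using tau_lim[of "[]"] tau_lim'[of "[]"] tau_one_limit[OF M]
    by (auto simp: mat_list_prod_Nil intro: LIMSEQ_unique)
  have restrict: "\<phi> (map Inl w) = \<phi>' w" if "w \<in> lists U" for w
  proof -
    have "map Inl w \<in> lists ?I" using that by (induction w) auto
    from tau_lim[OF this] tau_lim'[OF that] show ?thesis
      by (auto simp: a_def comp_def intro: LIMSEQ_unique)
  qed
  have moment: "\<phi>' (replicate m v) = \<nu> v m" if v: "v \<in> U" for v m
  proof -
    have "tau M n (\<lambda>\<omega>. mat_list_prod n (map (\<lambda>i. Y i n \<omega>) (replicate m v))) = tau M n (\<lambda>\<omega>. Y v n \<omega> ^\<^sub>m m)" for n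
    proof -
      have "integral\<^sup>L M (\<lambda>\<omega>. mat_trace (mat_list_prod n (map (\<lambda>i. Y i n \<omega>) (replicate m v)))) =
          integral\<^sup>L M (\<lambda>\<omega>. mat_trace (Y v n \<omega> ^\<^sub>m m))"
        using Y[OF v] by (intro Bochner_Integration.integral_cong) (simp_all add: map_replicate mat_list_prod_replicate)
      thus ?thesis by (simp add: tau_def)
    qed
    moreover have "replicate m v \<in> lists U" using v by auto
    ultimately have "(\<lambda>n. tau M n (\<lambda>\<omega>. Y v n \<omega> ^\<^sub>m m)) \<longlonglongrightarrow> \<phi>' (replicate m v)"
      using tau_lim'[of "replicate m v"] by simp
    moreover have "(\<lambda>n. tau M n (\<lambda>\<omega>. Y v n \<omega> ^\<^sub>m m)) \<longlonglongrightarrow> \<nu> v m"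
      using moments[OF v] unfolding has_limit_moments_def by blast
    ultimately show ?thesis by (rule LIMSEQ_unique)
  qed
  \<comment> \<open>Freeness of the \<open>Y\<close>'s: each of them is a group of its own, whose words are powers of one letter.\<close>
  have dyson': "\<phi>' (v # w) = schwinger_dyson \<phi>' (\<kappa> v) v 0 w" if v: "v \<in> U" and w: "w \<in> lists U" for v w
  proof (rule schwinger_dyson_extend[OF free' unit' v _ w])
    fix w assume "w \<in> lists {i \<in> U. id i = id v}"
    hence "w = replicate (length w) v" by (induction w) auto
    moreover have "\<nu> v 0 = 1" using moment[OF v, of 0] unit' by simp
    ultimately show "\<phi>' (v # w) = schwinger_dyson \<phi>' (\<kappa> v) v 0 w"
      using moments_schwinger_dyson[of \<phi>' v "\<nu> v" "length w"] moment[OF v] unfolding \<kappa>_def by metis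
  qed
  \<comment> \<open>Freeness from the diagonal matrices: the words of the first group are those treated in \<open>dyson'\<close>.\<close>
  have dyson: "\<phi> (Inl v # w) = schwinger_dyson \<phi> (\<kappa> v) (Inl v) 0 w" if v: "v \<in> U" and w: "w \<in> lists ?I" for v w
  proof (rule schwinger_dyson_extend[OF free unit _ _ w])
    show "Inl v \<in> ?I" using v by (rule InlI)
    fix w :: "('u + nat) list" assume "w \<in> lists {i \<in> ?I. isl i = isl (Inl v)}"
    hence "\<exists>w'\<in>lists U. w = map Inl w'"
    proof (induction w)
      case (Cons x w)
      then obtain w' x' where "w' \<in> lists U" "w = map Inl w'" "x = Inl x'" "x' \<in> U" by auto
      thus ?case by (intro bexI[of _ "x' # w'"]) auto
    qed simp
    then obtain w' where w': "w' \<in> lists U" "w = map Inl w'" by blast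
    have "\<phi> (Inl v # w) = \<phi>' (v # w')" using restrict[of "v # w'"] v w' by simp
    also have "\<dots> = schwinger_dyson \<phi> (\<kappa> v) (Inl v) 0 w"
      unfolding dyson'[OF v w'(1)] w'(2) using schwinger_dyson_map[of Inl U \<phi> \<phi>' w'] restrict w'(1) by simp
    finally show "\<phi> (Inl v # w) = schwinger_dyson \<phi> (\<kappa> v) (Inl v) 0 w" .
  qed
  have labU: "lab t \<in> U" for t using uU[OF label_index_range[OF p]] by (simp add: lab_def)
  have memR: "Inr c \<in> ?I" for c by (rule InrI) simp
  have memL: "Inl (lab t) \<in> ?I" for t by (rule InlI[OF labU])
  have path_I: "?path i j \<in> lists ?I" for i j using memR labU by (auto simp: path_word_def)
  have aI: "set (map (\<lambda>i. a i n \<omega>) w) \<subseteq> carrier_mat n n" if "w \<in> lists ?I" "\<omega> \<in> space M" for w n \<omega>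
    using that Y by (auto simp: a_def \<Delta>_def)
  have prodI: "mat_list_prod n (map (\<lambda>i. a i n \<omega>) w) \<in> carrier_mat n n" if "w \<in> lists ?I" "\<omega> \<in> space M" for w n \<omega>
    by (rule mat_list_prod_carrier[OF aI[OF that]])
  have cyclic: "\<phi> (v @ w) = \<phi> (w @ v)" if "v \<in> lists ?I" "w \<in> lists ?I" for v w
  proof (rule joint_limit_eqI[OF lim])
    fix n \<omega> assume w: "\<omega> \<in> space M"
    show "mat_trace (mat_list_prod n (map (\<lambda>i. a i n \<omega>) (v @ w))) =
        mat_trace (mat_list_prod n (map (\<lambda>i. a i n \<omega>) (w @ v)))"
      unfolding map_append mat_list_prod_append[OF aI[OF that(1) w] aI[OF that(2) w]]
        mat_list_prod_append[OF aI[OF that(2) w] aI[OF that(1) w]]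
      by (rule mat_trace_commute[OF prodI[OF that(1) w] prodI[OF that(2) w]])
  qed (use that in simp_all)
  have two: "mat_list_prod n (map (\<lambda>i. a i n \<omega>) (Inr c # Inr c' # w)) =
      (block_diag N c n * block_diag N c' n) * mat_list_prod n (map (\<lambda>i. a i n \<omega>) w)"
    if "w \<in> lists ?I" "\<omega> \<in> space M" for c c' w n \<omega>
    using prodI[OF that, of n] by (simp add: mat_list_prod_Cons a_def \<Delta>_def assoc_mult_mat[of _ n n _ n _ n])
  have merge: "\<phi> (Inr c # Inr c # w) = \<phi> (Inr c # w)" if "w \<in> lists ?I" for c w
  proof (rule joint_limit_eqI[OF lim])
    fix n \<omega> assume "\<omega> \<in> space M"
    from two[OF that this, of n c c] show "mat_trace (mat_list_prod n (map (\<lambda>i. a i n \<omega>) (Inr c # Inr c # w))) =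
        mat_trace (mat_list_prod n (map (\<lambda>i. a i n \<omega>) (Inr c # w)))"
      by (simp only: block_diag_mult if_True) (simp add: mat_list_prod_Cons a_def \<Delta>_def)
  qed (use that memR in simp_all)
  have orth: "\<phi> (Inr c # Inr c' # w) = 0" if "w \<in> lists ?I" "c \<noteq> c'" for c c' w
  proof (rule joint_limit_zero[OF lim])
    show "Inr c # Inr c' # w \<in> lists ?I" using that memR by simp
    fix n \<omega> assume w: "\<omega> \<in> space M"
    have "0\<^sub>m n n * mat_list_prod n (map (\<lambda>i. a i n \<omega>) w) = 0\<^sub>m n n"
      by (rule left_mult_zero_mat[OF prodI[OF that(1) w]])
    thus "mat_trace (mat_list_prod n (map (\<lambda>i. a i n \<omega>) (Inr c # Inr c' # w))) = 0"
      unfolding two[OF that(1) w] using that(2) by (simp add: block_diag_mult mat_trace_def)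
  qed
  interpret path_functional lab ?face \<phi> \<kappa> dm
  proof
    fix i
    have "\<phi> [Inr (?face i)] = (if ?face i \<in> {1..p + 1} then of_real (d (?face i)) else 0)"
    proof (rule LIMSEQ_unique)
      show "(\<lambda>n. tau M n (\<lambda>\<omega>. block_diag N (?face i) n)) \<longlonglongrightarrow> \<phi> [Inr (?face i)]"
        using tau_lim[of "[Inr (?face i)]"] memR right_mult_one_mat[OF block_diag_carrier]
        by (simp add: a_def \<Delta>_def mat_list_prod_Cons mat_list_prod_Nil)
    qed (rule block_diag_tau_limit[OF sums conv M])
    thus "\<phi> [Inr (?face i)] = dm (?face i)" using face_index_range[OF p, of i] by (simp add: dm_def)
  next
    fix i j :: nat assume ij: "i < j"
    obtain z where z: "?path (Suc i) j = z @ [Inr (?face j)]" "z \<in> lists ?I"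
    proof (cases "Suc i = j")
      case True
      thus ?thesis using that[of "[]"] by (simp add: path_word_refl)
    next
      case False
      hence "[Suc i..<j] = [Suc i..<j - 1] @ [j - 1]" "Suc (j - 1) = j"
        using ij upt_Suc_append[of "Suc i" "j - 1"] by auto
      hence "?path (Suc i) j = (?path (Suc i) (j - 1) @ [Inl (lab (j - 1))]) @ [Inr (?face j)]"
        by (simp add: path_word_def)
      thus ?thesis using that path_I memL by simp
    qed
    have v: "Inl (lab i) # z \<in> lists ?I" using memL z by simp
    \<comment> \<open>The last projection is moved to the front, where it meets the first one.\<close>
    have "\<phi> (?path i j) = \<phi> ((Inr (?face i) # Inl (lab i) # z) @ [Inr (?face j)])"
      using ij z by (simp add: path_word_step)
    also have "\<dots> = \<phi> (Inr (?face j) # Inr (?face i) # Inl (lab i) # z)"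
      using v memR by (subst cyclic) simp_all
    also have "\<dots> = (if ?face i = ?face j then \<phi> (Inr (?face j) # Inl (lab i) # z) else 0)"
      using merge[OF v] orth[OF v] by auto
    also have "\<phi> (Inr (?face j) # Inl (lab i) # z) = \<phi> ((Inl (lab i) # z) @ [Inr (?face j)])"
      using v memR cyclic[of "[Inr (?face j)]" "Inl (lab i) # z"] by simp
    finally show "\<phi> (?path i j) = (if ?face i = ?face j then \<phi> (Inl (lab i) # ?path (Suc i) j) else 0)"
      by (simp add: z)
    show "\<phi> (Inl (lab i) # ?path (Suc i) j) =
        schwinger_dyson \<phi> (\<kappa> (lab i)) (Inl (lab i)) 0 (?path (Suc i) j)"
      by (rule dyson[OF labU path_I])
  qed
  let ?w = "?path 0 (2 * p * k)"
  have face0: "?face 0 = 1" "?face (2 * p * k) = 1" by (simp_all add: face_index_def)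
  \<comment> \<open>The face that is not enclosed by any pair has dimension \<open>d 1\<close>; it cancels the normalization of \<open>\<tau>\<^sub>1\<close>.\<close>
  have "\<phi> ?w = dm 1 * pair_sum True 1 (4 * p * k + 1)"
    using word_pair_sum[of 0 "2 * p * k"] face0 by (simp add: mult.assoc)
  hence limit: "\<phi> ?w = dm 1 * (\<Sum>\<sigma>\<in>NC2_W0 p u k. \<Prod>V\<in>\<sigma>. block_weight p u k d \<kappa> \<sigma> V)"
    unfolding NC2_W0_sum[OF p] dm_def lab_def by simp
  have "(\<lambda>n. real (N 1 n) / real n) \<longlonglongrightarrow> d 1" "d 1 > 0" using conv[of 1] assms(4)[of 1] p by auto
  hence "(\<lambda>n. of_real (inverse (real (N 1 n) / real n))) \<longlonglongrightarrow> (of_real (inverse (d 1)) :: complex)"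
    by (intro tendsto_of_real tendsto_inverse) auto
  hence "(\<lambda>n. of_real (inverse (real (N 1 n) / real n)) * tau M n (\<lambda>\<omega>. mat_list_prod n (map (\<lambda>i. a i n \<omega>) ?w)))
      \<longlonglongrightarrow> of_real (inverse (d 1)) * \<phi> ?w"
    by (intro tendsto_mult tau_lim path_I)
  also have "of_real (inverse (d 1)) * \<phi> ?w = (\<Sum>\<sigma>\<in>NC2_W0 p u k. \<Prod>V\<in>\<sigma>. block_weight p u k d \<kappa> \<sigma> V)"
    unfolding limit using \<open>d 1 > 0\<close> by (simp add: dm_def)
  finally have main: "(\<lambda>n. of_real (inverse (real (N 1 n) / real n)) *
      tau M n (\<lambda>\<omega>. mat_list_prod n (map (\<lambda>i. a i n \<omega>) ?w))) \<longlonglongrightarrow>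
      (\<Sum>\<sigma>\<in>NC2_W0 p u k. \<Prod>V\<in>\<sigma>. block_weight p u k d \<kappa> \<sigma> V)" .
  have "\<forall>\<^sub>F n in sequentially. of_real (inverse (real (N 1 n) / real n)) *
      tau M n (\<lambda>\<omega>. mat_list_prod n (map (\<lambda>i. a i n \<omega>) ?w)) =
      partial_tau M N 1 n (\<lambda>\<omega>. (B_prod p N Y u n \<omega> * mat_adjoint (B_prod p N Y u n \<omega>)) ^\<^sub>m k)"
    using eventually_gt_at_top[of 0]
  proof eventually_elim
    case (elim n)
    have "integral\<^sup>L M (\<lambda>\<omega>. mat_trace (mat_list_prod n (map (\<lambda>i. a i n \<omega>) ?w))) =
        integral\<^sup>L M (\<lambda>\<omega>. mat_trace (block_diag N 1 n *
          (B_prod p N Y u n \<omega> * mat_adjoint (B_prod p N Y u n \<omega>)) ^\<^sub>m k))"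
    proof (rule Bochner_Integration.integral_cong[OF refl])
      fix \<omega> assume \<omega>: "\<omega> \<in> space M"
      have "a i n \<omega> = case_sum (\<lambda>v. Y v n \<omega>) (\<lambda>c. block_diag N c n) i" for i
        by (simp add: a_def \<Delta>_def split: sum.split)
      moreover have "block_diag N 1 n * (B_prod p N Y u n \<omega> * mat_adjoint (B_prod p N Y u n \<omega>)) ^\<^sub>m k =
          mat_list_prod n (map (case_sum (\<lambda>v. Y v n \<omega>) (\<lambda>c. block_diag N c n)) ?w)"
        unfolding lab_def using Y \<omega> uU by (intro B_prod_path_mat[OF p]) blast
      ultimately show "mat_trace (mat_list_prod n (map (\<lambda>i. a i n \<omega>) ?w)) = mat_trace (block_diag N 1 n *
          (B_prod p N Y u n \<omega> * mat_adjoint (B_prod p N Y u n \<omega>)) ^\<^sub>m k)" by simp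
    qed
    thus ?case using elim by (simp add: tau_def partial_tau_def divide_simps)
  qed
  from Lim_transform_eventually[OF main this] show ?thesis unfolding \<kappa>_def .
qed

end
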